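(* Let $(X^+,T)$ be a transitive locally compact one-sided topological Markov shift over a countably infinite set of states $S$, let $\lambda>0$, and let $\phi:X^+\to\mathbb{R}$ be a $\lambda$-transient potential function with summable variations. Then for every $\mu\in\mathrm{Conf}(\lambda)$ there exists a finite (positive Borel) measure $\nu$ on the $\lambda$-Martin boundary $\mathcal{M}(\lambda)$ such that for every $f\in C_c(X^+)$, $$\mu(f)=\int_{\omega\in\mathcal{M}(\lambda)}K(f,\omega|\lambda)\,d\nu(\omega).$$
   Context: Let $S$ be a countably infinite set and $\mathbb{A}\in\{0,1\}^{S\times S}$. The one-sided topological Markov shift (TMS) is $X^+=\{x\in S^{\mathbb{N}\cup\{0\}}:\mathbb{A}_{(x)_i,(x)_{i+1}}=1\ \forall i\ge 0\}$ with the shift $(Tx)_i=(x)_{i+1}$ and metric $d(x,y)=2^{-\inf\{i\ge0:(x)_i\ne(y)_i\}}$. Cylinders: $[a_0,\dots,a_m]=\{x\in X^+:(x)_i=a_i,\ 0\le i\le m\}$; a finite word is admissible if its cylinder is nonempty. Transitive: for all $a,b\in S$ there is $n\ge1$ with $T^{-n}[a]\cap[b]\neq\varnothing$. Locally compact: $\sum_b\mathbb{A}_{a,b}<\infty$ for every $a\in S$ (then cylinders are compact). $C_c(X^+)$ is the space of real continuous compactly supported functions and $C_c^+(X^+)$ its non-negative members. For $\phi:X^+\to\mathbb{R}$ let $Var_m(\phi)=\sup\{|\phi(x)-\phi(y)|:(x)_i=(y)_i,\ 0\le i\le m-1\}$; $\phi$ has summable variations if $\sum_{m\ge2}Var_m(\phi)<\infty$.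 Ruelle operator: $(L_\phi f)(x)=\sum_{y:Ty=x}e^{\phi(y)}f(y)$. Green's function: $G(f,x|\lambda)=\sum_{n\ge0}\lambda^{-n}(L_\phi^nf)(x)$. $\phi$ is $\lambda$-transient if $G(f,x|\lambda)<\infty$ for every (equivalently, some) $f\in C_c^+(X^+)\setminus\{0\}$ and $x\in X^+$. $\mathrm{Conf}(\lambda)$ is the set of positive Radon measures $\mu$ on $X^+$ with $L_\phi^*\mu=\lambda\mu$, i.e. $\int L_\phi 1_K\,d\mu=\lambda\mu(K)$ for every compact $K\subseteq X^+$. Martin boundary: fix an origin state $o\in S$ and set $K(f,x|\lambda)=G(f,x|\lambda)/G(1_{[o]},x|\lambda)$ for $f\in C_c(X^+)$, $x\in X^+$. Let $\{w_i\}_{i\ge1}$ enumerate all admissible finite words and let $C_{i}>0$ be constants with $K(1_{[w_i]},x|\lambda)\le C_{i}$ for all $x\in X^+$ (such constants exist). Define the metric $$\rho(x,y)=\sum_{i\ge1}\frac{|K(1_{[w_i]},x|\lambda)-K(1_{[w_i]},y|\lambda)|+|1_{[w_i]}(x)-1_{[w_i]}(y)|}{2^i(C_i+1)}.$$ $\widehat{X^+}(\lambda)$ is the completion of $X^+$ with respect to $\rho$, and $\mathcal{M}(\lambda)=\widehat{X^+}(\lambda)\setminus X^+$. For each $f\in C_c(X^+)$, $K(f,\cdot|\lambda)$ extends uniquely to a $\rho$-continuous function on $\widehat{X^+}(\lambda)$, denoted by the same symbol. *)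

theory Defs
  imports "HOL-Analysis.Analysis"
begin

text \<open>The state set is the whole type \<^typ>\<open>'s\<close>; the 0-1 matrix is a relation
  \<open>A :: 's \<Rightarrow> 's \<Rightarrow> bool\<close>. Functions on the shift space are total functions on
  \<^typ>\<open>nat \<Rightarrow> 's\<close> whose values off \<open>tms A\<close> never matter.\<close>

definition tms :: "('s \<Rightarrow> 's \<Rightarrow> bool) \<Rightarrow> (nat \<Rightarrow> 's) set" where
  "tms A = {x. \<forall>i. A (x i) (x (Suc i))}"

definition shift :: "(nat \<Rightarrow> 's) \<Rightarrow> nat \<Rightarrow> 's" where
  "shift x = (\<lambda>i. x (Suc i))"

definition tms_dist :: "(nat \<Rightarrow> 's) \<Rightarrow> (nat \<Rightarrow> 's) \<Rightarrow> real" where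
  "tms_dist x y = (if x = y then 0 else (1/2) ^ (LEAST i. x i \<noteq> y i))"

definition tms_top :: "('s \<Rightarrow> 's \<Rightarrow> bool) \<Rightarrow> (nat \<Rightarrow> 's) topology" where
  "tms_top A = Metric_space.mtopology (tms A) tms_dist"

definition cylinder :: "('s \<Rightarrow> 's \<Rightarrow> bool) \<Rightarrow> 's list \<Rightarrow> (nat \<Rightarrow> 's) set" where
  "cylinder A w = {x \<in> tms A. \<forall>i < length w. x i = w ! i}"

text \<open>The empty word is excluded: cylinders \<open>[a\<^sub>0,\<dots>,a\<^sub>m]\<close> have \<open>m \<ge> 0\<close>.\<close>

definition admissible_words :: "('s \<Rightarrow> 's \<Rightarrow> bool) \<Rightarrow> 's list set" where
  "admissible_words A = {w. w \<noteq> [] \<and> cylinder A w \<noteq> {}}"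

definition tms_transitive :: "('s \<Rightarrow> 's \<Rightarrow> bool) \<Rightarrow> bool" where
  "tms_transitive A \<longleftrightarrow>
     (\<forall>a b. \<exists>n\<ge>1. {x \<in> tms A. (shift ^^ n) x \<in> cylinder A [a]} \<inter> cylinder A [b] \<noteq> {})"

definition tms_locally_compact :: "('s \<Rightarrow> 's \<Rightarrow> bool) \<Rightarrow> bool" where
  "tms_locally_compact A \<longleftrightarrow> (\<forall>a. finite {b. A a b})"

definition Cc :: "('s \<Rightarrow> 's \<Rightarrow> bool) \<Rightarrow> ((nat \<Rightarrow> 's) \<Rightarrow> real) set" where
  "Cc A = {f. continuous_map (tms_top A) euclideanreal f \<and>
              compactin (tms_top A) (tms_top A closure_of {x \<in> tms A. f x \<noteq> 0})}"

definition Cc_pos :: "('s \<Rightarrow> 's \<Rightarrow> bool) \<Rightarrow> ((nat \<Rightarrow> 's) \<Rightarrow> real) set" where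
  "Cc_pos A = {f \<in> Cc A. \<forall>x \<in> tms A. f x \<ge> 0}"

text \<open>Variations may be infinite, hence take values in \<^typ>\<open>ennreal\<close>.\<close>

definition Var :: "('s \<Rightarrow> 's \<Rightarrow> bool) \<Rightarrow> nat \<Rightarrow> ((nat \<Rightarrow> 's) \<Rightarrow> real) \<Rightarrow> ennreal" where
  "Var A m \<phi> = (SUP (x, y) \<in> {(x, y). x \<in> tms A \<and> y \<in> tms A \<and> (\<forall>i<m. x i = y i)}.
                   ennreal \<bar>\<phi> x - \<phi> y\<bar>)"

definition summable_variations :: "('s \<Rightarrow> 's \<Rightarrow> bool) \<Rightarrow> ((nat \<Rightarrow> 's) \<Rightarrow> real) \<Rightarrow> bool" where
  "summable_variations A \<phi> \<longleftrightarrow> (\<Sum>m. Var A (m + 2) \<phi>) < \<infinity>"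

text \<open>A point may have infinitely many preimages, but for \<open>f\<close> vanishing off a compact
  set only finitely many terms of the sum are nonzero.\<close>

definition ruelle ::
  "('s \<Rightarrow> 's \<Rightarrow> bool) \<Rightarrow> ((nat \<Rightarrow> 's) \<Rightarrow> real) \<Rightarrow> ((nat \<Rightarrow> 's) \<Rightarrow> real) \<Rightarrow> (nat \<Rightarrow> 's) \<Rightarrow> real" where
  "ruelle A \<phi> f x = (\<Sum>\<^sub>\<infinity>y\<in>{y \<in> tms A. shift y = x}. exp (\<phi> y) * f y)"

definition green_term ::
  "('s \<Rightarrow> 's \<Rightarrow> bool) \<Rightarrow> ((nat \<Rightarrow> 's) \<Rightarrow> real) \<Rightarrow> real \<Rightarrow> ((nat \<Rightarrow> 's) \<Rightarrow> real) \<Rightarrow> (nat \<Rightarrow> 's) \<Rightarrow> nat \<Rightarrow> real" where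
  "green_term A \<phi> lam f x n = (ruelle A \<phi> ^^ n) f x / lam ^ n"

definition green ::
  "('s \<Rightarrow> 's \<Rightarrow> bool) \<Rightarrow> ((nat \<Rightarrow> 's) \<Rightarrow> real) \<Rightarrow> real \<Rightarrow> ((nat \<Rightarrow> 's) \<Rightarrow> real) \<Rightarrow> (nat \<Rightarrow> 's) \<Rightarrow> real" where
  "green A \<phi> lam f x = (\<Sum>n. green_term A \<phi> lam f x n)"

text \<open>For \<open>f \<ge> 0\<close> the terms are nonnegative, so finiteness of the Green's function
  is summability of the series.\<close>

definition transient :: "('s \<Rightarrow> 's \<Rightarrow> bool) \<Rightarrow> ((nat \<Rightarrow> 's) \<Rightarrow> real) \<Rightarrow> real \<Rightarrow> bool" where
  "transient A \<phi> lam \<longleftrightarrow>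
     (\<forall>f \<in> Cc_pos A. (\<exists>x \<in> tms A. f x \<noteq> 0) \<longrightarrow>
        (\<forall>x \<in> tms A. summable (green_term A \<phi> lam f x)))"

definition borel_sigma :: "'a topology \<Rightarrow> 'a measure" where
  "borel_sigma X = sigma (topspace X) {U. openin X U}"

definition radon_measure :: "'a topology \<Rightarrow> 'a measure \<Rightarrow> bool" where
  "radon_measure X \<mu> \<longleftrightarrow>
     sets \<mu> = sets (borel_sigma X) \<and>
     (\<forall>K. compactin X K \<longrightarrow> emeasure \<mu> K < \<infinity>) \<and>
     (\<forall>B \<in> sets \<mu>. emeasure \<mu> B = (SUP K \<in> {K. compactin X K \<and> K \<subseteq> B}. emeasure \<mu> K))"

definition Conf ::
  "('s \<Rightarrow> 's \<Rightarrow> bool) \<Rightarrow> ((nat \<Rightarrow> 's) \<Rightarrow> real) \<Rightarrow> real \<Rightarrow> (nat \<Rightarrow> 's) measure set" where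
  "Conf A \<phi> lam = {\<mu>. radon_measure (tms_top A) \<mu> \<and>
     (\<forall>K. compactin (tms_top A) K \<longrightarrow>
        (\<integral>\<^sup>+ x. ennreal (ruelle A \<phi> (indicator K) x) \<partial>\<mu>) = ennreal lam * emeasure \<mu> K)}"

definition martin_kernel ::
  "('s \<Rightarrow> 's \<Rightarrow> bool) \<Rightarrow> ((nat \<Rightarrow> 's) \<Rightarrow> real) \<Rightarrow> real \<Rightarrow> 's \<Rightarrow> ((nat \<Rightarrow> 's) \<Rightarrow> real) \<Rightarrow> (nat \<Rightarrow> 's) \<Rightarrow> real" where
  "martin_kernel A \<phi> lam orig f x =
     green A \<phi> lam f x / green A \<phi> lam (indicator (cylinder A [orig])) x"

text \<open>The enumeration \<open>w\<close> and the constants \<open>C\<close> are indexed by \<open>i \<ge> 1\<close>,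
  hence the \<^const>\<open>Suc\<close>.\<close>

definition martin_dist ::
  "('s \<Rightarrow> 's \<Rightarrow> bool) \<Rightarrow> ((nat \<Rightarrow> 's) \<Rightarrow> real) \<Rightarrow> real \<Rightarrow> 's \<Rightarrow> (nat \<Rightarrow> 's list) \<Rightarrow> (nat \<Rightarrow> real)
    \<Rightarrow> (nat \<Rightarrow> 's) \<Rightarrow> (nat \<Rightarrow> 's) \<Rightarrow> real" where
  "martin_dist A \<phi> lam orig w C x y =
     (\<Sum>j. let i = Suc j; I = indicator (cylinder A (w i)) :: (nat \<Rightarrow> 's) \<Rightarrow> real in
        (\<bar>martin_kernel A \<phi> lam orig I x - martin_kernel A \<phi> lam orig I y\<bar> + \<bar>I x - I y\<bar>)
          / (2 ^ i * (C i + 1)))"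

text \<open>\<open>Y\<close> together with the embedding \<open>\<iota>\<close> is a completion of \<open>(M, d)\<close>. Such a pair is
  unique up to isometry, and it exists for every metric space by
  \<open>Metric_space.metric_completion\<close>.\<close>

definition is_completion ::
  "'a set \<Rightarrow> ('a \<Rightarrow> 'a \<Rightarrow> real) \<Rightarrow> 'b metric \<Rightarrow> ('a \<Rightarrow> 'b) \<Rightarrow> bool" where
  "is_completion M d Y \<iota> \<longleftrightarrow>
     mcomplete_of Y \<and> \<iota> \<in> M \<rightarrow> mspace Y \<and>
     (\<forall>x\<in>M. \<forall>y\<in>M. mdist Y (\<iota> x) (\<iota> y) = d x y) \<and>
     mtopology_of Y closure_of (\<iota> ` M) = mspace Y"

definition boundary_in :: "'a set \<Rightarrow> 'b metric \<Rightarrow> ('a \<Rightarrow> 'b) \<Rightarrow> 'b set" where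
  "boundary_in M Y \<iota> = mspace Y - \<iota> ` M"

text \<open>The value at \<open>\<omega>\<close> of the unique continuous extension of \<open>k\<close> from \<open>M\<close> to \<open>Y\<close>.
  The description is of the value, not of the function, since extensions are
  determined only on \<^term>\<open>mspace Y\<close>.\<close>

definition cont_extension ::
  "'a set \<Rightarrow> 'b metric \<Rightarrow> ('a \<Rightarrow> 'b) \<Rightarrow> ('a \<Rightarrow> real) \<Rightarrow> 'b \<Rightarrow> real" where
  "cont_extension M Y \<iota> k \<omega> =
     (THE c. \<exists>g. continuous_map (mtopology_of Y) euclideanreal g \<and>
                 (\<forall>x\<in>M. g (\<iota> x) = k x) \<and> g \<omega> = c)"

end

theory Submission
  imports Defs "HOL-Probability.Helly_Selection"
begin

text \<open>For a finite set \<open>F\<close> of states let \<open>D\<close> be the set of points that start in \<open>F\<close> and never return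
  to it. By transience and the Borel--Cantelli lemma almost every orbit visits \<open>F\<close> finitely often, so
  splitting at the time of the last visit and using \<open>L\<^sub>\<phi>\<^sup>* \<mu> = \<lambda> \<mu>\<close> gives
  \<open>\<mu>(f) = \<integral>\<^sub>D G(f, x | \<lambda>) d\<mu>(x)\<close> for \<open>f\<close> supported in \<open>F\<close>. Hence \<open>\<mu>(f) = \<integral> K(f, \<cdot> | \<lambda>) d\<nu>\<^sub>F\<close> with
  \<open>d\<nu>\<^sub>F = 1\<^sub>D G(1\<^bsub>[o]\<^esub>, \<cdot> | \<lambda>) d\<mu>\<close>, whose total mass is \<open>\<mu>([o])\<close> once \<open>o \<in> F\<close>. Now let \<open>F\<close> exhaust the states and take
  a weak limit on the compact completion. The limit does not charge \<open>X\<^sup>+\<close>, because \<open>\<nu>\<^sub>F\<close> gives no mass to \<open>[a]\<close>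
  as soon as \<open>F\<close> contains the finitely many successors of \<open>a\<close>.\<close>

section \<open>Weak limits on compact metric spaces\<close>

text \<open>Everything rests on one duality: L/lam is dual to composition with the shift under mu,
  so summing over n turns the integrals of f times h(T^n x) into the integral of G(f) times h. With
  h = 1_[a] it bounds the total measure of visits to [a] from [b] by mu([a]) times the supremum of
  G(1_[b]) on [a]. Summable variations make the values of G(1_[b]) on [a] comparable, so this
  supremum is finite, and Borel-Cantelli applies. With h = 1_D it is the last-exit formula, because
  exactly one shift of the point enters D. The mass of nu_F does not depend on F since K(1_[o]) = 1,
  so the laws can be normalised; if mu([o]) = 0, the same formula makes mu vanish on C_c. The two
  summands of rho have separate tasks: the first extends the kernels to the completion, the second
  extends the indicators 1_[a], whose limit integrals show that X+ is not charged. The bounds C_i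
  give compactness. Conformality is given only on compact sets and the Ruelle operator only as a
  real-valued sum, so the argument passes to an \<open>ennreal\<close>-valued operator on all
  nonnegative Borel functions, where sums and integrals commute freely.\<close>

lemma space_borel_sigma [simp]: "space (borel_sigma X) = topspace X"
  unfolding borel_sigma_def by (rule space_measure_of) (auto dest: openin_subset)

lemma sets_borel_sigma: "sets (borel_sigma X) = sigma_sets (topspace X) {U. openin X U}"
  unfolding borel_sigma_def by (rule sets_measure_of) (auto dest: openin_subset)

lemma openin_borel_sigma: "openin X U \<Longrightarrow> U \<in> sets (borel_sigma X)"
  by (auto simp: sets_borel_sigma)

lemma borel_sigma_euclidean: "borel_sigma euclidean = borel"
  by (simp add: borel_sigma_def borel_def)

lemma measurable_borel_sigmaI:
  assumes "f \<in> space M \<rightarrow> topspace X"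
    and "\<And>U. openin X U \<Longrightarrow> f -` U \<inter> space M \<in> sets M"
  shows "f \<in> measurable M (borel_sigma X)"
  unfolding borel_sigma_def
proof (rule measurable_measure_of)
  show "{U. openin X U} \<subseteq> Pow (topspace X)"
    by (auto dest: openin_subset)
qed (use assms in auto)

lemma continuous_map_borel_sigma:
  assumes "continuous_map X Z f"
  shows "f \<in> measurable (borel_sigma X) (borel_sigma Z)"
proof (rule measurable_borel_sigmaI)
  show "f \<in> space (borel_sigma X) \<rightarrow> topspace Z"
    using assms by (auto simp: continuous_map_def)
  show "\<And>U. openin Z U \<Longrightarrow> f -` U \<inter> space (borel_sigma X) \<in> sets (borel_sigma X)"
    using openin_borel_sigma[OF openin_continuous_map_preimage[OF assms]]
    by (simp add: vimage_def Int_def conj_commute)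
qed

lemma continuous_map_borel_measurable:
  "continuous_map X euclideanreal f \<Longrightarrow> f \<in> borel_measurable (borel_sigma X)"
  using continuous_map_borel_sigma[of X euclideanreal f] by (simp add: borel_sigma_euclidean)

text \<open>The Cantor-set coding, with digits 0 and 2 in base 3. Base 2 would give 0111... and
  1000... the same value; base 3 leaves gaps that make the code injective with a quantitative
  inverse.\<close>

definition ternary_code :: "(nat \<Rightarrow> bool) \<Rightarrow> real" where
  "ternary_code b = (\<Sum>i. 2 * of_bool (b i) * (1/3) ^ Suc i)"

lemma ternary_code_sums: "(\<lambda>i. 2 * (1/3::real) ^ Suc i) sums 1"
  using sums_mult[OF geometric_sums[of "1/3::real"], of "2/3"] by (simp add: field_simps)

lemma ternary_code_summable: "summable (\<lambda>i. 2 * of_bool (b i) * (1/3::real) ^ Suc i)"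
  by (rule summable_comparison_test'[OF sums_summable[OF ternary_code_sums], of 0]) auto

lemma ternary_code_range: "0 \<le> ternary_code b" "ternary_code b \<le> 1"
proof -
  show "0 \<le> ternary_code b"
    unfolding ternary_code_def by (rule suminf_nonneg[OF ternary_code_summable]) auto
  have "ternary_code b \<le> (\<Sum>i. 2 * (1/3) ^ Suc i)"
    unfolding ternary_code_def
    by (rule suminf_le[OF _ ternary_code_summable sums_summable[OF ternary_code_sums]]) auto
  then show "ternary_code b \<le> 1"
    using ternary_code_sums by (simp add: sums_iff)
qed

text \<open>At the first disagreement \<open>k\<close> the sums differ by 2 * 3^-(k+1), while all
  later digits together can undo at most 3^-(k+1).\<close>

lemma ternary_code_separated:
  assumes "b j \<noteq> b' j"
  shows "(1/3) ^ Suc j \<le> \<bar>ternary_code b - ternary_code b'\<bar>"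
proof -
  define k where "k = (LEAST i. b i \<noteq> b' i)"
  have k: "b k \<noteq> b' k" "k \<le> j" and below: "\<And>i. i < k \<Longrightarrow> b i = b' i"
    unfolding k_def using assms
    by (rule LeastI, rule Least_le) (use not_less_Least in blast)
  define d :: "nat \<Rightarrow> real"
    where "d i = 2 * of_bool (b i) * (1/3) ^ Suc i - 2 * of_bool (b' i) * (1/3) ^ Suc i" for i
  have sd: "summable d"
    unfolding d_def by (intro summable_diff ternary_code_summable)
  have tail_sums: "(\<lambda>i. 2 * (1/3::real) ^ Suc (i + Suc k)) sums (1/3) ^ Suc k"
    using sums_mult2[OF ternary_code_sums, of "(1/3) ^ Suc k"] by (simp add: power_add mult_ac)
  have "\<bar>\<Sum>i. d (i + Suc k)\<bar> \<le> (\<Sum>i. 2 * (1/3) ^ Suc (i + Suc k))"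
    unfolding real_norm_def[symmetric]
    by (rule norm_suminf_le[OF _ sums_summable[OF tail_sums]]) (simp add: d_def)
  then have tail: "\<bar>\<Sum>i. d (i + Suc k)\<bar> \<le> (1/3) ^ Suc k"
    using tail_sums by (simp add: sums_iff)
  have "ternary_code b - ternary_code b' = suminf d"
    unfolding ternary_code_def d_def by (rule suminf_diff[OF ternary_code_summable ternary_code_summable])
  also have "\<dots> = (\<Sum>i. d (i + Suc k)) + (\<Sum>i<Suc k. d i)"
    by (rule suminf_split_initial_segment[OF sd])
  also have "(\<Sum>i<Suc k. d i) = d k"
    using below by (simp add: d_def)
  finally have eq: "ternary_code b - ternary_code b' = (\<Sum>i. d (i + Suc k)) + d k" .
  have "\<bar>d k\<bar> = 2 * (1/3) ^ Suc k"
    using k(1) by (auto simp: d_def)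
  with tail have "(1/3) ^ Suc k \<le> \<bar>ternary_code b - ternary_code b'\<bar>"
    unfolding eq by linarith
  moreover have "(1/3::real) ^ Suc j \<le> (1/3) ^ Suc k"
    using k(2) by (intro power_decreasing) auto
  ultimately show ?thesis by linarith
qed


text \<open>The ternary digits of \<open>c x\<close> record which balls of finite \<open>2\<^sup>-\<^sup>k\<close>-nets contain \<open>x\<close>, so nearby codes force
  a common small ball.\<close>

lemma compact_metric_real_coding:
  fixes Y :: "'b metric"
  assumes cpt: "compact_space (mtopology_of Y)"
  obtains c :: "'b \<Rightarrow> real"
  where "c \<in> borel_measurable (borel_sigma (mtopology_of Y))" "\<And>x. 0 \<le> c x" "\<And>x. c x \<le> 1"
    and "\<And>\<epsilon>. \<epsilon> > 0 \<Longrightarrow>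
      \<exists>\<delta>>0. \<forall>x\<in>mspace Y. \<forall>y\<in>mspace Y. \<bar>c x - c y\<bar> < \<delta> \<longrightarrow> mdist Y x y < \<epsilon>"
proof -
  interpret Y: Metric_space "mspace Y" "mdist Y" by (rule Metric_space_mspace_mdist)
  have top: "mtopology_of Y = Y.mtopology" by (simp add: mtopology_of_def)
  have "Y.mtotally_bounded (mspace Y)"
    using cpt Y.compact_space_eq_mcomplete_mtotally_bounded top by simp
  then have "\<exists>K. finite K \<and> K \<subseteq> mspace Y \<and> mspace Y \<subseteq> (\<Union>x\<in>K. Y.mball x ((1/2) ^ k))" for k :: nat
    unfolding Y.mtotally_bounded_def by simp
  then obtain K where K: "\<And>k::nat. finite (K k)" "\<And>k. K k \<subseteq> mspace Y"
      "\<And>k. mspace Y \<subseteq> (\<Union>x\<in>K k. Y.mball x ((1/2) ^ k))"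
    by metis
  obtain l where l: "\<And>k. set (l k) = K k"
    using finite_list[OF K(1)] by metis
  \<comment> \<open>\<open>prod_decode\<close> runs over pairs of a level \<open>k\<close> and a
    position \<open>i\<close> in its net. Positions beyond the end of the list give arbitrary balls,
    which are harmless because they are open.\<close>
  define U where "U j = (case prod_decode j of (k, i) \<Rightarrow> Y.mball (l k ! i) ((1/2) ^ k))" for j
  define c where "c x = ternary_code (\<lambda>j. x \<in> U j)" for x
  have U: "U j \<in> sets (borel_sigma (mtopology_of Y))" for j
    by (auto simp: U_def top split: prod.split intro: openin_borel_sigma)
  have "c \<in> borel_measurable (borel_sigma (mtopology_of Y))"
    unfolding c_def ternary_code_def of_bool_def using U by measurable
  moreover have "0 \<le> c x" "c x \<le> 1" for x
    using ternary_code_range by (simp_all add: c_def)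
  moreover have "\<exists>\<delta>>0. \<forall>x\<in>mspace Y. \<forall>y\<in>mspace Y. \<bar>c x - c y\<bar> < \<delta> \<longrightarrow> mdist Y x y < \<epsilon>"
    if "\<epsilon> > 0" for \<epsilon>
  proof -
    obtain k where k: "(1/2) ^ k < \<epsilon> / 2"
      using real_arch_pow_inv[of "\<epsilon> / 2" "1/2"] \<open>\<epsilon> > 0\<close> by (auto simp del: power_one_over)
    \<comment> \<open>A code difference below 3^-(J+1) fixes membership in all balls of level
      \<open>k\<close> at once; the 0 keeps \<open>Max\<close> meaningful for an empty net.\<close>
    define J where "J = Max ((\<lambda>i. prod_encode (k, i)) ` {..<length (l k)} \<union> {0})"
    have J: "prod_encode (k, i) \<le> J" if "i < length (l k)" for i
      unfolding J_def using that by (intro Max_ge) auto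
    have "mdist Y x y < \<epsilon>"
      if xy: "x \<in> mspace Y" "y \<in> mspace Y" "\<bar>c x - c y\<bar> < (1/3) ^ Suc J" for x y
    proof -
      obtain p where p: "p \<in> K k" "x \<in> Y.mball p ((1/2) ^ k)"
        using K(3)[of k] xy(1) by blast
      then obtain i where i: "i < length (l k)" "l k ! i = p"
        using l by (metis in_set_conv_nth)
      let ?j = "prod_encode (k, i)"
      have "(1/3::real) ^ Suc J \<le> (1/3) ^ Suc ?j"
        using J[OF i(1)] by (intro power_decreasing) auto
      then have "(x \<in> U ?j) = (y \<in> U ?j)"
        using ternary_code_separated[of "\<lambda>j. x \<in> U j" ?j "\<lambda>j. y \<in> U j"] xy(3)
        unfolding c_def by linarith
      then have "y \<in> Y.mball p ((1/2) ^ k)"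
        using p i by (simp add: U_def)
      with p(2) have "mdist Y p x < (1/2) ^ k" "mdist Y p y < (1/2) ^ k" "p \<in> mspace Y"
        by (auto simp: Y.in_mball)
      moreover have "mdist Y x y \<le> mdist Y x p + mdist Y p y"
        using xy \<open>p \<in> mspace Y\<close> by (intro Y.triangle)
      ultimately show ?thesis
        using k Y.commute[of x p] by linarith
    qed
    then show ?thesis
      by (intro exI[of _ "(1/3) ^ Suc J"]) simp
  qed
  ultimately show ?thesis by (rule that)
qed

text \<open>Helly's theorem applies to the laws of \<open>c\<close> on the real line; the inverse of \<open>c\<close>, which is
  uniformly continuous but defined only on the range of \<open>c\<close>, extends to the closure of that range and
  carries the limit law back to \<open>Y\<close>.\<close>

theorem compact_metric_weak_limit:
  fixes Y :: "'b metric" and P :: "nat \<Rightarrow> 'b measure"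
  assumes cpt: "compact_space (mtopology_of Y)"
    and prob: "\<And>n. prob_space (P n)"
    and setsP: "\<And>n. sets (P n) = sets (borel_sigma (mtopology_of Y))"
  obtains r \<nu> where "strict_mono (r :: nat \<Rightarrow> nat)" "prob_space \<nu>"
    "sets \<nu> = sets (borel_sigma (mtopology_of Y))"
    "\<And>F. continuous_map (mtopology_of Y) euclideanreal F \<Longrightarrow>
       (\<lambda>n. \<integral>x. F x \<partial>P (r n)) \<longlonglongrightarrow> (\<integral>x. F x \<partial>\<nu>)"
proof -
  let ?BY = "borel_sigma (mtopology_of Y)"
  interpret P: prob_space "P n" for n by (rule prob)
  have spP: "space (P n) = mspace Y" for n
    using sets_eq_imp_space_eq[OF setsP[of n]] by simp
  obtain c :: "'b \<Rightarrow> real" where c: "c \<in> borel_measurable ?BY"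
      "\<And>x. 0 \<le> c x" "\<And>x. c x \<le> 1"
    and sep: "\<And>\<epsilon>. \<epsilon> > 0 \<Longrightarrow>
      \<exists>\<delta>>0. \<forall>x\<in>mspace Y. \<forall>y\<in>mspace Y. \<bar>c x - c y\<bar> < \<delta> \<longrightarrow> mdist Y x y < \<epsilon>"
    using compact_metric_real_coding[OF cpt] by blast
  have cP: "c \<in> borel_measurable (P n)" for n
    using c(1) measurable_cong_sets[OF setsP refl] by blast
  have inj: "x = y" if "x \<in> mspace Y" "y \<in> mspace Y" "c x = c y" for x y
  proof (rule ccontr)
    assume "x \<noteq> y"
    then have "mdist Y x y > 0"
      using that Metric_space.mdist_pos_eq[OF Metric_space_mspace_mdist] by metis
    with sep[of "mdist Y x y"] that show False by fastforce
  qed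
  define S where "S = c ` mspace Y"
  define T where "T = closure S"
  define p0 where "p0 = inv_into (mspace Y) c"
  have p0: "p0 (c x) = x" if "x \<in> mspace Y" for x
    using that inj by (auto simp: p0_def intro!: inv_into_f_f inj_onI)
  have "uniformly_continuous_map (submetric euclidean_metric S) Y p0"
    unfolding uniformly_continuous_map_def
  proof (intro conjI allI impI)
    show "p0 \<in> mspace (submetric euclidean_metric S) \<rightarrow> mspace Y"
      using p0 by (auto simp: S_def)
    fix \<epsilon> :: real assume "\<epsilon> > 0"
    from sep[OF this] obtain \<delta> where "\<delta> > 0"
      "\<And>x y. x \<in> mspace Y \<Longrightarrow> y \<in> mspace Y \<Longrightarrow> \<bar>c x - c y\<bar> < \<delta> \<Longrightarrow> mdist Y x y < \<epsilon>" by blast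
    then show "\<exists>\<delta>>0. \<forall>x\<in>mspace (submetric euclidean_metric S). \<forall>y\<in>mspace (submetric euclidean_metric S).
        mdist (submetric euclidean_metric S) y x < \<delta> \<longrightarrow> mdist Y (p0 y) (p0 x) < \<epsilon>"
      using p0 by (intro exI[of _ \<delta>]) (auto simp: S_def dist_real_def)
  qed
  moreover have "mcomplete_of Y"
    using cpt Metric_space.compact_space_eq_mcomplete_mtotally_bounded[OF Metric_space_mspace_mdist[of Y]]
    by (simp add: mtopology_of_def mcomplete_of_def)
  ultimately obtain p where p: "uniformly_continuous_map (submetric euclidean_metric T) Y p"
      "\<And>t. t \<in> S \<Longrightarrow> p t = p0 t"
    using uniformly_continuous_map_extends_to_closure_of[of Y euclidean_metric S p0]
    by (auto simp: T_def)
  have pcont: "continuous_map (top_of_set T) (mtopology_of Y) p"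
    using uniformly_continuous_imp_continuous_map[OF p(1)] by (simp add: mtopology_of_submetric)
  have S01: "S \<subseteq> {0..1}" using c by (auto simp: S_def)
  then have T01: "T \<subseteq> {0..1}"
    unfolding T_def by (intro closure_minimal) auto
  then have cptT: "compact T"
    by (metis T_def bounded_subset bounded_closed_interval closed_closure compact_eq_bounded_closed)
  define Q where "Q n = distr (P n) borel c" for n
  have Q: "real_distribution (Q n)" for n
    unfolding Q_def using cP by (intro real_distribution.intro P.prob_space_distr)
      (auto simp: real_distribution_axioms_def)
  have "tight Q"
    unfolding tight_def
  proof (intro conjI allI impI)
    show "real_distribution (Q n)" for n by (rule Q)
    fix \<epsilon> :: real assume "\<epsilon> > 0"
    \<comment> \<open>The left end is -1 because the half-open interval omits it and
      \<open>c\<close> may take the value 0.\<close>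
    have "measure (Q n) {-1<..1} = 1" for n
    proof -
      have "measure (Q n) {-1<..1} = measure (P n) (c -` {-1<..1} \<inter> space (P n))"
        unfolding Q_def by (rule measure_distr[OF cP]) simp
      also have "c -` {-1<..1} \<inter> space (P n) = space (P n)"
        using less_le_trans[OF _ c(2), of "-1"] c(3) by auto
      finally show ?thesis by (simp add: P.prob_space)
    qed
    with \<open>\<epsilon> > 0\<close> show "\<exists>a b. a < b \<and> (\<forall>n. 1 - \<epsilon> < measure (Q n) {a<..b})"
      by (intro exI[of _ "-1"] exI[of _ 1]) simp
  qed
  from tight_imp_convergent_subsubsequence[OF this strict_mono_id] obtain r m
    where r: "strict_mono r" and m: "real_distribution m" and conv: "weak_conv_m (\<lambda>n. Q (r n)) m"
    by (auto simp: comp_def)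
  interpret m: real_distribution m by (rule m)
  have lim: "(\<lambda>n. \<integral>x. g (c x) \<partial>P (r n)) \<longlonglongrightarrow> (\<integral>t. g t \<partial>m)"
    if g: "continuous_on UNIV g" "\<And>t. \<bar>g t\<bar> \<le> B" for g :: "real \<Rightarrow> real" and B
  proof -
    have "(\<lambda>n. integral\<^sup>L (Q (r n)) g) \<longlonglongrightarrow> integral\<^sup>L m g"
      using g by (intro weak_conv_imp_integral_bdd_continuous_conv[OF Q m conv, of g B])
        (auto simp: continuous_on_eq_continuous_at)
    moreover have "integral\<^sup>L (Q n) g = (\<integral>x. g (c x) \<partial>P n)" for n
      unfolding Q_def using g cP
      by (intro integral_distr) (auto intro: borel_measurable_continuous_onI)
    ultimately show ?thesis by simp
  qed
  have Tne: "T \<noteq> {}"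
    using P.not_empty[of 0] spP[of 0] by (auto simp: T_def S_def)
  \<comment> \<open>To see that \<open>m\<close> is carried by the closed set \<open>T\<close>, test
    with a bounded continuous function that vanishes exactly on \<open>T\<close>: its integrals
    under all \<open>Q n\<close> are 0, hence so is the limit.\<close>
  have infd: "continuous_on UNIV (\<lambda>t. min 1 (infdist t T))"
    by (intro continuous_intros)
  have "(\<lambda>n. \<integral>x. min 1 (infdist (c x) T) \<partial>P (r n)) \<longlonglongrightarrow> (\<integral>t. min 1 (infdist t T) \<partial>m)"
    by (rule lim[OF infd, of 1]) (auto simp: infdist_nonneg)
  moreover have "(\<integral>x. min 1 (infdist (c x) T) \<partial>P n) = 0" for n
  proof -
    have "(\<integral>x. min 1 (infdist (c x) T) \<partial>P n) = (\<integral>x. 0 \<partial>P n)"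
    proof (rule Bochner_Integration.integral_cong[OF refl])
      fix x assume "x \<in> space (P n)"
      then have "c x \<in> T"
        using closure_subset[of S] by (auto simp: T_def S_def spP)
      then show "min 1 (infdist (c x) T) = 0" by simp
    qed
    then show ?thesis by simp
  qed
  ultimately have "(\<integral>t. min 1 (infdist t T) \<partial>m) = 0"
    by (simp add: LIMSEQ_const_iff)
  moreover have "integrable m (\<lambda>t. min 1 (infdist t T))"
    using borel_measurable_continuous_onI[OF infd]
    by (intro m.integrable_const_bound[of _ 1]) (auto simp: infdist_nonneg)
  ultimately have "AE t in m. min 1 (infdist t T) = 0"
    by (subst (asm) integral_nonneg_eq_0_iff_AE) (auto simp: infdist_nonneg)
  then have aeT: "AE t in m. t \<in> T"
  proof (rule AE_mp, intro AE_I2 impI)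
    fix t assume "min 1 (infdist t T) = 0"
    then have "infdist t T = 0" by linarith
    then show "t \<in> T"
      using in_closed_iff_infdist_zero[OF compact_imp_closed[OF cptT] Tne] by simp
  qed
  obtain y0 where y0: "y0 \<in> mspace Y"
    using P.not_empty[of 0] spP[of 0] by auto
  \<comment> \<open>\<open>y0\<close> is a filler that makes \<open>q\<close> total;
    \<open>m\<close> gives no mass to the complement of \<open>T\<close>.\<close>
  define q where "q t = (if t \<in> T then p t else y0)" for t
  have pT: "p t \<in> mspace Y" if "t \<in> T" for t
    using pcont that by (auto simp: continuous_map_def Pi_iff)
  have q: "q \<in> measurable m ?BY"
  proof (rule measurable_borel_sigmaI)
    show "q \<in> space m \<rightarrow> topspace (mtopology_of Y)"
      using pT y0 by (auto simp: q_def)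
    fix U assume "openin (mtopology_of Y) U"
    then have "openin (top_of_set T) {t \<in> topspace (top_of_set T). p t \<in> U}"
      by (rule openin_continuous_map_preimage[OF pcont])
    then obtain V where "open V" "{t \<in> T. p t \<in> U} = T \<inter> V"
      by (auto simp: openin_open)
    moreover have "q -` U \<inter> space m = {t \<in> T. p t \<in> U} \<union> (if y0 \<in> U then - T else {})"
      by (auto simp: q_def split: if_splits)
    ultimately show "q -` U \<inter> space m \<in> sets m"
      using compact_imp_closed[OF cptT] by auto
  qed
  define \<nu> where "\<nu> = distr m ?BY q"
  have "prob_space \<nu>"
    unfolding \<nu>_def using q by (rule m.prob_space_distr)
  moreover have "sets \<nu> = sets ?BY"
    by (simp add: \<nu>_def)
  moreover have "(\<lambda>n. \<integral>x. F x \<partial>P (r n)) \<longlonglongrightarrow> (\<integral>x. F x \<partial>\<nu>)"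
    if F: "continuous_map (mtopology_of Y) euclideanreal F" for F
  proof -
    have "continuous_map (top_of_set T) euclideanreal (F \<circ> p)"
      using pcont F by (rule continuous_map_compose)
    then have Fp: "continuous_on T (F \<circ> p)" by simp
    then have "bounded ((F \<circ> p) ` T)"
      using cptT by (intro compact_imp_bounded compact_continuous_image)
    then obtain B where B: "B > 0" "\<And>t. t \<in> T \<Longrightarrow> norm ((F \<circ> p) t) \<le> B"
      by (auto simp: bounded_pos)
    \<comment> \<open>Weak convergence tests functions on the whole line, whereas
      \<open>F \<circ> p\<close> makes sense only on \<open>T\<close>; Tietze extends it with the
      same bound.\<close>
    obtain g where g: "continuous_on UNIV g" "\<And>t. t \<in> T \<Longrightarrow> g t = (F \<circ> p) t"
        "\<And>t. t \<in> UNIV \<Longrightarrow> norm (g t) \<le> B"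
      using Tietze[OF Fp, of UNIV B] compact_imp_closed[OF cptT] B by auto
    have "(\<integral>x. g (c x) \<partial>P n) = (\<integral>x. F x \<partial>P n)" for n
    proof (rule Bochner_Integration.integral_cong[OF refl])
      fix x assume x: "x \<in> space (P n)"
      then have "c x \<in> S" by (simp add: S_def spP)
      moreover from this have "c x \<in> T" using closure_subset[of S] by (auto simp: T_def)
      ultimately show "g (c x) = F x"
        using x by (simp add: g p p0 spP)
    qed
    moreover have "(\<integral>x. F x \<partial>\<nu>) = (\<integral>t. F (q t) \<partial>m)"
      unfolding \<nu>_def by (rule integral_distr[OF q continuous_map_borel_measurable[OF F]])
    moreover have "\<dots> = (\<integral>t. g t \<partial>m)"
    proof (rule integral_cong_AE)
      show "g \<in> borel_measurable m"
        using borel_measurable_continuous_onI[OF g(1)] by simp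
      show "(\<lambda>t. F (q t)) \<in> borel_measurable m"
        using measurable_compose[OF q continuous_map_borel_measurable[OF F]] .
      show "AE t in m. F (q t) = g t"
        using aeT by (rule AE_mp) (auto simp: q_def g)
    qed
    ultimately show ?thesis
      using lim[OF g(1), of B] g(3) by simp
  qed
  ultimately show ?thesis
    using that r by blast
qed

section \<open>Topology of the shift space\<close>

lemma tms_dist_ge:
  assumes "x k \<noteq> y k" shows "(1/2) ^ k \<le> tms_dist x y"
proof -
  have "(LEAST i. x i \<noteq> y i) \<le> k" using assms by (rule Least_le)
  then show ?thesis
    using assms by (auto simp: tms_dist_def intro!: power_decreasing simp del: power_one_over)
qed

text \<open>Nonzero distances are powers of 1/2, so a strict bound pushes the first disagreement
  beyond \<open>n\<close>: coordinate \<open>n\<close> itself agrees too.\<close>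

lemma tms_dist_less_iff: "tms_dist x y < (1/2) ^ n \<longleftrightarrow> (\<forall>i\<le>n. x i = y i)"
proof
  assume l: "tms_dist x y < (1/2) ^ n"
  show "\<forall>i\<le>n. x i = y i"
  proof (intro allI impI, rule ccontr)
    fix i assume "i \<le> n" "x i \<noteq> y i"
    then have "(1/2::real) ^ n \<le> (1/2) ^ i" by (intro power_decreasing) auto
    with tms_dist_ge[of x i y] \<open>x i \<noteq> y i\<close> l show False by linarith
  qed
next
  assume eq: "\<forall>i\<le>n. x i = y i"
  show "tms_dist x y < (1/2) ^ n"
  proof (cases "x = y")
    case False
    then obtain k where "x k \<noteq> y k" by auto
    then have "x (LEAST i. x i \<noteq> y i) \<noteq> y (LEAST i. x i \<noteq> y i)" by (rule LeastI)
    then have "n < (LEAST i. x i \<noteq> y i)" using eq by (meson not_le)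
    then show ?thesis
      using False by (simp add: tms_dist_def power_strict_decreasing del: power_one_over)
  qed (simp add: tms_dist_def)
qed

lemma Metric_space_tms: "Metric_space (tms A) tms_dist"
proof
  show "0 \<le> tms_dist x y" for x y :: "nat \<Rightarrow> 's" by (simp add: tms_dist_def)
  show "tms_dist x y = tms_dist y x" for x y :: "nat \<Rightarrow> 's"
  proof -
    have "(\<lambda>i. x i \<noteq> y i) = (\<lambda>i. y i \<noteq> x i)" by auto
    then show ?thesis unfolding tms_dist_def by metis
  qed
  show "(tms_dist x y = 0) = (x = y)" for x y :: "nat \<Rightarrow> 's" by (simp add: tms_dist_def)
  show "tms_dist x z \<le> tms_dist x y + tms_dist y z" for x y z :: "nat \<Rightarrow> 's"
  proof (cases "x = z")
    case False
    then obtain k where "x k \<noteq> z k" by auto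
    then have l: "x (LEAST i. x i \<noteq> z i) \<noteq> z (LEAST i. x i \<noteq> z i)" by (rule LeastI)
    \<comment> \<open>At the first index where \<open>x\<close> and \<open>z\<close> differ,
      \<open>y\<close> differs from one of them, so one of the two distances on the right is already
      large enough: the ultrametric inequality.\<close>
    then consider "x (LEAST i. x i \<noteq> z i) \<noteq> y (LEAST i. x i \<noteq> z i)"
      | "y (LEAST i. x i \<noteq> z i) \<noteq> z (LEAST i. x i \<noteq> z i)" by metis
    moreover have "tms_dist x z = (1/2) ^ (LEAST i. x i \<noteq> z i)"
      using False by (simp add: tms_dist_def)
    moreover have "tms_dist x y \<ge> 0" "tms_dist y z \<ge> 0" by (simp_all add: tms_dist_def)
    ultimately show ?thesis
      using tms_dist_ge[of x _ y] tms_dist_ge[of y _ z] by (smt (verit))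
  qed (simp add: tms_dist_def)
qed

interpretation tms: Metric_space "tms A" tms_dist for A
  by (rule Metric_space_tms)

lemma tms_small_ball:
  fixes \<epsilon> :: real assumes "\<epsilon> > 0"
  obtains n where "\<forall>x y :: nat \<Rightarrow> 's. (\<forall>i<n. x i = y i) \<longrightarrow> tms_dist x y < \<epsilon>"
proof -
  obtain n where n: "(1/2) ^ n < \<epsilon>"
    using real_arch_pow_inv[of \<epsilon> "1/2"] assms by auto
  have "tms_dist x y < \<epsilon>" if "\<forall>i<Suc n. x i = y i" for x y :: "nat \<Rightarrow> 's"
    using tms_dist_less_iff[of x y n] that n by (auto simp: less_Suc_eq_le)
  then show ?thesis using that by blast
qed

lemma topspace_tms [simp]: "topspace (tms_top A) = tms A"
  by (simp add: tms_top_def)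

text \<open>Prefixes give a neighbourhood basis. In this form most later proofs of openness only
  exhibit how many coordinates decide membership.\<close>

lemma openin_tms_top:
  "openin (tms_top A) U \<longleftrightarrow>
     U \<subseteq> tms A \<and> (\<forall>x\<in>U. \<exists>n. \<forall>y\<in>tms A. (\<forall>i<n. y i = x i) \<longrightarrow> y \<in> U)"
proof -
  have "(\<exists>\<epsilon>>0. tms.mball A x \<epsilon> \<subseteq> U) \<longleftrightarrow> (\<exists>n. \<forall>y\<in>tms A. (\<forall>i<n. y i = x i) \<longrightarrow> y \<in> U)"
    if "x \<in> tms A" for x
  proof safe
    fix \<epsilon> :: real assume "\<epsilon> > 0" and sub: "tms.mball A x \<epsilon> \<subseteq> U"
    from \<open>\<epsilon> > 0\<close> obtain n where n: "\<forall>x y :: nat \<Rightarrow> 'a. (\<forall>i<n. x i = y i) \<longrightarrow> tms_dist x y < \<epsilon>"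
      by (rule tms_small_ball)
    have "y \<in> U" if "y \<in> tms A" "\<forall>i<n. y i = x i" for y
      using n[rule_format, of x y] sub that \<open>x \<in> tms A\<close> by (auto simp: tms.in_mball subset_iff)
    then show "\<exists>n. \<forall>y\<in>tms A. (\<forall>i<n. y i = x i) \<longrightarrow> y \<in> U" by blast
  next
    fix n assume n: "\<forall>y\<in>tms A. (\<forall>i<n. y i = x i) \<longrightarrow> y \<in> U"
    then show "\<exists>\<epsilon>>0. tms.mball A x \<epsilon> \<subseteq> U"
      by (intro exI[of _ "(1/2) ^ n"])
        (auto simp: tms.in_mball tms_dist_less_iff simp del: power_one_over)
  qed
  then have "(\<forall>x\<in>U. \<exists>\<epsilon>>0. tms.mball A x \<epsilon> \<subseteq> U) \<longleftrightarrow>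
      (\<forall>x\<in>U. \<exists>n. \<forall>y\<in>tms A. (\<forall>i<n. y i = x i) \<longrightarrow> y \<in> U)" if "U \<subseteq> tms A"
    using that by (intro ball_cong refl) blast
  then show ?thesis
    unfolding tms_top_def tms.openin_mtopology Ball_def[symmetric] by (rule conj_cong[OF refl])
qed

lemma continuous_map_tms_metric:
  "continuous_map (tms_top A) (mtopology_of Y) f \<longleftrightarrow>
     f \<in> tms A \<rightarrow> mspace Y \<and>
     (\<forall>x\<in>tms A. \<forall>\<epsilon>>0. \<exists>n. \<forall>y\<in>tms A. (\<forall>i<n. y i = x i) \<longrightarrow> mdist Y (f x) (f y) < \<epsilon>)"
    (is "?l \<longleftrightarrow> ?r")
proof -
  interpret Y: Metric_space "mspace Y" "mdist Y" by (rule Metric_space_mspace_mdist)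
  have top: "mtopology_of Y = Y.mtopology" by (simp add: mtopology_of_def)
  show ?thesis
  proof
    assume l: ?l
    have "\<exists>n. \<forall>y\<in>tms A. (\<forall>i<n. y i = x i) \<longrightarrow> mdist Y (f x) (f y) < \<epsilon>"
      if x: "x \<in> tms A" and "\<epsilon> > 0" for x \<epsilon>
    proof -
      have fx: "f x \<in> mspace Y" using l x by (auto simp: continuous_map_def)
      have "openin (tms_top A) {y \<in> topspace (tms_top A). f y \<in> Y.mball (f x) \<epsilon>}"
        by (rule openin_continuous_map_preimage[OF l]) (simp add: top)
      then obtain n where "\<forall>y\<in>tms A. (\<forall>i<n. y i = x i) \<longrightarrow>
          y \<in> {y \<in> topspace (tms_top A). f y \<in> Y.mball (f x) \<epsilon>}"
        using x fx \<open>\<epsilon> > 0\<close> unfolding openin_tms_top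
        by (elim conjE, drule_tac bspec[of _ _ x]) auto
      then show ?thesis by (auto simp: Y.in_mball)
    qed
    with l show ?r by (auto simp: continuous_map_def)
  next
    assume r: ?r
    show ?l
      unfolding continuous_map_def
    proof (intro conjI allI impI)
      show "f \<in> topspace (tms_top A) \<rightarrow> topspace (mtopology_of Y)" using r by simp
      fix U assume U: "openin (mtopology_of Y) U"
      have "\<exists>n. \<forall>y\<in>tms A. (\<forall>i<n. y i = x i) \<longrightarrow> y \<in> tms A \<and> f y \<in> U"
        if x: "x \<in> tms A" "f x \<in> U" for x
      proof -
        obtain \<epsilon> where "\<epsilon> > 0" "Y.mball (f x) \<epsilon> \<subseteq> U"
          using U x(2) unfolding top Y.openin_mtopology by blast
        moreover from \<open>\<epsilon> > 0\<close> obtain n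
          where "\<forall>y\<in>tms A. (\<forall>i<n. y i = x i) \<longrightarrow> mdist Y (f x) (f y) < \<epsilon>"
          using r x(1) by blast
        ultimately show ?thesis
          using r x(1) by (intro exI[of _ n]) (auto simp: subset_iff Pi_iff)
      qed
      then show "openin (tms_top A) {x \<in> topspace (tms_top A). f x \<in> U}"
        unfolding openin_tms_top by auto
    qed
  qed
qed

lemma continuous_map_tms_real:
  "continuous_map (tms_top A) euclideanreal f \<longleftrightarrow>
     (\<forall>x\<in>tms A. \<forall>\<epsilon>>0. \<exists>n. \<forall>y\<in>tms A. (\<forall>i<n. y i = x i) \<longrightarrow> \<bar>f x - f y\<bar> < \<epsilon>)"
  using continuous_map_tms_metric[of A euclidean_metric f] by (simp add: dist_real_def)

lemma shift_in_tms: "x \<in> tms A \<Longrightarrow> shift x \<in> tms A"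
  by (simp add: tms_def shift_def)

lemma cylinder_subset: "cylinder A w \<subseteq> tms A"
  by (auto simp: cylinder_def)

lemma openin_cylinder: "openin (tms_top A) (cylinder A w)"
  unfolding openin_tms_top cylinder_def
  by (auto intro!: exI[of _ "length w"])

lemma closedin_cylinder: "closedin (tms_top A) (cylinder A w)"
proof -
  have "\<forall>y\<in>tms A. (\<forall>i<length w. y i = x i) \<longrightarrow> y \<in> tms A - cylinder A w"
    if "x \<in> tms A - cylinder A w" for x
    using that by (simp add: cylinder_def)
  then show ?thesis
    unfolding closedin_def openin_tms_top using cylinder_subset[of A w] by auto
qed

lemma cylinder_measurable: "cylinder A w \<in> sets (borel_sigma (tms_top A))"
  by (rule openin_borel_sigma[OF openin_cylinder])

lemma continuous_map_cylinder:
  "continuous_map (tms_top A) euclideanreal (indicator (cylinder A w))"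
  unfolding continuous_map_tms_real
proof (intro ballI allI impI)
  fix x and \<epsilon> :: real assume "x \<in> tms A" "\<epsilon> > 0"
  then show "\<exists>n. \<forall>y\<in>tms A. (\<forall>i<n. y i = x i) \<longrightarrow>
      \<bar>indicator (cylinder A w) x - indicator (cylinder A w) y\<bar> < \<epsilon>"
    by (intro exI[of _ "length w"]) (auto simp: cylinder_def indicator_def)
qed

lemma cylinder_Int:
  assumes "length v \<le> length w"
  shows "cylinder A v \<inter> cylinder A w = (if take (length v) w = v then cylinder A w else {})"
proof (cases "take (length v) w = v")
  case True
  then have "w ! i = v ! i" if "i < length v" for i
    using that by (metis nth_take)
  then show ?thesis
    using assms True by (auto simp: cylinder_def)
next
  case False
  moreover have "take (length v) w = v" if "\<forall>i<length v. w ! i = v ! i"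
    using assms that by (intro nth_equalityI) auto
  ultimately obtain i where "i < length v" "w ! i \<noteq> v ! i" by auto
  then show ?thesis
    using assms False by (force simp: cylinder_def)
qed

lemma in_cylinder_prefix: "x \<in> tms A \<Longrightarrow> y \<in> cylinder A (map x [0..<n]) \<longleftrightarrow> y \<in> tms A \<and> (\<forall>i<n. y i = x i)"
  by (auto simp: cylinder_def)

text \<open>There are only countably many words over a countable alphabet, so every open set is a
  countable union of cylinders.\<close>

lemma sets_borel_tms:
  assumes "countable (UNIV :: 's set)"
  shows "sets (borel_sigma (tms_top A)) =
    sigma_sets (tms A) (insert {} (cylinder A ` {w :: 's list. w \<noteq> []}))"
    (is "_ = sigma_sets _ ?E")
proof -
  have cE: "countable ?E"
    by (intro countable_insert countable_image countable_subset[OF _ countable_lists[OF assms]]) auto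
  have "U \<in> sigma_sets (tms A) ?E" if U: "openin (tms_top A) U" for U
  proof -
    have "U = \<Union>{B \<in> ?E. B \<subseteq> U}"
    proof
      show "U \<subseteq> \<Union>{B \<in> ?E. B \<subseteq> U}"
      proof
        fix x assume x: "x \<in> U"
        with U obtain n where n: "\<forall>y\<in>tms A. (\<forall>i<n. y i = x i) \<longrightarrow> y \<in> U" and xt: "x \<in> tms A"
          unfolding openin_tms_top by blast
        \<comment> \<open>\<open>Suc n\<close> instead of \<open>n\<close> keeps the word
          nonempty.\<close>
        have "cylinder A (map x [0..<Suc n]) \<subseteq> U"
          using n by (auto simp: in_cylinder_prefix[OF xt] simp del: upt_Suc)
        moreover have "x \<in> cylinder A (map x [0..<Suc n])"
          using xt by (simp add: in_cylinder_prefix del: upt_Suc)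
        moreover have "cylinder A (map x [0..<Suc n]) \<in> ?E"
          by (intro insertI2 imageI) simp
        ultimately show "x \<in> \<Union>{B \<in> ?E. B \<subseteq> U}"
          by (intro UnionI[of "cylinder A (map x [0..<Suc n])"]) simp_all
      qed
    qed auto
    moreover have "\<Union>{B \<in> ?E. B \<subseteq> U} \<in> sigma_sets (tms A) ?E"
      by (rule sigma_sets_UNION) (use cE in \<open>auto intro: countable_subset[of _ ?E]\<close>)
    ultimately show ?thesis by simp
  qed
  then have "sigma_sets (tms A) {U. openin (tms_top A) U} \<subseteq> sigma_sets (tms A) ?E"
    by (intro sigma_sets_mono) auto
  moreover have "sigma_sets (tms A) ?E \<subseteq> sigma_sets (tms A) {U. openin (tms_top A) U}"
    by (intro sigma_sets_mono') (auto intro: openin_cylinder)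
  ultimately show ?thesis
    by (simp add: sets_borel_sigma)
qed

text \<open>Two cylinders are nested or disjoint; the empty set is added to cover the disjoint case.
  This is the pi-system on which measures are compared.\<close>

lemma Int_stable_cylinders: "Int_stable (insert {} (cylinder A ` {w. w \<noteq> []}))"
proof (rule Int_stableI)
  have *: "cylinder A v \<inter> cylinder A w \<in> insert {} (cylinder A ` {w. w \<noteq> []})"
    if "v \<noteq> []" "w \<noteq> []" "length v \<le> length w" for v w
    using that by (auto simp: cylinder_Int)
  fix a b assume "a \<in> insert {} (cylinder A ` {w. w \<noteq> []})" "b \<in> insert {} (cylinder A ` {w. w \<noteq> []})"
  then consider "a \<inter> b = {}" | v w where "a = cylinder A v" "b = cylinder A w" "v \<noteq> []" "w \<noteq> []"
    by auto
  then show "a \<inter> b \<in> insert {} (cylinder A ` {w. w \<noteq> []})"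
  proof cases
    case 2
    then show ?thesis
      using *[of v w] *[of w v] by (metis Int_commute linear)
  qed auto
qed

section \<open>Compact sets and compactly supported functions\<close>

definition starting_in :: "('s \<Rightarrow> 's \<Rightarrow> bool) \<Rightarrow> 's set \<Rightarrow> (nat \<Rightarrow> 's) set" where
  "starting_in A F = {x \<in> tms A. x 0 \<in> F}"

text \<open>Every state has finitely many successors, so by induction each coordinate ranges over a
  finite set once the first one does.\<close>

lemma finite_prefixes:
  assumes "tms_locally_compact A" "finite F"
  shows "finite ((\<lambda>x. map x [0..<n]) ` starting_in A F)"
proof -
  have fin: "finite ((\<lambda>x. x k) ` starting_in A F)" for k
  proof (induction k)
    case 0
    show ?case
      by (rule finite_subset[OF _ assms(2)]) (auto simp: starting_in_def)
  next
    case (Suc k)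
    have "(\<lambda>x. x (Suc k)) ` starting_in A F \<subseteq> (\<Union>a\<in>(\<lambda>x. x k) ` starting_in A F. {b. A a b})"
      by (auto simp: starting_in_def tms_def)
    moreover have "finite (\<Union>a\<in>(\<lambda>x. x k) ` starting_in A F. {b. A a b})"
      using Suc assms(1) by (intro finite_UN_I) (auto simp: tms_locally_compact_def)
    ultimately show ?case by (rule finite_subset)
  qed
  let ?B = "\<Union>k<n. (\<lambda>x. x k) ` starting_in A F"
  have "finite ?B" using fin by auto
  then have "finite {xs. set xs \<subseteq> ?B \<and> length xs = n}"
    by (rule finite_lists_length_eq)
  moreover have "x k \<in> ?B" if "x \<in> starting_in A F" "k < n" for x k
    using imageI[OF that(1), of "\<lambda>x. x k"] that(2) by blast
  then have "(\<lambda>x. map x [0..<n]) ` starting_in A F \<subseteq> {xs. set xs \<subseteq> ?B \<and> length xs = n}"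
    by auto
  ultimately show ?thesis by (rule rev_finite_subset)
qed

text \<open>Along a Cauchy sequence each coordinate is eventually constant. The admissibility
  condition involves two coordinates at a time, so it passes to the limit.\<close>

lemma tms_mcomplete: "Metric_space.mcomplete (tms A) tms_dist"
  unfolding tms.mcomplete_def
proof (intro allI impI)
  fix \<sigma> assume C: "tms.MCauchy A \<sigma>"
  have "\<exists>N. \<forall>m\<ge>N. \<forall>m'\<ge>N. \<forall>i\<le>n. \<sigma> m i = \<sigma> m' i" for n
  proof -
    have "(1/2::real) ^ n > 0" by simp
    moreover have "\<forall>\<epsilon>>0. \<exists>N. \<forall>m m'. N \<le> m \<longrightarrow> N \<le> m' \<longrightarrow> tms_dist (\<sigma> m) (\<sigma> m') < \<epsilon>"
      using C by (simp add: tms.MCauchy_def)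
    ultimately obtain N where "\<forall>m m'. N \<le> m \<longrightarrow> N \<le> m' \<longrightarrow> tms_dist (\<sigma> m) (\<sigma> m') < (1/2) ^ n"
      by presburger
    then show ?thesis unfolding tms_dist_less_iff by blast
  qed
  then obtain N where N: "\<And>n m m' i. m \<ge> N n \<Longrightarrow> m' \<ge> N n \<Longrightarrow> i \<le> n \<Longrightarrow> \<sigma> m i = \<sigma> m' i"
    by metis
  define x where "x n = \<sigma> (N n) n" for n
  have x: "\<sigma> m i = x i" if "m \<ge> N i" for m i
    using N[OF that order_refl order_refl] by (simp add: x_def)
  have \<sigma>: "\<sigma> m \<in> tms A" for m
    using C by (auto simp: tms.MCauchy_def)
  moreover have "A (x i) (x (Suc i))" for i
  proof -
    define m where "m = max (N i) (N (Suc i))"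
    have "A (\<sigma> m i) (\<sigma> m (Suc i))" using \<sigma>[of m] by (simp add: tms_def)
    moreover have "\<sigma> m i = x i" "\<sigma> m (Suc i) = x (Suc i)" by (simp_all add: x m_def)
    ultimately show ?thesis by (simp only:)
  qed
  then have "x \<in> tms A" by (simp add: tms_def)
  moreover have "\<forall>\<^sub>F m in sequentially. tms_dist (\<sigma> m) x < \<epsilon>" if "\<epsilon> > 0" for \<epsilon>
  proof -
    from that obtain n where n: "\<forall>x y :: nat \<Rightarrow> 'a. (\<forall>i<n. x i = y i) \<longrightarrow> tms_dist x y < \<epsilon>"
      by (rule tms_small_ball)
    have "\<forall>\<^sub>F m in sequentially. \<forall>i\<in>{..<n}. \<sigma> m i = x i"
      using x by (intro eventually_ball_finite) (auto simp: eventually_sequentially)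
    then show ?thesis by (rule eventually_mono) (simp add: n)
  qed
  ultimately show "\<exists>x. limitin (tms.mtopology A) \<sigma> x sequentially"
    by (auto simp: tms.limitin_metric)
qed

text \<open>Finitely many prefixes of each length give total boundedness, and the set is closed in a
  complete space. For finite \<open>F\<close> these are the model compact sets in which all supports
  are placed.\<close>

lemma compactin_starting_in:
  assumes "tms_locally_compact A" "finite F"
  shows "compactin (tms_top A) (starting_in A F)"
proof -
  have "tms.mtotally_bounded A (starting_in A F)"
    unfolding tms.mtotally_bounded_def
  proof (intro allI impI)
    fix \<epsilon> :: real assume "\<epsilon> > 0"
    then obtain n where n: "\<forall>x y :: nat \<Rightarrow> 'a. (\<forall>i<n. x i = y i) \<longrightarrow> tms_dist x y < \<epsilon>"
      by (rule tms_small_ball)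
    let ?p = "\<lambda>x. map x [0..<n]"
    obtain K where K: "K \<subseteq> starting_in A F" "finite K" "?p ` starting_in A F = ?p ` K"
      using finite_subset_image[OF finite_prefixes[OF assms, of n] subset_refl] by blast
    have "starting_in A F \<subseteq> (\<Union>x\<in>K. tms.mball A x \<epsilon>)"
    proof
      fix y assume y: "y \<in> starting_in A F"
      then obtain x where x: "x \<in> K" "?p y = ?p x"
        using K(3) imageI[OF y, of ?p] by auto
      then have "\<forall>i<n. x i = y i" by simp
      then show "y \<in> (\<Union>x\<in>K. tms.mball A x \<epsilon>)"
        using n[rule_format, of x y] x(1) y K(1) by (auto simp: starting_in_def)
    qed
    with K show "\<exists>K. finite K \<and> K \<subseteq> starting_in A F \<and> starting_in A F \<subseteq> (\<Union>x\<in>K. tms.mball A x \<epsilon>)"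
      by blast
  qed
  then have "compactin (tms_top A) (tms_top A closure_of starting_in A F)"
    unfolding tms_top_def tms.mtotally_bounded_eq_compact_closure_of[OF tms_mcomplete]
    by (rule conjunct2)
  moreover have "closedin (tms_top A) (starting_in A F)"
    unfolding closedin_def openin_tms_top by (auto simp: starting_in_def intro!: exI[of _ 1])
  ultimately show ?thesis by (simp add: closure_of_closedin)
qed

lemma compactin_cylinder:
  assumes "tms_locally_compact A" "w \<noteq> []"
  shows "compactin (tms_top A) (cylinder A w)"
  using assms
  by (intro closed_compactin[OF compactin_starting_in[of A "{hd w}"] _ closedin_cylinder])
    (auto simp: starting_in_def cylinder_def hd_conv_nth)

lemma starting_in_measurable: "starting_in A F \<in> sets (borel_sigma (tms_top A))"
  by (rule openin_borel_sigma) (auto simp: openin_tms_top starting_in_def intro!: exI[of _ 1])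

lemma indicator_cylinder_Cc:
  assumes "tms_locally_compact A" "w \<noteq> []"
  shows "indicator (cylinder A w) \<in> Cc_pos A"
proof -
  have "{x \<in> tms A. indicator (cylinder A w) x \<noteq> (0::real)} = cylinder A w"
    using cylinder_subset[of A w] by (auto simp: indicator_def)
  then show ?thesis
    using compactin_cylinder[OF assms] closedin_cylinder[of A w]
    by (simp add: Cc_pos_def Cc_def continuous_map_cylinder closure_of_closedin)
qed

text \<open>Constrains only the first coordinate and asks for no continuity, so it survives the
  Ruelle operator and makes the sums over preimages finite.\<close>

definition supported_in :: "('s \<Rightarrow> 's \<Rightarrow> bool) \<Rightarrow> 's set \<Rightarrow> ((nat \<Rightarrow> 's) \<Rightarrow> real) \<Rightarrow> bool" where
  "supported_in A F f \<longleftrightarrow> (\<forall>x\<in>tms A. f x \<noteq> 0 \<longrightarrow> x 0 \<in> F)"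

text \<open>The one-letter cylinders form an open cover of the compact support; the letters of a
  finite subcover make up \<open>F\<close>.\<close>

lemma Cc_supported_in:
  assumes "f \<in> Cc A"
  obtains F where "finite F" "supported_in A F f"
proof -
  let ?K = "tms_top A closure_of {x \<in> tms A. f x \<noteq> 0}"
  have K: "compactin (tms_top A) ?K" using assms by (simp add: Cc_def)
  have sub: "{x \<in> tms A. f x \<noteq> 0} \<subseteq> ?K" by (rule closure_of_subset) auto
  have "?K \<subseteq> tms A"
    using closure_of_subset_topspace[of "tms_top A"] by simp
  then have "?K \<subseteq> \<Union>(range (\<lambda>a. cylinder A [a]))"
    by (auto simp: cylinder_def)
  moreover have "\<forall>U\<in>range (\<lambda>a. cylinder A [a]). openin (tms_top A) U"
    using openin_cylinder by blast
  ultimately obtain \<F> where "finite \<F>" "\<F> \<subseteq> range (\<lambda>a. cylinder A [a])" "?K \<subseteq> \<Union>\<F>"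
    using compactinD[OF K] by (metis (no_types, lifting))
  then obtain F where F: "finite F" "?K \<subseteq> (\<Union>a\<in>F. cylinder A [a])"
    using finite_subset_image[of \<F> "\<lambda>a. cylinder A [a]" UNIV] by auto
  then have "x 0 \<in> F" if "x \<in> tms A" "f x \<noteq> 0" for x
    using that sub by (auto simp: cylinder_def)
  then have "supported_in A F f" by (auto simp: supported_in_def)
  with F(1) show ?thesis by (rule that)
qed

lemma Cc_uniformly_continuous:
  assumes lc: "tms_locally_compact A" and f: "f \<in> Cc A" and "\<epsilon> > 0"
  obtains n where
    "\<forall>x y. x \<in> tms A \<longrightarrow> y \<in> tms A \<longrightarrow> (\<forall>i<n. x i = y i) \<longrightarrow> \<bar>f x - f y\<bar> < \<epsilon>"
proof -
  obtain F where F: "finite F" "supported_in A F f"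
    using Cc_supported_in[OF f] .
  have ct: "\<forall>x\<in>tms A. \<forall>\<epsilon>>0. \<exists>n. \<forall>y\<in>tms A. (\<forall>i<n. y i = x i) \<longrightarrow> \<bar>f x - f y\<bar> < \<epsilon>"
    using f by (simp add: Cc_def continuous_map_tms_real)
  have "\<epsilon> / 2 > 0" using \<open>\<epsilon> > 0\<close> by simp
  with ct have "\<forall>x. \<exists>n. x \<in> tms A \<longrightarrow> (\<forall>y\<in>tms A. (\<forall>i<n. y i = x i) \<longrightarrow> \<bar>f x - f y\<bar> < \<epsilon>/2)"
    by blast
  then obtain n where
    n: "\<forall>x. x \<in> tms A \<longrightarrow> (\<forall>y\<in>tms A. (\<forall>i<n x. y i = x i) \<longrightarrow> \<bar>f x - f y\<bar> < \<epsilon>/2)"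
    by (rule choice[THEN exE])
  let ?c = "\<lambda>x. cylinder A (map x [0..<n x])"
  have "x \<in> ?c x" if "x \<in> starting_in A F" for x
    using that by (simp add: starting_in_def cylinder_def)
  then have "starting_in A F \<subseteq> \<Union>(?c ` starting_in A F)" by blast
  moreover have "\<forall>U\<in>?c ` starting_in A F. openin (tms_top A) U"
    using openin_cylinder by blast
  ultimately obtain \<F> where "finite \<F>" "\<F> \<subseteq> ?c ` starting_in A F" "starting_in A F \<subseteq> \<Union>\<F>"
    using compactinD[OF compactin_starting_in[OF lc F(1)]] by (metis (no_types, lifting))
  then obtain K where K: "finite K" "K \<subseteq> starting_in A F" "starting_in A F \<subseteq> (\<Union>x\<in>K. ?c x)"
    using finite_subset_image[of \<F> ?c "starting_in A F"] by auto
  \<comment> \<open>The 1 makes \<open>x\<close> and \<open>y\<close> share their first letter, so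
    that either the finite cover applies to \<open>x\<close> or both values are 0.\<close>
  define N where "N = Max (insert 1 (n ` K))"
  have N: "1 \<le> N" "\<And>x. x \<in> K \<Longrightarrow> n x \<le> N" using K(1) by (auto simp: N_def)
  have close: "\<bar>f x - f y\<bar> < \<epsilon>"
    if xy: "x \<in> starting_in A F" "y \<in> tms A" "\<forall>i<N. x i = y i" for x y
  proof -
    obtain z where z: "z \<in> K" "x \<in> ?c z" using K(3) xy(1) by blast
    then have zt: "z \<in> tms A" using K(2) by (auto simp: starting_in_def)
    have xz: "x \<in> tms A" "\<forall>i<n z. x i = z i"
      using z(2) unfolding in_cylinder_prefix[OF zt] by blast+
    have yz: "y i = z i" if "i < n z" for i
    proof -
      have "x i = y i" using xy(3) N(2)[OF z(1)] that by simp
      moreover have "x i = z i" using xz(2) that by simp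
      ultimately show ?thesis by simp
    qed
    have "\<bar>f z - f x\<bar> < \<epsilon>/2" "\<bar>f z - f y\<bar> < \<epsilon>/2"
      using n zt xz xy(2) yz by auto
    then show ?thesis by linarith
  qed
  have "\<bar>f x - f y\<bar> < \<epsilon>" if xy: "x \<in> tms A" "y \<in> tms A" "\<forall>i<N. x i = y i" for x y
  proof (cases "x 0 \<in> F")
    case True
    then show ?thesis using close xy by (simp add: starting_in_def)
  next
    case False
    moreover have "x 0 = y 0" using xy(3) N(1) by simp
    ultimately have "f x = 0" "f y = 0" using F(2) xy by (auto simp: supported_in_def)
    then show ?thesis using \<open>\<epsilon> > 0\<close> by simp
  qed
  then show ?thesis using that by blast
qed

section \<open>The Ruelle operator\<close>

lemma case_nat_in_tms: "case_nat b x \<in> tms A \<longleftrightarrow> A b (x 0) \<and> x \<in> tms A"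
proof -
  have "(\<forall>i. A (case_nat b x i) (case_nat b x (Suc i))) \<longleftrightarrow> A b (x 0) \<and> (\<forall>i. A (x i) (x (Suc i)))"
    by (metis old.nat.exhaust old.nat.simps(4,5))
  then show ?thesis by (simp add: tms_def)
qed

lemma shift_case_nat [simp]: "shift (case_nat b x) = x"
  by (simp add: shift_def)

lemma case_nat_shift: "case_nat (y 0) (shift y) = y"
  by (auto simp: shift_def split: nat.split)

lemma shift_power: "(shift ^^ n) x = (\<lambda>i. x (i + n))"
  by (induction n) (auto simp: shift_def)

lemma shift_power_in_tms: "x \<in> tms A \<Longrightarrow> (shift ^^ n) x \<in> tms A"
  by (induction n) (auto intro: shift_in_tms)

lemma preimages_eq:
  assumes "x \<in> tms A"
  shows "{y \<in> tms A. shift y = x} = (\<lambda>b. case_nat b x) ` {b. A b (x 0)}"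
proof -
  have "y \<in> (\<lambda>b. case_nat b x) ` {b. A b (x 0)}" if "y \<in> tms A" "shift y = x" for y
  proof
    show "y = case_nat (y 0) x" using case_nat_shift[of y] that(2) by simp
    show "y 0 \<in> {b. A b (x 0)}" using that by (auto simp: tms_def shift_def)
  qed
  then show ?thesis using assms by (auto simp: case_nat_in_tms)
qed

text \<open>The preimages of \<open>x\<close> are the sequences \<open>case_nat b x\<close> with
  \<open>A b (x 0)\<close>, and the support condition kills all but those with
  \<open>b \<in> F\<close>, so no question of summability arises.\<close>

lemma ruelle_finite_sum:
  assumes "finite F" "supported_in A F f" "x \<in> tms A"
  shows "ruelle A \<phi> f x =
    (\<Sum>b\<in>F. if A b (x 0) then exp (\<phi> (case_nat b x)) * f (case_nat b x) else 0)"
proof -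
  have inj: "inj_on (\<lambda>b. case_nat b x) B" for B
    by (rule inj_onI) (metis old.nat.simps(4))
  let ?G = "F \<inter> {b. A b (x 0)}"
  have "ruelle A \<phi> f x = infsum (\<lambda>y. exp (\<phi> y) * f y) ((\<lambda>b. case_nat b x) ` ?G)"
    unfolding ruelle_def preimages_eq[OF assms(3)]
  proof (rule infsum_cong_neutral)
    fix y assume y: "y \<in> (\<lambda>b. case_nat b x) ` {b. A b (x 0)} - (\<lambda>b. case_nat b x) ` ?G"
    then obtain b where b: "y = case_nat b x" "A b (x 0)" "b \<notin> F" by auto
    then have "y \<in> tms A" "y 0 \<notin> F" using assms(3) by (simp_all add: case_nat_in_tms)
    then have "f y = 0"
      using assms(2) by (auto simp: supported_in_def)
    then show "exp (\<phi> y) * f y = 0" by simp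
  qed auto
  also have "\<dots> = (\<Sum>b\<in>?G. exp (\<phi> (case_nat b x)) * f (case_nat b x))"
    using assms(1) by (simp add: sum.reindex[OF inj] comp_def)
  also have "\<dots> = (\<Sum>b\<in>F. if b \<in> {b. A b (x 0)} then exp (\<phi> (case_nat b x)) * f (case_nat b x) else 0)"
    by (rule sum.inter_restrict[OF assms(1)])
  finally show ?thesis by simp
qed

text \<open>A nonzero value at \<open>x\<close> requires some \<open>b \<in> F\<close> to precede
  \<open>x 0\<close>, and states in \<open>F\<close> have finitely many successors
  altogether.\<close>

lemma supported_in_ruelle:
  assumes "tms_locally_compact A" "finite F" "supported_in A F f"
  shows "\<exists>F'. finite F' \<and> supported_in A F' (ruelle A \<phi> f)"
proof (intro exI conjI)
  show "finite (\<Union>b\<in>F. {c. A b c})"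
    using assms(1,2) by (auto simp: tms_locally_compact_def)
  show "supported_in A (\<Union>b\<in>F. {c. A b c}) (ruelle A \<phi> f)"
    unfolding supported_in_def
  proof (intro ballI impI)
    fix x assume x: "x \<in> tms A" "ruelle A \<phi> f x \<noteq> 0"
    from x(2) obtain b where "b \<in> F" "(if A b (x 0) then exp (\<phi> (case_nat b x)) * f (case_nat b x) else 0) \<noteq> 0"
      unfolding ruelle_finite_sum[OF assms(2,3) x(1)] by (rule sum.not_neutral_contains_not_neutral)
    then show "x 0 \<in> (\<Union>b\<in>F. {c. A b c})" by (auto split: if_splits)
  qed
qed

lemma supported_in_ruelle_power:
  assumes "tms_locally_compact A" "finite F" "supported_in A F f"
  shows "\<exists>F'. finite F' \<and> supported_in A F' ((ruelle A \<phi> ^^ n) f)"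
proof (induction n)
  case 0
  then show ?case using assms by auto
next
  case (Suc n)
  then show ?case using supported_in_ruelle[OF assms(1)] by auto
qed

lemma supported_in_lincomb:
  "supported_in A F f \<Longrightarrow> supported_in A F g \<Longrightarrow> supported_in A F (\<lambda>x. a * f x + b * g x)"
  by (auto simp: supported_in_def)

lemma supported_in_mono: "supported_in A F f \<Longrightarrow> F \<subseteq> F' \<Longrightarrow> supported_in A F' f"
  by (auto simp: supported_in_def)

lemma ruelle_lincomb:
  assumes "finite F" "supported_in A F f" "supported_in A F g"
  shows "ruelle A \<phi> (\<lambda>x. a * f x + b * g x) = (\<lambda>x. a * ruelle A \<phi> f x + b * ruelle A \<phi> g x)"
proof
  fix x
  note s = supported_in_lincomb[OF assms(2,3), of a b]
  show "ruelle A \<phi> (\<lambda>x. a * f x + b * g x) x = a * ruelle A \<phi> f x + b * ruelle A \<phi> g x"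
  proof (cases "x \<in> tms A")
    case True
    show ?thesis
      unfolding ruelle_finite_sum[OF assms(1,2) True] ruelle_finite_sum[OF assms(1,3) True]
        ruelle_finite_sum[OF assms(1) s True]
      unfolding sum_distrib_left sum.distrib[symmetric]
      by (rule sum.cong) (auto simp: algebra_simps)
  next
    \<comment> \<open>Off \<open>tms A\<close> there are no preimages and both sides are 0. Equality
      on all sequences is what permits rewriting under iteration.\<close>
    case False
    then have "{y \<in> tms A. shift y = x} = {}" using shift_in_tms by auto
    then show ?thesis unfolding ruelle_def by (simp only: infsum_empty mult_zero_right add_0_right)
  qed
qed

lemma ruelle_power_lincomb:
  assumes lc: "tms_locally_compact A" and F: "finite F" "supported_in A F f" "supported_in A F g"
  shows "(ruelle A \<phi> ^^ n) (\<lambda>x. a * f x + b * g x) =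
    (\<lambda>x. a * (ruelle A \<phi> ^^ n) f x + b * (ruelle A \<phi> ^^ n) g x)"
proof (induction n)
  case (Suc n)
  obtain F1 where F1: "finite F1" "supported_in A F1 ((ruelle A \<phi> ^^ n) f)"
    using supported_in_ruelle_power[OF lc F(1,2)] by blast
  obtain F2 where F2: "finite F2" "supported_in A F2 ((ruelle A \<phi> ^^ n) g)"
    using supported_in_ruelle_power[OF lc F(1,3)] by blast
  have "supported_in A (F1 \<union> F2) ((ruelle A \<phi> ^^ n) f)" "supported_in A (F1 \<union> F2) ((ruelle A \<phi> ^^ n) g)"
    using F1 F2 by (auto intro: supported_in_mono)
  with F1(1) F2(1) show ?case
    by (simp add: Suc.IH ruelle_lincomb[of "F1 \<union> F2"])
qed simp

lemma ruelle_nonneg: "(\<And>x. x \<in> tms A \<Longrightarrow> 0 \<le> f x) \<Longrightarrow> 0 \<le> ruelle A \<phi> f x"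
  unfolding ruelle_def by (auto intro!: infsum_nonneg)

lemma ruelle_power_nonneg:
  assumes "\<And>x. x \<in> tms A \<Longrightarrow> 0 \<le> f x"
  shows "x \<in> tms A \<Longrightarrow> 0 \<le> (ruelle A \<phi> ^^ n) f x"
proof (induction n arbitrary: x)
  case (Suc n)
  show ?case using ruelle_nonneg[OF Suc.IH] by simp
qed (simp add: assms)

text \<open>Working with values in \<^typ>\<open>ennreal\<close>, the normalized Ruelle operator \<open>P = L\<^sub>\<phi>/\<lambda>\<close> acts on all
  nonnegative functions, without any condition on supports. The sum over the states runs along
  \<^term>\<open>from_nat_into UNIV\<close>, which is a bijection only for a countably infinite state set.\<close>

definition branch ::
  "('s \<Rightarrow> 's \<Rightarrow> bool) \<Rightarrow> ((nat \<Rightarrow> 's) \<Rightarrow> real) \<Rightarrow> real \<Rightarrow> 's \<Rightarrow> ((nat \<Rightarrow> 's) \<Rightarrow> ennreal) \<Rightarrow> (nat \<Rightarrow> 's) \<Rightarrow> ennreal"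
  where "branch A \<phi> lam b f x =
    (if A b (x 0) then ennreal (exp (\<phi> (case_nat b x)) / lam) * f (case_nat b x) else 0)"

definition transfer ::
  "('s \<Rightarrow> 's \<Rightarrow> bool) \<Rightarrow> ((nat \<Rightarrow> 's) \<Rightarrow> real) \<Rightarrow> real \<Rightarrow> ((nat \<Rightarrow> 's) \<Rightarrow> ennreal) \<Rightarrow> (nat \<Rightarrow> 's) \<Rightarrow> ennreal"
  where "transfer A \<phi> lam f x = (\<Sum>k. branch A \<phi> lam (from_nat_into UNIV k) f x)"

definition potential ::
  "('s \<Rightarrow> 's \<Rightarrow> bool) \<Rightarrow> ((nat \<Rightarrow> 's) \<Rightarrow> real) \<Rightarrow> real \<Rightarrow> ((nat \<Rightarrow> 's) \<Rightarrow> ennreal) \<Rightarrow> (nat \<Rightarrow> 's) \<Rightarrow> ennreal"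
  where "potential A \<phi> lam f x = (\<Sum>n. (transfer A \<phi> lam ^^ n) f x)"

text \<open>A function of \<open>shift y\<close> is constant on the fibre over \<open>x\<close>.
  Integrated against a conformal measure, this becomes the duality between the operator and the
  shift.\<close>

lemma transfer_pull_out:
  "transfer A \<phi> lam (\<lambda>y. f y * g (shift y)) = (\<lambda>x. transfer A \<phi> lam f x * g x)"
proof
  fix x
  have "branch A \<phi> lam b (\<lambda>y. f y * g (shift y)) x = branch A \<phi> lam b f x * g x" for b
    by (simp add: branch_def mult.assoc)
  then show "transfer A \<phi> lam (\<lambda>y. f y * g (shift y)) x = transfer A \<phi> lam f x * g x"
    by (simp add: transfer_def)
qed

lemma transfer_power_pull_out:
  "(transfer A \<phi> lam ^^ n) (\<lambda>y. f y * g ((shift ^^ n) y)) = (\<lambda>x. (transfer A \<phi> lam ^^ n) f x * g x)"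
proof (induction n arbitrary: g)
  case (Suc n)
  have "(transfer A \<phi> lam ^^ n) (\<lambda>y. f y * g ((shift ^^ Suc n) y)) =
      (\<lambda>x. (transfer A \<phi> lam ^^ n) f x * g (shift x))"
    using Suc.IH[of "\<lambda>x. g (shift x)"] by simp
  then show ?case
    by (simp add: transfer_pull_out)
qed simp

lemma transfer_cong:
  assumes "\<And>x. x \<in> tms A \<Longrightarrow> f x = g x" "x \<in> tms A"
  shows "transfer A \<phi> lam f x = transfer A \<phi> lam g x"
proof -
  have "branch A \<phi> lam b f x = branch A \<phi> lam b g x" for b
    using assms by (simp add: branch_def case_nat_in_tms)
  then show ?thesis by (simp add: transfer_def)
qed

lemma transfer_eq_finite_sum:
  assumes S: "countable (UNIV :: 's set)" "infinite (UNIV :: 's set)"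
    and F: "finite F" "\<And>b :: 's. b \<notin> F \<Longrightarrow> branch A \<phi> lam b f x = 0"
  shows "transfer A \<phi> lam f x = (\<Sum>b\<in>F. branch A \<phi> lam b f x)"
proof -
  have bij: "bij_betw (from_nat_into (UNIV :: 's set)) UNIV UNIV"
    using S by (rule bij_betw_from_nat_into)
  let ?N = "from_nat_into UNIV -` F"
  have "from_nat_into UNIV ` ?N = F"
    using bij by (simp add: bij_betw_def image_vimage_eq)
  then have bN: "bij_betw (from_nat_into UNIV) ?N F"
    using bij_betw_subset[OF bij subset_UNIV] by blast
  then have "finite ?N" using F(1) bij_betw_finite by blast
  then have "transfer A \<phi> lam f x = (\<Sum>k\<in>?N. branch A \<phi> lam (from_nat_into UNIV k) f x)"
    unfolding transfer_def using F(2) by (intro suminf_finite) auto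
  also have "\<dots> = (\<Sum>b\<in>F. branch A \<phi> lam b f x)"
    by (rule sum.reindex_bij_betw[OF bN])
  finally show ?thesis .
qed

lemma transfer_eq_ruelle:
  assumes S: "countable (UNIV :: 's set)" "infinite (UNIV :: 's set)"
    and F: "finite F" "supported_in A F f"
    and f: "\<And>y. y \<in> tms A \<Longrightarrow> 0 \<le> f y" and lam: "lam > 0" and x: "x \<in> tms (A :: 's \<Rightarrow> 's \<Rightarrow> bool)"
  shows "transfer A \<phi> lam (\<lambda>y. ennreal (f y)) x = ennreal (ruelle A \<phi> f x / lam)"
proof -
  let ?t = "\<lambda>b. if A b (x 0) then exp (\<phi> (case_nat b x)) * f (case_nat b x) else 0"
  have br: "branch A \<phi> lam b (\<lambda>y. ennreal (f y)) x = ennreal (?t b / lam)" for b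
    using f lam x by (simp add: branch_def case_nat_in_tms ennreal_mult[symmetric])
  have t0: "0 \<le> ?t b" for b
    using f x by (simp add: case_nat_in_tms)
  have "?t b = 0" if "b \<notin> F" for b
  proof (cases "A b (x 0)")
    case True
    then have "case_nat b x \<in> tms A" using x by (simp add: case_nat_in_tms)
    then show ?thesis using F(2) that by (force simp: supported_in_def)
  qed simp
  then have "transfer A \<phi> lam (\<lambda>y. ennreal (f y)) x = (\<Sum>b\<in>F. branch A \<phi> lam b (\<lambda>y. ennreal (f y)) x)"
    by (intro transfer_eq_finite_sum[OF S F(1)]) (simp add: br)
  also have "\<dots> = ennreal (\<Sum>b\<in>F. ?t b / lam)"
    unfolding br using t0 lam by (intro sum_ennreal) simp
  also have "(\<Sum>b\<in>F. ?t b / lam) = ruelle A \<phi> f x / lam"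
    unfolding ruelle_finite_sum[OF F x] by (simp add: sum_divide_distrib)
  finally show ?thesis .
qed

lemma transfer_power_eq_ruelle:
  assumes S: "countable (UNIV :: 's set)" "infinite (UNIV :: 's set)" and lc: "tms_locally_compact A"
    and F: "finite F" "supported_in A F f"
    and f: "\<And>y. y \<in> tms A \<Longrightarrow> 0 \<le> f y" and lam: "lam > 0"
  shows "x \<in> tms (A :: 's \<Rightarrow> 's \<Rightarrow> bool) \<Longrightarrow>
    (transfer A \<phi> lam ^^ n) (\<lambda>y. ennreal (f y)) x = ennreal (green_term A \<phi> lam f x n)"
proof (induction n arbitrary: x)
  case 0
  then show ?case by (simp add: green_term_def)
next
  case (Suc n)
  \<comment> \<open>The void second summand gives the scalar multiple the shape of the linear
    combinations treated earlier.\<close>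
  let ?g = "\<lambda>y. (1 / lam ^ n) * (ruelle A \<phi> ^^ n) f y + 0 * (ruelle A \<phi> ^^ n) f y"
  obtain F' where F': "finite F'" "supported_in A F' ((ruelle A \<phi> ^^ n) f)"
    using supported_in_ruelle_power[OF lc F] by blast
  have g: "green_term A \<phi> lam f y n = ?g y" for y by (simp add: green_term_def)
  have "(transfer A \<phi> lam ^^ Suc n) (\<lambda>y. ennreal (f y)) x =
      transfer A \<phi> lam (\<lambda>y. ennreal (?g y)) x"
    using Suc.IH unfolding g funpow.simps comp_apply by (rule transfer_cong[OF _ Suc.prems])
  also have "\<dots> = ennreal (ruelle A \<phi> ?g x / lam)"
    by (rule transfer_eq_ruelle[OF S F'(1) supported_in_lincomb[OF F'(2) F'(2)] _ lam Suc.prems])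
      (use ruelle_power_nonneg[of A f, OF f] lam in simp)
  also have "ruelle A \<phi> ?g x / lam = green_term A \<phi> lam f x (Suc n)"
    unfolding ruelle_lincomb[OF F'(1) F'(2) F'(2)] by (simp add: green_term_def)
  finally show ?case .
qed

section \<open>Distortion and the Green function\<close>

text \<open>\<open>enn2real\<close> sends an infinite variation to 0, so the value is reliable only
  from \<open>m = 2\<close> on, where summable variations guarantee finiteness.\<close>

definition var :: "('s \<Rightarrow> 's \<Rightarrow> bool) \<Rightarrow> ((nat \<Rightarrow> 's) \<Rightarrow> real) \<Rightarrow> nat \<Rightarrow> real" where
  "var A \<phi> m = enn2real (Var A m \<phi>)"

text \<open>The sum starts at \<open>Suc N\<close>: prepending a common letter to points that agree
  on \<open>N\<close> coordinates makes them agree on \<open>Suc N\<close>. For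
  \<open>N \<ge> 1\<close> only indices from 2 on occur.\<close>

definition var_tail :: "('s \<Rightarrow> 's \<Rightarrow> bool) \<Rightarrow> ((nat \<Rightarrow> 's) \<Rightarrow> real) \<Rightarrow> nat \<Rightarrow> real" where
  "var_tail A \<phi> N = (\<Sum>j. var A \<phi> (j + Suc N))"

lemma ennreal_var:
  assumes "summable_variations A \<phi>" "m \<ge> 2"
  shows "ennreal (var A \<phi> m) = Var A m \<phi>"
proof -
  obtain k where "m = k + 2" using assms(2) by (metis le_add_diff_inverse2)
  moreover have "Var A (k + 2) \<phi> < \<infinity>"
    using assms(1) unfolding summable_variations_def by (rule ennreal_suminf_lessD)
  ultimately show ?thesis by (simp add: var_def)
qed

lemma var_bound:
  assumes "summable_variations A \<phi>" "m \<ge> 2" "x \<in> tms A" "y \<in> tms A" "\<forall>i<m. x i = y i"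
  shows "\<bar>\<phi> x - \<phi> y\<bar> \<le> var A \<phi> m"
proof -
  have "ennreal \<bar>\<phi> x - \<phi> y\<bar> \<le> Var A m \<phi>"
    unfolding Var_def using assms(3-5) by (intro SUP_upper2[of "(x, y)"]) auto
  also have "\<dots> = ennreal (var A \<phi> m)" by (simp add: ennreal_var[OF assms(1,2)])
  finally show ?thesis by (simp add: var_def)
qed

lemma var_nonneg [simp]: "0 \<le> var A \<phi> m"
  by (simp add: var_def)

lemma summable_var:
  assumes "summable_variations A \<phi>" shows "summable (var A \<phi>)"
proof -
  have "(\<Sum>m. ennreal (var A \<phi> (m + 2))) \<noteq> top"
    using assms by (simp add: ennreal_var summable_variations_def)
  then have "summable (\<lambda>m. var A \<phi> (m + 2))"
    by (rule summable_suminf_not_top[rotated]) simp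
  then show ?thesis by (rule summable_iff_shift[THEN iffD1])
qed

lemma var_tail_Suc:
  assumes "summable_variations A \<phi>"
  shows "var_tail A \<phi> N = var A \<phi> (Suc N) + var_tail A \<phi> (Suc N)"
  using suminf_split_head[of "\<lambda>j. var A \<phi> (j + Suc N)"] summable_var[OF assms]
  by (simp add: var_tail_def summable_iff_shift[of _ "Suc N"] del: add_Suc_right) simp

lemma var_tail_nonneg: "summable_variations A \<phi> \<Longrightarrow> 0 \<le> var_tail A \<phi> N"
  unfolding var_tail_def using summable_var[of A \<phi>]
  by (intro suminf_nonneg) (simp_all add: summable_iff_shift del: add_Suc_right)

lemma var_tail_tendsto:
  assumes "summable_variations A \<phi>" shows "var_tail A \<phi> \<longlonglongrightarrow> 0"
proof (rule LIMSEQ_I)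
  fix r :: real assume "0 < r"
  from suminf_exist_split[OF this summable_var[OF assms]]
  obtain N where "\<forall>n\<ge>N. norm (\<Sum>i. var A \<phi> (i + n)) < r" by blast
  then have "\<forall>n\<ge>N. norm (var_tail A \<phi> n - 0) < r"
    unfolding var_tail_def diff_0_right using le_SucI by blast
  then show "\<exists>N. \<forall>n\<ge>N. norm (var_tail A \<phi> n - 0) < r" by blast
qed

text \<open>Each prepended letter lengthens the agreement by one and costs a factor
  \<open>exp (var A \<phi> (Suc N))\<close> at the current \<open>N\<close>; the costs add up to at
  most the tail, uniformly in \<open>n\<close>. \<open>1 \<le> N\<close> ensures that the same
  letters may precede \<open>x\<close> and \<open>y\<close>. The condition on \<open>f\<close>
  applies in both orders, so \<open>f\<close> depends only on the first \<open>N\<close>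
  coordinates.\<close>

lemma transfer_power_distortion:
  assumes sv: "summable_variations A \<phi>" and lam: "lam > 0"
  shows "1 \<le> N \<Longrightarrow> (\<And>x y. x \<in> tms A \<Longrightarrow> y \<in> tms A \<Longrightarrow> \<forall>i<N. x i = y i \<Longrightarrow> f x \<le> f y) \<Longrightarrow>
    x \<in> tms A \<Longrightarrow> y \<in> tms A \<Longrightarrow> \<forall>i<N. x i = y i \<Longrightarrow>
    (transfer A \<phi> lam ^^ n) f x \<le> ennreal (exp (var_tail A \<phi> N)) * (transfer A \<phi> lam ^^ n) f y"
proof (induction n arbitrary: N x y)
  case 0
  have "ennreal 1 \<le> ennreal (exp (var_tail A \<phi> N))"
    using var_tail_nonneg[OF sv, of N] by (intro ennreal_leI) simp
  then have "1 * f y \<le> ennreal (exp (var_tail A \<phi> N)) * f y"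
    by (intro mult_right_mono) auto
  then show ?case using 0(2)[OF 0(3-5)] by simp
next
  case (Suc n)
  let ?g = "(transfer A \<phi> lam ^^ n) f"
  have br: "branch A \<phi> lam b ?g x \<le> ennreal (exp (var_tail A \<phi> N)) * branch A \<phi> lam b ?g y" for b
  proof (cases "A b (y 0)")
    case True
    have eq0: "x 0 = y 0" using Suc.prems(1,5) by simp
    have bx: "case_nat b x \<in> tms A" "case_nat b y \<in> tms A"
      using Suc.prems(3,4) True eq0 by (simp_all add: case_nat_in_tms)
    have agree: "\<forall>i<Suc N. case_nat b x i = case_nat b y i"
      using Suc.prems(5) by (auto split: nat.split)
    have "?g (case_nat b x) \<le> ennreal (exp (var_tail A \<phi> (Suc N))) * ?g (case_nat b y)"
    proof (rule Suc.IH[OF _ _ bx agree])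
      fix x y assume "x \<in> tms A" "y \<in> tms A" "\<forall>i<Suc N. x i = y i"
      then show "f x \<le> f y" by (intro Suc.prems(2)) auto
    qed simp
    moreover have "\<bar>\<phi> (case_nat b x) - \<phi> (case_nat b y)\<bar> \<le> var A \<phi> (Suc N)"
      using Suc.prems(1) by (intro var_bound[OF sv _ bx agree]) simp
    then have "exp (\<phi> (case_nat b x)) / lam \<le> exp (var A \<phi> (Suc N)) * (exp (\<phi> (case_nat b y)) / lam)"
      using lam by (simp add: divide_right_mono exp_add[symmetric])
    ultimately have "ennreal (exp (\<phi> (case_nat b x)) / lam) * ?g (case_nat b x) \<le>
        ennreal (exp (var A \<phi> (Suc N)) * (exp (\<phi> (case_nat b y)) / lam)) *
        (ennreal (exp (var_tail A \<phi> (Suc N))) * ?g (case_nat b y))"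
      by (intro mult_mono ennreal_leI) auto
    also have "\<dots> = (ennreal (exp (var A \<phi> (Suc N))) * ennreal (exp (var_tail A \<phi> (Suc N)))) *
        (ennreal (exp (\<phi> (case_nat b y)) / lam) * ?g (case_nat b y))"
      using lam by (subst ennreal_mult) (auto simp: mult_ac)
    also have "ennreal (exp (var A \<phi> (Suc N))) * ennreal (exp (var_tail A \<phi> (Suc N))) =
        ennreal (exp (var_tail A \<phi> N))"
      by (simp add: var_tail_Suc[OF sv, of N] exp_add ennreal_mult)
    finally show ?thesis
      using True eq0 by (simp add: branch_def)
  next
    case False
    then show ?thesis using Suc.prems(1,5) by (simp add: branch_def)
  qed
  have "(transfer A \<phi> lam ^^ Suc n) f x \<le>
      (\<Sum>k. ennreal (exp (var_tail A \<phi> N)) * branch A \<phi> lam (from_nat_into UNIV k) ?g y)"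
    unfolding funpow.simps comp_apply transfer_def[of A \<phi> lam ?g x] by (intro suminf_le br) auto
  then show ?case by (simp add: transfer_def[of A \<phi> lam ?g y])
qed

text \<open>The distortion factor is independent of \<open>n\<close> and therefore passes through
  the series.\<close>

lemma potential_distortion:
  assumes "summable_variations A \<phi>" "lam > 0" "1 \<le> N"
    "\<And>x y. x \<in> tms A \<Longrightarrow> y \<in> tms A \<Longrightarrow> \<forall>i<N. x i = y i \<Longrightarrow> f x \<le> f y"
    "x \<in> tms A" "y \<in> tms A" "\<forall>i<N. x i = y i"
  shows "potential A \<phi> lam f x \<le> ennreal (exp (var_tail A \<phi> N)) * potential A \<phi> lam f y"
proof -
  have "potential A \<phi> lam f x \<le> (\<Sum>n. ennreal (exp (var_tail A \<phi> N)) * (transfer A \<phi> lam ^^ n) f y)"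
    unfolding potential_def
    by (intro suminf_le transfer_power_distortion assms) auto
  then show ?thesis by (simp add: potential_def)
qed

section \<open>Linearity, positivity and continuity of the Green function\<close>

locale transient_shift =
  fixes A :: "'s \<Rightarrow> 's \<Rightarrow> bool"
    and \<phi> :: "(nat \<Rightarrow> 's) \<Rightarrow> real"
    and lam :: real
    and orig :: 's
  assumes countable_states: "countable (UNIV :: 's set)"
    and infinite_states: "infinite (UNIV :: 's set)"
    and transitive: "tms_transitive A"
    and locally_compact: "tms_locally_compact A"
    and lam_pos: "lam > 0"
    and summable_variations: "summable_variations A \<phi>"
    and transient: "transient A \<phi> lam"
begin

abbreviation "X \<equiv> tms A"
abbreviation "BX \<equiv> borel_sigma (tms_top A)"
abbreviation "P \<equiv> transfer A \<phi> lam"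
abbreviation "G \<equiv> potential A \<phi> lam"
abbreviation "g \<equiv> green A \<phi> lam"
abbreviation "K \<equiv> martin_kernel A \<phi> lam orig"
abbreviation "cyl w \<equiv> (indicator (cylinder A w) :: (nat \<Rightarrow> 's) \<Rightarrow> real)"

text \<open>For finite \<open>F\<close> the set \<open>starting_in A F\<close> is closed and
  compact, hence it contains the closed support, and compactness becomes a condition on first
  letters.\<close>

lemma Cc_iff: "f \<in> Cc A \<longleftrightarrow>
  continuous_map (tms_top A) euclideanreal f \<and> (\<exists>F. finite F \<and> supported_in A F f)"
proof
  assume "f \<in> Cc A"
  then show "continuous_map (tms_top A) euclideanreal f \<and> (\<exists>F. finite F \<and> supported_in A F f)"
    using Cc_supported_in[of f A] by (auto simp: Cc_def)
next
  assume r: "continuous_map (tms_top A) euclideanreal f \<and> (\<exists>F. finite F \<and> supported_in A F f)"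
  then obtain F where F: "finite F" "supported_in A F f" by blast
  have cl: "closedin (tms_top A) (starting_in A F)"
    unfolding closedin_def openin_tms_top by (auto simp: starting_in_def intro!: exI[of _ 1])
  have "tms_top A closure_of {x \<in> tms A. f x \<noteq> 0} \<subseteq> starting_in A F"
    using F(2) by (intro closure_of_minimal cl) (auto simp: supported_in_def starting_in_def)
  then have "compactin (tms_top A) (tms_top A closure_of {x \<in> tms A. f x \<noteq> 0})"
    using closed_compactin[OF compactin_starting_in[OF locally_compact F(1)]] closedin_closure_of by blast
  with r show "f \<in> Cc A" by (simp add: Cc_def)
qed

lemma Cc_common_support:
  assumes "f \<in> Cc A" "h \<in> Cc A"
  obtains F where "finite F" "supported_in A F f" "supported_in A F h"
proof -
  obtain F1 where "finite F1" "supported_in A F1 f" using Cc_supported_in[OF assms(1)] .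
  moreover obtain F2 where "finite F2" "supported_in A F2 h" using Cc_supported_in[OF assms(2)] .
  ultimately show ?thesis
    by (intro that[of "F1 \<union> F2"]) (auto intro: supported_in_mono)
qed

lemma Cc_lincomb:
  assumes "f \<in> Cc A" "h \<in> Cc A"
  shows "(\<lambda>x. a * f x + b * h x) \<in> Cc A"
proof -
  obtain F where "finite F" "supported_in A F f" "supported_in A F h"
    using Cc_common_support[OF assms] .
  then have "finite F \<and> supported_in A F (\<lambda>x. a * f x + b * h x)"
    using supported_in_lincomb by blast
  moreover have "continuous_map (tms_top A) euclideanreal (\<lambda>x. a * f x + b * h x)"
    using assms unfolding Cc_iff
    by (intro continuous_map_add continuous_map_real_mult continuous_map_const[THEN iffD2]) auto
  ultimately show ?thesis unfolding Cc_iff by blast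
qed

lemma Cc_pos_part:
  assumes "f \<in> Cc A"
  shows "(\<lambda>x. max 0 (f x)) \<in> Cc_pos A"
proof -
  obtain F where "finite F" "supported_in A F f" using Cc_supported_in[OF assms] .
  then have "finite F \<and> supported_in A F (\<lambda>x. max 0 (f x))"
    by (auto simp: supported_in_def)
  moreover have "continuous_map (tms_top A) euclideanreal (\<lambda>x. max 0 (f x))"
    using assms unfolding Cc_iff by (intro continuous_map_real_max) auto
  ultimately show ?thesis unfolding Cc_pos_def Cc_iff by auto
qed

lemma Cc_pos_cylinder: "w \<noteq> [] \<Longrightarrow> cyl w \<in> Cc_pos A"
  by (rule indicator_cylinder_Cc[OF locally_compact])

lemma Cc_pos_imp_Cc: "f \<in> Cc_pos A \<Longrightarrow> f \<in> Cc A"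
  by (simp add: Cc_pos_def)

lemma summable_green_pos:
  assumes f: "f \<in> Cc_pos A" and x: "x \<in> X"
  shows "summable (green_term A \<phi> lam f x)"
proof (cases "\<exists>y\<in>X. f y \<noteq> 0")
  case True
  then show ?thesis using transient f x by (auto simp: transient_def)
next
  case False
  \<comment> \<open>Transience speaks only of functions that are nonzero somewhere on
    \<open>X\<close>; otherwise all terms of the series are 0.\<close>
  have "\<forall>y\<in>X. (ruelle A \<phi> ^^ n) f y = 0" for n
  proof (induction n)
    case (Suc n)
    then show ?case by (auto simp: ruelle_def intro!: infsum_0)
  qed (use False in auto)
  then have "green_term A \<phi> lam f x = (\<lambda>n. 0)"
    using x by (auto simp: green_term_def)
  then show ?thesis by simp
qed

lemma green_term_nonneg:
  "(\<And>y. y \<in> X \<Longrightarrow> 0 \<le> f y) \<Longrightarrow> x \<in> X \<Longrightarrow> 0 \<le> green_term A \<phi> lam f x n"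
  using ruelle_power_nonneg[of A f x n \<phi>] lam_pos by (simp add: green_term_def)

lemma green_term_lincomb:
  assumes "f \<in> Cc A" "h \<in> Cc A"
  shows "green_term A \<phi> lam (\<lambda>x. a * f x + b * h x) x n =
    a * green_term A \<phi> lam f x n + b * green_term A \<phi> lam h x n"
proof -
  obtain F where F: "finite F" "supported_in A F f" "supported_in A F h"
    using Cc_common_support[OF assms] .
  show ?thesis
    by (simp add: green_term_def ruelle_power_lincomb[OF locally_compact F] add_divide_distrib)
qed

lemma summable_green:
  assumes f: "f \<in> Cc A" and x: "x \<in> X"
  shows "summable (green_term A \<phi> lam f x)"
proof -
  let ?p = "\<lambda>x. max 0 (f x)" and ?q = "\<lambda>x. max 0 ((-1) * f x + 0 * f x)"
  have pq: "?p \<in> Cc_pos A" "?q \<in> Cc_pos A"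
    by (rule Cc_pos_part[OF f], rule Cc_pos_part[OF Cc_lincomb[OF f f]])
  have "f = (\<lambda>x. 1 * ?p x + (-1) * ?q x)" by (auto simp: max_def)
  then have eq: "green_term A \<phi> lam f x = (\<lambda>n. 1 * green_term A \<phi> lam ?p x n + (-1) * green_term A \<phi> lam ?q x n)"
    using green_term_lincomb[OF pq[THEN Cc_pos_imp_Cc], of 1 "-1" x] by (intro ext) simp
  show ?thesis
    unfolding eq by (intro summable_add summable_mult summable_green_pos pq x)
qed

lemma green_lincomb:
  assumes "f \<in> Cc A" "h \<in> Cc A" "x \<in> X"
  shows "g (\<lambda>x. a * f x + b * h x) x = a * g f x + b * g h x"
  unfolding green_def green_term_lincomb[OF assms(1,2)]
  using summable_green[OF _ assms(3)] assms(1,2)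
  by (simp add: suminf_add[symmetric] suminf_mult summable_mult)

lemma green_nonneg: "f \<in> Cc_pos A \<Longrightarrow> x \<in> X \<Longrightarrow> 0 \<le> g f x"
  unfolding green_def
  by (intro suminf_nonneg summable_green_pos green_term_nonneg) (auto simp: Cc_pos_def)

text \<open>The bridge between the two settings: measurability and integration are handled with
  \<open>G\<close>, linearity and the Martin kernel with \<open>g\<close>.\<close>

lemma potential_eq_green:
  assumes f: "f \<in> Cc_pos A" and x: "x \<in> X"
  shows "G (\<lambda>y. ennreal (f y)) x = ennreal (g f x)"
proof -
  obtain F where F: "finite F" "supported_in A F f" using Cc_supported_in[OF Cc_pos_imp_Cc[OF f]] .
  have f0: "0 \<le> f y" if "y \<in> X" for y using f that by (simp add: Cc_pos_def)
  have "G (\<lambda>y. ennreal (f y)) x = (\<Sum>n. ennreal (green_term A \<phi> lam f x n))"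
    unfolding potential_def
    using transfer_power_eq_ruelle[OF countable_states infinite_states locally_compact F f0 lam_pos x]
    by simp
  also have "\<dots> = ennreal (g f x)"
    unfolding green_def by (rule suminf_ennreal2[OF green_term_nonneg[OF f0 x] summable_green_pos[OF f x]])
  finally show ?thesis .
qed

lemma potential_cylinder:
  "w \<noteq> [] \<Longrightarrow> x \<in> X \<Longrightarrow> G (indicator (cylinder A w)) x = ennreal (g (cyl w) x)"
  using potential_eq_green[OF Cc_pos_cylinder] by (simp add: ennreal_indicator)

text \<open>The one branch that retraces the orbit of \<open>y\<close> backwards already contributes
  a positive term.\<close>

lemma transfer_power_pos:
  "y \<in> X \<Longrightarrow> 0 < f y \<Longrightarrow> 0 < (P ^^ n) f ((shift ^^ n) y)"
proof (induction n)
  case (Suc n)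
  let ?z = "(shift ^^ n) y"
  have z: "?z \<in> X" using Suc.prems(1) by (rule shift_power_in_tms)
  have "0 < (P ^^ n) f ?z" by (rule Suc.IH[OF Suc.prems])
  moreover have "A (?z 0) (shift ?z 0)" using z by (simp add: tms_def shift_def)
  ultimately have pos: "0 < branch A \<phi> lam (?z 0) ((P ^^ n) f) (shift ?z)"
    using lam_pos by (simp add: branch_def case_nat_shift ennreal_zero_less_mult_iff)
  have "surj (from_nat_into (UNIV :: 's set))"
    using bij_betw_from_nat_into[OF countable_states infinite_states] by (simp add: bij_betw_def)
  then obtain k where k: "from_nat_into UNIV k = ?z 0" by (metis surjD)
  have "branch A \<phi> lam (from_nat_into UNIV k) ((P ^^ n) f) (shift ?z) \<le> P ((P ^^ n) f) (shift ?z)"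
    unfolding transfer_def[of A \<phi> lam "(P ^^ n) f" "shift ?z"]
    using sum_le_suminf[of "\<lambda>k. branch A \<phi> lam (from_nat_into UNIV k) ((P ^^ n) f) (shift ?z)" "{k}"] by simp
  then show ?case using pos k by simp
qed simp

text \<open>Transitivity provides a path from \<open>a\<close> to the state \<open>x 0\<close>; the
  sequence \<open>x\<close> is glued to its end.\<close>

lemma reachable:
  assumes x: "x \<in> X"
  obtains n y where "y \<in> X" "y 0 = a" "(shift ^^ n) y = x"
proof -
  obtain n where "n \<ge> 1" "{z \<in> X. (shift ^^ n) z \<in> cylinder A [x 0]} \<inter> cylinder A [a] \<noteq> {}"
    using transitive unfolding tms_transitive_def by blast
  then obtain z where z: "z \<in> X" "z n = x 0" "z 0 = a"
    by (auto simp: cylinder_def shift_power)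
  define y where "y i = (if i < n then z i else x (i - n))" for i
  have "A (y i) (y (Suc i))" for i
  proof -
    consider "Suc i < n" | "Suc i = n" | "n \<le> i" by linarith
    then show ?thesis
    proof cases
      case 2
      then have "y (Suc i) = z (Suc i)" "y i = z i" using z(2) by (auto simp: y_def)
      moreover have "A (z i) (z (Suc i))" using z(1) by (simp add: tms_def)
      ultimately show ?thesis by simp
    qed (use z(1) x in \<open>auto simp: y_def tms_def Suc_diff_le\<close>)
  qed
  then have "y \<in> X" by (simp add: tms_def)
  moreover have "y 0 = a" using z(3) \<open>n \<ge> 1\<close> by (simp add: y_def)
  moreover have "(shift ^^ n) y = x" by (auto simp: shift_power y_def)
  ultimately show ?thesis by (rule that)
qed

text \<open>For \<open>a = orig\<close> this makes the quotient defining the Martin kernel genuine,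
  and it lets the kernel be multiplied back by its denominator.\<close>

lemma green_cylinder_pos:
  assumes x: "x \<in> X"
  shows "0 < g (cyl [a]) x"
proof -
  obtain n y where y: "y \<in> X" "y 0 = a" "(shift ^^ n) y = x" using reachable[OF x] .
  have "0 < (P ^^ n) (indicator (cylinder A [a])) x"
    using transfer_power_pos[of y "indicator (cylinder A [a])" n] y by (simp add: cylinder_def)
  also have "\<dots> \<le> G (indicator (cylinder A [a])) x"
    unfolding potential_def
    using sum_le_suminf[of "\<lambda>n. (P ^^ n) (indicator (cylinder A [a])) x" "{n}"] by simp
  finally show ?thesis using x by (simp add: potential_cylinder)
qed

lemma green_cylinder_distortion:
  assumes "1 \<le> N" "length w \<le> N" "w \<noteq> []" "x \<in> X" "y \<in> X" "\<forall>i<N. x i = y i"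
  shows "g (cyl w) x \<le> exp (var_tail A \<phi> N) * g (cyl w) y"
proof -
  have "G (indicator (cylinder A w)) x \<le> ennreal (exp (var_tail A \<phi> N)) * G (indicator (cylinder A w)) y"
  proof (rule potential_distortion[OF summable_variations lam_pos assms(1) _ assms(4-6)])
    fix x y assume "x \<in> X" "y \<in> X" "\<forall>i<N. x i = y i"
    then have "x \<in> cylinder A w \<longleftrightarrow> y \<in> cylinder A w" using assms(2) by (simp add: cylinder_def)
    then show "(indicator (cylinder A w) x :: ennreal) \<le> indicator (cylinder A w) y"
      by (simp add: indicator_def)
  qed
  then show ?thesis
    using green_nonneg[OF Cc_pos_cylinder[OF assms(3)] assms(5)]
    by (simp add: potential_cylinder assms ennreal_mult[symmetric])
qed

text \<open>Points agreeing on \<open>N\<close> coordinates have values within the factor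
  \<open>exp (var_tail A \<phi> N)\<close> of each other, and this factor tends to 1.\<close>

lemma continuous_green_cylinder:
  assumes w: "w \<noteq> []"
  shows "continuous_map (tms_top A) euclideanreal (g (cyl w))"
  unfolding continuous_map_tms_real
proof (intro ballI allI impI)
  fix x and \<epsilon> :: real assume x: "x \<in> X" and "\<epsilon> > 0"
  let ?c = "g (cyl w) x"
  have c0: "0 \<le> ?c" by (rule green_nonneg[OF Cc_pos_cylinder[OF w] x])
  have "(\<lambda>N. (exp (var_tail A \<phi> N) - 1) * ?c) \<longlonglongrightarrow> (exp 0 - 1) * ?c"
    by (intro tendsto_intros var_tail_tendsto summable_variations)
  then have "\<forall>\<^sub>F N in sequentially. (exp (var_tail A \<phi> N) - 1) * ?c < \<epsilon>"
    using \<open>\<epsilon> > 0\<close> by (intro order_tendstoD(2)) auto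
  moreover have "\<forall>\<^sub>F N in sequentially. 1 + length w \<le> N" by (rule eventually_ge_at_top)
  ultimately have "\<forall>\<^sub>F N in sequentially. (exp (var_tail A \<phi> N) - 1) * ?c < \<epsilon> \<and> 1 + length w \<le> N"
    by (rule eventually_conj)
  then obtain N where N: "(exp (var_tail A \<phi> N) - 1) * ?c < \<epsilon>" "1 + length w \<le> N"
    by (auto simp: eventually_sequentially)
  have "\<bar>?c - g (cyl w) y\<bar> < \<epsilon>" if y: "y \<in> X" "\<forall>i<N. y i = x i" for y
  proof -
    let ?d = "g (cyl w) y" and ?e = "exp (var_tail A \<phi> N)"
    have 1: "?c \<le> ?e * ?d"
      by (rule green_cylinder_distortion) (use N(2) w x y in auto)
    have 2: "?d \<le> ?e * ?c"
      by (rule green_cylinder_distortion) (use N(2) w x y in auto)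
    have e: "1 \<le> ?e" using var_tail_nonneg[OF summable_variations] by simp
    have "?d - ?c < \<epsilon>" using 2 N(1) by (simp add: algebra_simps)
    moreover have "?c - ?d < \<epsilon>"
    proof (cases "?d \<le> ?c")
      case True
      then have "(?e - 1) * ?d \<le> (?e - 1) * ?c" using e by (intro mult_left_mono) auto
      then show ?thesis using 1 N(1) by (simp add: algebra_simps)
    qed (use \<open>\<epsilon> > 0\<close> in simp)
    ultimately show ?thesis by (simp add: abs_less_iff)
  qed
  then show "\<exists>n. \<forall>y\<in>X. (\<forall>i<n. y i = x i) \<longrightarrow> \<bar>?c - g (cyl w) y\<bar> < \<epsilon>" by blast
qed

lemma continuous_phi: "continuous_map (tms_top A) euclideanreal \<phi>"
  unfolding continuous_map_tms_real
proof (intro ballI allI impI)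
  fix x and \<epsilon> :: real assume x: "x \<in> X" and "\<epsilon> > 0"
  have "var A \<phi> \<longlonglongrightarrow> 0"
    by (rule summable_LIMSEQ_zero[OF summable_var[OF summable_variations]])
  then have "\<forall>\<^sub>F N in sequentially. var A \<phi> N < \<epsilon>"
    using \<open>\<epsilon> > 0\<close> by (rule order_tendstoD(2))
  then have "\<forall>\<^sub>F N in sequentially. var A \<phi> N < \<epsilon> \<and> 2 \<le> N"
    using eventually_ge_at_top by (rule eventually_conj)
  then obtain N where N: "var A \<phi> N < \<epsilon>" "2 \<le> N"
    by (auto simp: eventually_sequentially)
  have "\<bar>\<phi> x - \<phi> y\<bar> < \<epsilon>" if y: "y \<in> X" "\<forall>i<N. y i = x i" for y
    using var_bound[OF summable_variations N(2) x y(1)] y(2) N(1) by auto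
  then show "\<exists>n. \<forall>y\<in>X. (\<forall>i<n. y i = x i) \<longrightarrow> \<bar>\<phi> x - \<phi> y\<bar> < \<epsilon>" by blast
qed

lemma continuous_kernel_cylinder:
  assumes "w \<noteq> []"
  shows "continuous_map (tms_top A) euclideanreal (K (cyl w))"
proof -
  have "g (cyl [orig]) x \<noteq> 0" if "x \<in> X" for x
    using green_cylinder_pos[OF that, of orig] by simp
  then show ?thesis
    unfolding martin_kernel_def
    by (intro continuous_map_real_divide continuous_green_cylinder assms) auto
qed

lemma kernel_lincomb:
  "f \<in> Cc A \<Longrightarrow> h \<in> Cc A \<Longrightarrow> x \<in> X \<Longrightarrow> K (\<lambda>x. a * f x + b * h x) x = a * K f x + b * K h x"
  by (simp add: martin_kernel_def green_lincomb add_divide_distrib)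

lemma kernel_nonneg: "f \<in> Cc_pos A \<Longrightarrow> x \<in> X \<Longrightarrow> 0 \<le> K f x"
  using green_nonneg green_cylinder_pos[of x orig] by (simp add: martin_kernel_def)

end

section \<open>Conformal measures and last exits\<close>

definition last_exit :: "('s \<Rightarrow> 's \<Rightarrow> bool) \<Rightarrow> 's set \<Rightarrow> (nat \<Rightarrow> 's) set" where
  "last_exit A F = {y \<in> tms A. y 0 \<in> F \<and> (\<forall>i\<ge>1. y i \<notin> F)}"

lemma coordinate_measurable: "{y \<in> tms A. y i \<in> F} \<in> sets (borel_sigma (tms_top A))"
  by (rule openin_borel_sigma) (auto simp: openin_tms_top intro!: exI[of _ "Suc i"])

lemma last_exit_measurable: "last_exit A F \<in> sets (borel_sigma (tms_top A))"
proof -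
  have "last_exit A F = {y \<in> tms A. y 0 \<in> F} \<inter> (\<Inter>i\<in>{1..}. {y \<in> tms A. y i \<in> - F})"
    by (auto simp: last_exit_def)
  also have "\<dots> \<in> sets (borel_sigma (tms_top A))"
    by (intro sets.Int coordinate_measurable sets.countable_INT') (auto simp: coordinate_measurable simp del: Compl_iff)
  finally show ?thesis .
qed

lemma shift_measurable: "shift \<in> measurable (borel_sigma (tms_top A)) (borel_sigma (tms_top A))"
proof (rule continuous_map_borel_sigma)
  show "continuous_map (tms_top A) (tms_top A) shift"
    unfolding continuous_map_def
  proof (intro conjI allI impI)
    fix U assume U: "openin (tms_top A) U"
    have "\<exists>n. \<forall>y\<in>tms A. (\<forall>i<n. y i = x i) \<longrightarrow> shift y \<in> U" if x: "x \<in> tms A" "shift x \<in> U" for x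
    proof -
      obtain n where n: "\<forall>y\<in>tms A. (\<forall>i<n. y i = shift x i) \<longrightarrow> y \<in> U"
        using U x(2) unfolding openin_tms_top by blast
      have "shift y \<in> U" if "y \<in> tms A" "\<forall>i<Suc n. y i = x i" for y
        using n that shift_in_tms[of y A] by (auto simp: shift_def)
      then show ?thesis by blast
    qed
    then show "openin (tms_top A) {x \<in> topspace (tms_top A). shift x \<in> U}"
      unfolding openin_tms_top by (auto intro: shift_in_tms)
  qed (auto intro: shift_in_tms)
qed

lemma shift_power_measurable:
  "shift ^^ n \<in> measurable (borel_sigma (tms_top A)) (borel_sigma (tms_top A))"
proof (induction n)
  case (Suc n)
  show ?case using measurable_comp[OF Suc.IH shift_measurable] by (simp add: comp_def)
qed simp

text \<open>The value \<open>x\<close> off the domain \<open>A b (x 0)\<close> only serves to keep \<open>prepend\<close> a map of the shift space into itself.\<close>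

definition prepend :: "('s \<Rightarrow> 's \<Rightarrow> bool) \<Rightarrow> 's \<Rightarrow> (nat \<Rightarrow> 's) \<Rightarrow> nat \<Rightarrow> 's" where
  "prepend A b x = (if A b (x 0) then case_nat b x else x)"

lemma prepend_measurable:
  "prepend A b \<in> measurable (borel_sigma (tms_top A)) (borel_sigma (tms_top A))"
proof (rule continuous_map_borel_sigma)
  have X: "prepend A b x \<in> tms A" if "x \<in> tms A" for x
    using that by (simp add: prepend_def case_nat_in_tms)
  show "continuous_map (tms_top A) (tms_top A) (prepend A b)"
    unfolding continuous_map_def
  proof (intro conjI allI impI)
    fix U assume U: "openin (tms_top A) U"
    have "\<exists>n. \<forall>y\<in>tms A. (\<forall>i<n. y i = x i) \<longrightarrow> prepend A b y \<in> U"
      if x: "x \<in> tms A" "prepend A b x \<in> U" for x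
    proof -
      obtain n where n: "\<forall>y\<in>tms A. (\<forall>i<n. y i = prepend A b x i) \<longrightarrow> y \<in> U"
        using U x(2) unfolding openin_tms_top by blast
      have "prepend A b y \<in> U" if y: "y \<in> tms A" "\<forall>i<Suc n. y i = x i" for y
      proof -
        have "y 0 = x 0" using y(2) by simp
        then have "\<forall>i<n. prepend A b y i = prepend A b x i"
          using y(2) by (auto simp: prepend_def split: nat.split)
        then show ?thesis using n X[OF y(1)] by blast
      qed
      then show ?thesis by blast
    qed
    then show "openin (tms_top A) {x \<in> topspace (tms_top A). prepend A b x \<in> U}"
      unfolding openin_tms_top by (auto intro: X)
  qed (auto intro: X)
qed

context transient_shift
begin

text \<open>It vanishes where \<open>b\<close> cannot precede \<open>x\<close>, which hides the
  default value of \<open>prepend\<close>.\<close>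

definition branch_weight :: "'s \<Rightarrow> (nat \<Rightarrow> 's) \<Rightarrow> ennreal" where
  "branch_weight b x = indicator {x \<in> X. x 0 \<in> {c. A b c}} x * ennreal (exp (\<phi> (prepend A b x)) / lam)"

lemma branch_weight_measurable: "branch_weight b \<in> borel_measurable BX"
proof -
  have "(\<lambda>x. \<phi> (prepend A b x)) \<in> borel_measurable BX"
    using measurable_compose[OF prepend_measurable continuous_map_borel_measurable[OF continuous_phi]] .
  then have "(\<lambda>x. ennreal (exp (\<phi> (prepend A b x)) / lam)) \<in> borel_measurable BX"
    by measurable
  then show ?thesis
    unfolding branch_weight_def
    by (intro borel_measurable_times_ennreal borel_measurable_indicator coordinate_measurable)
qed

lemma branch_eq: "x \<in> X \<Longrightarrow> branch A \<phi> lam b f x = branch_weight b x * f (prepend A b x)"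
  by (simp add: branch_def branch_weight_def prepend_def)

lemma branch_measurable:
  assumes "f \<in> borel_measurable BX"
  shows "branch A \<phi> lam b f \<in> borel_measurable BX"
proof -
  have "(\<lambda>x. branch_weight b x * f (prepend A b x)) \<in> borel_measurable BX"
    using measurable_compose[OF prepend_measurable assms]
    by (intro borel_measurable_times_ennreal branch_weight_measurable)
  then show ?thesis
    by (subst measurable_cong[of _ _ "\<lambda>x. branch_weight b x * f (prepend A b x)"])
      (simp_all add: branch_eq)
qed

lemma transfer_measurable: "f \<in> borel_measurable BX \<Longrightarrow> P f \<in> borel_measurable BX"
  using branch_measurable[of f] unfolding transfer_def by measurable

lemma transfer_power_measurable: "f \<in> borel_measurable BX \<Longrightarrow> (P ^^ n) f \<in> borel_measurable BX"
  by (induction n) (auto intro: transfer_measurable)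

lemma potential_measurable: "f \<in> borel_measurable BX \<Longrightarrow> G f \<in> borel_measurable BX"
  using transfer_power_measurable[of f] unfolding potential_def by measurable

text \<open>Points of \<open>[a]\<close> share their first coordinate, so distortion with
  \<open>N = 1\<close> bounds the potential on all of \<open>[a]\<close> by its value at a single
  point.\<close>

lemma potential_cylinder_bounded:
  obtains c :: ennreal where "c < \<infinity>" "\<forall>x\<in>cylinder A [a]. G (indicator (cylinder A [b])) x \<le> c"
proof (cases "cylinder A [a] = {}")
  case False
  then obtain y where y: "y \<in> X" "y 0 = a" by (auto simp: cylinder_def)
  show ?thesis
  proof (rule that)
    show "ennreal (exp (var_tail A \<phi> 1) * g (cyl [b]) y) < \<infinity>" by simp
    show "\<forall>x\<in>cylinder A [a].
        G (indicator (cylinder A [b])) x \<le> ennreal (exp (var_tail A \<phi> 1) * g (cyl [b]) y)"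
    proof
      fix x assume "x \<in> cylinder A [a]"
      then have "x \<in> X" "x 0 = a" by (auto simp: cylinder_def)
      then show "G (indicator (cylinder A [b])) x \<le> ennreal (exp (var_tail A \<phi> 1) * g (cyl [b]) y)"
        using green_cylinder_distortion[of 1 "[b]" x y] y
        by (simp add: potential_cylinder ennreal_leI)
    qed
  qed
qed (auto intro: that[of 0])

end

section \<open>Conformality as invariance under the transfer operator\<close>

locale conformal_measure = transient_shift A \<phi> lam orig
  for A :: "'s \<Rightarrow> 's \<Rightarrow> bool" and \<phi> lam orig +
  fixes \<mu> :: "(nat \<Rightarrow> 's) measure"
  assumes conformal: "\<mu> \<in> Conf A \<phi> lam"
begin

lemma sets_mu [measurable_cong]: "sets \<mu> = sets BX"
  using conformal by (simp add: Conf_def radon_measure_def)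

lemma space_mu: "space \<mu> = X"
  using sets_eq_imp_space_eq[OF sets_mu] by simp

lemma measurable_mu: "measurable \<mu> N = measurable BX N"
  by (rule measurable_cong_sets[OF sets_mu refl])

lemma cylinder_finite: "w \<noteq> [] \<Longrightarrow> emeasure \<mu> (cylinder A w) < \<infinity>"
  using conformal compactin_cylinder[OF locally_compact] by (simp add: Conf_def radon_measure_def)

text \<open>On functions living on words that begin with \<open>a\<close>, only the branch of
  \<open>a\<close> is nonzero, and it equals the whole operator. The conformality equation for the
  compact cylinder then gives the integral.\<close>

lemma nn_integral_branch_cylinder:
  "(\<integral>\<^sup>+x. branch A \<phi> lam b (indicator (cylinder A (a # w))) x \<partial>\<mu>) =
    (if a = b then emeasure \<mu> (cylinder A (a # w)) else 0)"
proof (cases "a = b")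
  case True
  let ?C = "cylinder A (a # w)"
  have sup: "supported_in A {a} (cyl (a # w))"
    by (auto simp: supported_in_def cylinder_def indicator_def)
  have other: "branch A \<phi> lam c (indicator ?C) x = 0" if "c \<notin> {b}" for c x
    using that True by (auto simp: branch_def cylinder_def indicator_def)
  have "branch A \<phi> lam b (indicator ?C) x = ennreal (ruelle A \<phi> (indicator ?C) x) * ennreal (1 / lam)"
    if x: "x \<in> X" for x
  proof -
    have "branch A \<phi> lam b (indicator ?C) x = P (indicator ?C) x"
      using transfer_eq_finite_sum[OF countable_states infinite_states, of "{b}" A \<phi> lam "indicator ?C" x] other
      by simp
    also have "\<dots> = P (\<lambda>y. ennreal (cyl (a # w) y)) x"
      by (simp add: ennreal_indicator)
    also have "\<dots> = ennreal (ruelle A \<phi> (indicator ?C) x / lam)"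
      by (rule transfer_eq_ruelle[OF countable_states infinite_states _ sup _ lam_pos x]) auto
    also have "\<dots> = ennreal (ruelle A \<phi> (indicator ?C) x) * ennreal (1 / lam)"
      using lam_pos ruelle_nonneg[of A "cyl (a # w)" \<phi> x] by (simp add: ennreal_mult[symmetric])
    finally show ?thesis .
  qed
  moreover have "(\<lambda>x. ennreal (ruelle A \<phi> (indicator ?C) x) * ennreal (1 / lam)) \<in> borel_measurable \<mu>"
    using branch_measurable[OF borel_measurable_indicator[OF cylinder_measurable[of A "a # w"]], of b]
      measurable_cong[of \<mu> "branch A \<phi> lam b (indicator ?C)"
        "\<lambda>x. ennreal (ruelle A \<phi> (indicator ?C) x) * ennreal (1 / lam)" borel] calculation
    by (simp add: space_mu measurable_mu)
  ultimately have "(\<integral>\<^sup>+x. branch A \<phi> lam b (indicator ?C) x \<partial>\<mu>) * ennreal lam =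
      (\<integral>\<^sup>+x. ennreal (ruelle A \<phi> (indicator ?C) x) * ennreal (1 / lam) * ennreal lam \<partial>\<mu>)"
    by (subst nn_integral_multc) (auto intro!: arg_cong2[where f="(*)"] nn_integral_cong simp: space_mu)
  also have "\<dots> = (\<integral>\<^sup>+x. ennreal (ruelle A \<phi> (indicator ?C) x) \<partial>\<mu>)"
    using lam_pos by (simp add: mult.assoc ennreal_mult[symmetric])
  also have "\<dots> = emeasure \<mu> ?C * ennreal lam"
    using conformal compactin_cylinder[OF locally_compact, of "a # w"] by (simp add: Conf_def mult.commute)
  finally show ?thesis
    using True lam_pos by (simp add: mult.commute[of _ "ennreal lam"] ennreal_mult_cancel_left)
next
  case False
  then have "branch A \<phi> lam b (indicator (cylinder A (a # w))) x = 0" for x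
    by (auto simp: branch_def cylinder_def indicator_def)
  then show ?thesis using False by simp
qed

text \<open>Both sides integrate \<open>f\<close> against a measure: \<open>N1\<close> is the
  weighted image of \<open>\<mu>\<close> under prepending \<open>b\<close>, and \<open>N2\<close> is
  \<open>\<mu>\<close> restricted to \<open>[b]\<close>. They agree on the pi-system of cylinders
  and are finite on the countable cover by one-letter cylinders, hence they coincide.\<close>

lemma nn_integral_branch:
  assumes f: "f \<in> borel_measurable BX"
  shows "(\<integral>\<^sup>+x. branch A \<phi> lam b f x \<partial>\<mu>) = (\<integral>\<^sup>+x. indicator (cylinder A [b]) x * f x \<partial>\<mu>)"
proof -
  define N1 where "N1 = distr (density \<mu> (branch_weight b)) BX (prepend A b)"
  define N2 where "N2 = density \<mu> (indicator (cylinder A [b]))"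
  have prep: "prepend A b \<in> measurable (density \<mu> (branch_weight b)) BX"
    using prepend_measurable[of A b] by (simp add: measurable_mu)
  have N1: "(\<integral>\<^sup>+x. h x \<partial>N1) = (\<integral>\<^sup>+x. branch A \<phi> lam b h x \<partial>\<mu>)" if h: "h \<in> borel_measurable BX" for h
  proof -
    have "(\<integral>\<^sup>+x. h x \<partial>N1) = (\<integral>\<^sup>+x. h (prepend A b x) \<partial>density \<mu> (branch_weight b))"
      unfolding N1_def by (rule nn_integral_distr[OF prep]) (simp add: h)
    also have "\<dots> = (\<integral>\<^sup>+x. branch_weight b x * h (prepend A b x) \<partial>\<mu>)"
      using branch_weight_measurable[of b] measurable_compose[OF prepend_measurable h, of b]
      by (intro nn_integral_density) (simp_all add: measurable_mu)
    also have "\<dots> = (\<integral>\<^sup>+x. branch A \<phi> lam b h x \<partial>\<mu>)"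
      by (intro nn_integral_cong) (simp add: branch_eq space_mu)
    finally show ?thesis .
  qed
  have cyl: "cylinder A w \<in> sets \<mu>" for w
    by (simp add: sets_mu cylinder_measurable)
  have N2: "(\<integral>\<^sup>+x. h x \<partial>N2) = (\<integral>\<^sup>+x. indicator (cylinder A [b]) x * h x \<partial>\<mu>)"
    if h: "h \<in> borel_measurable BX" for h
    unfolding N2_def using h cyl by (intro nn_integral_density) (simp_all add: measurable_mu)
  have eq: "emeasure N1 (cylinder A (a # w)) = emeasure N2 (cylinder A (a # w))" for a w
  proof -
    let ?C = "cylinder A (a # w)"
    have ind: "indicator ?C \<in> borel_measurable BX"
      by (intro borel_measurable_indicator cylinder_measurable)
    have "emeasure N1 ?C = (\<integral>\<^sup>+x. indicator ?C x \<partial>N1)"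
      by (simp add: N1_def cylinder_measurable)
    also have "\<dots> = (if a = b then emeasure \<mu> ?C else 0)"
      unfolding N1[OF ind] by (rule nn_integral_branch_cylinder)
    also have "\<dots> = (\<integral>\<^sup>+x. (if a = b then indicator ?C x else 0) \<partial>\<mu>)"
      using cyl by simp
    also have "\<dots> = (\<integral>\<^sup>+x. indicator (cylinder A [b]) x * indicator ?C x \<partial>\<mu>)"
      by (intro nn_integral_cong) (auto simp: cylinder_def indicator_def)
    also have "\<dots> = emeasure N2 ?C"
      unfolding N2[OF ind, symmetric] by (simp add: N2_def cyl)
    finally show ?thesis .
  qed
  have "N1 = N2"
  proof (rule measure_eqI_generator_eq_countable[OF Int_stable_cylinders])
    show "insert {} (cylinder A ` {w. w \<noteq> []}) \<subseteq> Pow X"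
      by (auto simp: cylinder_def)
    show "sets N1 = sigma_sets X (insert {} (cylinder A ` {w. w \<noteq> []}))"
      "sets N2 = sigma_sets X (insert {} (cylinder A ` {w. w \<noteq> []}))"
      using sets_borel_tms[OF countable_states, of A] by (simp_all add: N1_def N2_def sets_mu)
    show "emeasure N1 B = emeasure N2 B" if B: "B \<in> insert {} (cylinder A ` {w. w \<noteq> []})" for B
    proof (cases "B = {}")
      case False
      then obtain w where "w \<noteq> []" "B = cylinder A w" using B by auto
      then show ?thesis using eq by (metis neq_Nil_conv)
    qed simp
    let ?D = "range (\<lambda>a. cylinder A [a])"
    show "?D \<subseteq> insert {} (cylinder A ` {w. w \<noteq> []})" by auto
    show "\<Union>?D = X" by (auto simp: cylinder_def)
    show "countable ?D" using countable_states by simp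
    fix B assume "B \<in> ?D"
    then obtain a where B: "B = cylinder A [a]" by auto
    have "emeasure N1 B = (\<integral>\<^sup>+x. indicator B x \<partial>N1)"
      unfolding B by (simp add: N1_def cylinder_measurable)
    also have "\<dots> = (if a = b then emeasure \<mu> B else 0)"
      unfolding B N1[OF borel_measurable_indicator[OF cylinder_measurable]]
      by (rule nn_integral_branch_cylinder)
    also have "\<dots> \<noteq> \<infinity>" using cylinder_finite[of "[a]"] B by (auto simp: less_top)
    finally show "emeasure N1 B \<noteq> \<infinity>" .
  qed
  then show ?thesis using N1[OF f] N2[OF f] by simp
qed

lemma suminf_cylinders:
  assumes "x \<in> X"
  shows "(\<Sum>k. indicator (cylinder A [from_nat_into UNIV k]) x) = (1::ennreal)"
proof -
  have bij: "bij_betw (from_nat_into (UNIV :: 's set)) UNIV UNIV"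
    by (rule bij_betw_from_nat_into[OF countable_states infinite_states])
  then obtain k where k: "from_nat_into UNIV k = x 0" by (metis bij_betw_def surjD)
  have neq: "from_nat_into UNIV j \<noteq> x 0" if "j \<noteq> k" for j
    using bij that k by (metis bij_betw_def injD)
  have "indicator (cylinder A [from_nat_into UNIV j]) x = (0::ennreal)" if "j \<notin> {k}" for j
    using neq[of j] that by (auto simp: cylinder_def indicator_def)
  then have "(\<Sum>k. indicator (cylinder A [from_nat_into UNIV k]) x) =
      (\<Sum>k\<in>{k}. indicator (cylinder A [from_nat_into UNIV k]) x :: ennreal)"
    by (intro suminf_finite) simp_all
  then show ?thesis using k assms by (simp add: cylinder_def)
qed

text \<open>The one-letter cylinders partition \<open>X\<close>, so the branch identities add up.
  Conformality is thereby extended from compact sets to all nonnegative Borel functions.\<close>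

lemma nn_integral_transfer:
  assumes f: "f \<in> borel_measurable BX"
  shows "(\<integral>\<^sup>+x. P f x \<partial>\<mu>) = (\<integral>\<^sup>+x. f x \<partial>\<mu>)"
proof -
  let ?e = "from_nat_into (UNIV :: 's set)"
  have "(\<integral>\<^sup>+x. P f x \<partial>\<mu>) = (\<Sum>k. \<integral>\<^sup>+x. branch A \<phi> lam (?e k) f x \<partial>\<mu>)"
    unfolding transfer_def using branch_measurable[OF f] by (intro nn_integral_suminf) (simp add: measurable_mu)
  also have "\<dots> = (\<Sum>k. \<integral>\<^sup>+x. indicator (cylinder A [?e k]) x * f x \<partial>\<mu>)"
    by (simp add: nn_integral_branch[OF f])
  also have "\<dots> = (\<integral>\<^sup>+x. (\<Sum>k. indicator (cylinder A [?e k]) x * f x) \<partial>\<mu>)"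
    using f by (intro nn_integral_suminf[symmetric] borel_measurable_times_ennreal borel_measurable_indicator)
      (simp_all add: measurable_mu sets_mu cylinder_measurable)
  also have "\<dots> = (\<integral>\<^sup>+x. f x \<partial>\<mu>)"
    by (intro nn_integral_cong) (simp add: suminf_cylinders space_mu)
  finally show ?thesis .
qed

lemma nn_integral_transfer_power:
  "f \<in> borel_measurable BX \<Longrightarrow> (\<integral>\<^sup>+x. (P ^^ n) f x \<partial>\<mu>) = (\<integral>\<^sup>+x. f x \<partial>\<mu>)"
  by (induction n) (simp_all add: nn_integral_transfer transfer_power_measurable)

lemma nn_integral_times_shift_power:
  assumes f: "f \<in> borel_measurable BX" and h: "h \<in> borel_measurable BX"
  shows "(\<integral>\<^sup>+x. f x * h ((shift ^^ n) x) \<partial>\<mu>) = (\<integral>\<^sup>+x. (P ^^ n) f x * h x \<partial>\<mu>)"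
proof -
  have "(\<lambda>x. f x * h ((shift ^^ n) x)) \<in> borel_measurable BX"
    by (intro borel_measurable_times_ennreal f measurable_compose[OF shift_power_measurable h])
  from nn_integral_transfer_power[OF this, of n] show ?thesis
    by (simp add: transfer_power_pull_out)
qed

text \<open>The duality summed over all times. It is used twice: with a cylinder for
  \<open>h\<close> to count visits, and with the last-exit set for \<open>h\<close> to decompose
  integrals.\<close>

lemma suminf_nn_integral_shift_power:
  assumes f: "f \<in> borel_measurable BX" and h: "h \<in> borel_measurable BX"
  shows "(\<Sum>n. \<integral>\<^sup>+x. f x * h ((shift ^^ n) x) \<partial>\<mu>) = (\<integral>\<^sup>+x. G f x * h x \<partial>\<mu>)"
proof -
  have "(\<Sum>n. \<integral>\<^sup>+x. f x * h ((shift ^^ n) x) \<partial>\<mu>) = (\<integral>\<^sup>+x. (\<Sum>n. (P ^^ n) f x * h x) \<partial>\<mu>)"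
    unfolding nn_integral_times_shift_power[OF f h]
    by (intro nn_integral_suminf[symmetric] borel_measurable_times_ennreal)
      (simp_all add: measurable_mu transfer_power_measurable f h)
  then show ?thesis by (simp add: potential_def)
qed

text \<open>The measures of \<open>V k\<close> sum to the integral of the potential of
  \<open>[b]\<close> over \<open>[a]\<close>, at most
  \<open>c * emeasure \<mu> (cylinder A [a])\<close>, so Borel-Cantelli applies. Fixing the initial
  letter \<open>b\<close> keeps the sets of finite measure, since \<open>\<mu>\<close> may be
  infinite; countably many pairs of states are then combined.\<close>

lemma AE_finite_visits: "AE y in \<mu>. \<forall>b. finite {k. y k = b}"
proof -
  have "AE y in \<mu>. y \<in> cylinder A [b] \<longrightarrow> finite {k. y k = a}" for a b
  proof -
    define V where "V k = {y \<in> cylinder A [b]. y k = a}" for k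
    have V: "V k \<in> sets \<mu>" for k
    proof -
      have "V k = cylinder A [b] \<inter> {y \<in> X. y k \<in> {a}}"
        by (auto simp: V_def cylinder_def)
      then show ?thesis
        using cylinder_measurable[of A "[b]"] coordinate_measurable[of A k "{a}"] by (auto simp: sets_mu)
    qed
    have Vfin: "emeasure \<mu> (V k) < \<infinity>" for k
    proof -
      have "emeasure \<mu> (V k) \<le> emeasure \<mu> (cylinder A [b])"
        by (rule emeasure_mono) (auto simp: V_def sets_mu cylinder_measurable)
      then show ?thesis using cylinder_finite[of "[b]"] by (auto intro: le_less_trans)
    qed
    obtain c where c: "c < \<infinity>" "\<forall>x\<in>cylinder A [a]. G (indicator (cylinder A [b])) x \<le> c"
      using potential_cylinder_bounded .
    have "(\<Sum>k. emeasure \<mu> (V k)) = (\<Sum>k. \<integral>\<^sup>+x. indicator (cylinder A [b]) x * indicator (cylinder A [a]) ((shift ^^ k) x) \<partial>\<mu>)"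
    proof (rule suminf_cong)
      fix k
      have "emeasure \<mu> (V k) = (\<integral>\<^sup>+x. indicator (V k) x \<partial>\<mu>)" using V by simp
      also have "\<dots> = (\<integral>\<^sup>+x. indicator (cylinder A [b]) x * indicator (cylinder A [a]) ((shift ^^ k) x) \<partial>\<mu>)"
        by (intro nn_integral_cong)
          (auto simp: V_def cylinder_def indicator_def shift_power shift_power_in_tms[unfolded shift_power])
      finally show "emeasure \<mu> (V k) = (\<integral>\<^sup>+x. indicator (cylinder A [b]) x * indicator (cylinder A [a]) ((shift ^^ k) x) \<partial>\<mu>)" .
    qed
    also have "\<dots> = (\<integral>\<^sup>+x. G (indicator (cylinder A [b])) x * indicator (cylinder A [a]) x \<partial>\<mu>)"
      by (intro suminf_nn_integral_shift_power borel_measurable_indicator cylinder_measurable)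
    also have "\<dots> \<le> (\<integral>\<^sup>+x. c * indicator (cylinder A [a]) x \<partial>\<mu>)"
      using c(2) by (intro nn_integral_mono) (auto simp: indicator_def)
    also have "\<dots> = c * emeasure \<mu> (cylinder A [a])"
      by (simp add: nn_integral_cmult_indicator sets_mu cylinder_measurable)
    also have "\<dots> < \<infinity>"
      using c(1) cylinder_finite[of "[a]"] by (simp add: ennreal_mult_less_top)
    finally have "(\<Sum>k. ennreal (measure \<mu> (V k))) \<noteq> top"
      using Vfin by (simp add: emeasure_eq_ennreal_measure less_top)
    then have "summable (\<lambda>k. measure \<mu> (V k))"
      by (rule summable_suminf_not_top[rotated]) simp
    from borel_cantelli_AE1[OF V _ this] Vfin
    have "AE y in \<mu>. \<forall>\<^sub>F k in sequentially. y \<in> space \<mu> - V k" by auto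
    then show ?thesis
    proof (rule AE_mp, intro AE_I2 impI)
      fix y assume y: "\<forall>\<^sub>F k in sequentially. y \<in> space \<mu> - V k" "y \<in> cylinder A [b]"
      then obtain n where "\<And>k. k \<ge> n \<Longrightarrow> y k \<noteq> a"
        by (auto simp: eventually_sequentially V_def)
      then have "{k. y k = a} \<subseteq> {..<n}" by (auto simp: not_less[symmetric])
      then show "finite {k. y k = a}" by (rule finite_subset) simp
    qed
  qed
  then have "AE y in \<mu>. \<forall>a\<in>UNIV. \<forall>b\<in>UNIV. y \<in> cylinder A [b] \<longrightarrow> finite {k. y k = a}"
    by (intro AE_ball_countable' countable_states)
  then show ?thesis
    by (rule AE_mp) (auto intro!: AE_I2 simp: space_mu cylinder_def)
qed

text \<open>The only nonzero term belongs to the time \<open>m\<close> of the last visit to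
  \<open>F\<close>, which exists because there is a visit at time 0 and there are finitely many in
  all.\<close>

lemma suminf_last_exit:
  assumes y: "y \<in> X" "y 0 \<in> F" and fin: "finite {k. y k \<in> F}"
  shows "(\<Sum>k. indicator (last_exit A F) ((shift ^^ k) y)) = (1::ennreal)"
proof -
  define m where "m = Max {k. y k \<in> F}"
  have ne: "{k. y k \<in> F} \<noteq> {}" using y(2) by auto
  have m: "y m \<in> F" using Max_in[OF fin ne] by (simp add: m_def)
  have above: "y k \<notin> F" if "k > m" for k
    using Max_ge[OF fin, of k] that by (auto simp: m_def)
  have iff: "(shift ^^ k) y \<in> last_exit A F \<longleftrightarrow> k = m" for k
  proof
    assume "(shift ^^ k) y \<in> last_exit A F"
    then have k: "y k \<in> F" "\<And>i. i \<ge> 1 \<Longrightarrow> y (i + k) \<notin> F"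
      by (auto simp: last_exit_def shift_power)
    have "\<not> k < m"
    proof
      assume "k < m"
      then have "1 \<le> m - k" by simp
      from k(2)[OF this] show False using m \<open>k < m\<close> by simp
    qed
    moreover have "\<not> m < k" using above k(1) by auto
    ultimately show "k = m" by simp
  next
    assume "k = m"
    then show "(shift ^^ k) y \<in> last_exit A F"
      using m above shift_power_in_tms[OF y(1), of m] by (auto simp: last_exit_def shift_power)
  qed
  have "(\<Sum>k. indicator (last_exit A F) ((shift ^^ k) y)) =
      (\<Sum>k\<in>{m}. indicator (last_exit A F) ((shift ^^ k) y) :: ennreal)"
    by (intro suminf_finite) (auto simp: iff)
  then show ?thesis by (simp add: iff)
qed

text \<open>Where \<open>f\<close> can be nonzero, almost every point satisfies the preceding
  partition of unity over exit times. Inserting that 1 under the integral and applying the duality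
  turns \<open>f\<close> into its potential.\<close>

lemma last_exit_decomposition:
  assumes "finite F" and f: "f \<in> borel_measurable BX" and sup: "\<And>y. y \<in> X \<Longrightarrow> y 0 \<notin> F \<Longrightarrow> f y = 0"
  shows "(\<integral>\<^sup>+y. f y \<partial>\<mu>) = (\<integral>\<^sup>+y. G f y * indicator (last_exit A F) y \<partial>\<mu>)"
proof -
  have ind: "indicator (last_exit A F) \<in> borel_measurable BX"
    by (intro borel_measurable_indicator last_exit_measurable)
  have "(\<integral>\<^sup>+y. f y \<partial>\<mu>) = (\<integral>\<^sup>+y. (\<Sum>k. f y * indicator (last_exit A F) ((shift ^^ k) y)) \<partial>\<mu>)"
  proof (rule nn_integral_cong_AE)
    show "AE y in \<mu>. f y = (\<Sum>k. f y * indicator (last_exit A F) ((shift ^^ k) y))"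
      using AE_finite_visits
    proof (rule AE_mp, intro AE_I2 impI)
      fix y assume y: "y \<in> space \<mu>" "\<forall>b. finite {k. y k = b}"
      show "f y = (\<Sum>k. f y * indicator (last_exit A F) ((shift ^^ k) y))"
      proof (cases "y 0 \<in> F")
        case True
        have "{k. y k \<in> F} = (\<Union>b\<in>F. {k. y k = b})" by auto
        then have "finite {k. y k \<in> F}" using y(2) assms(1) by simp
        then show ?thesis using suminf_last_exit[of y F] True y(1) by (simp add: space_mu)
      next
        case False
        then show ?thesis using sup y(1) by (simp add: space_mu)
      qed
    qed
  qed
  also have "\<dots> = (\<Sum>k. \<integral>\<^sup>+y. f y * indicator (last_exit A F) ((shift ^^ k) y) \<partial>\<mu>)"
    by (intro nn_integral_suminf borel_measurable_times_ennreal)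
      (simp_all add: measurable_mu f measurable_compose[OF shift_power_measurable ind])
  also have "\<dots> = (\<integral>\<^sup>+y. G f y * indicator (last_exit A F) y \<partial>\<mu>)"
    by (rule suminf_nn_integral_shift_power[OF f ind])
  finally show ?thesis .
qed

end

section \<open>The Martin compactification\<close>

text \<open>Nothing here says that \<open>d\<close> separates points, so carrying \<open>k\<close>
  over to the image needs an argument: points with the same image have distance 0, and uniform
  continuity then makes their values equal.\<close>

lemma completion_uniform_extension:
  fixes k :: "'a \<Rightarrow> real"
  assumes comp: "is_completion M d Y \<iota>"
    and uc: "\<forall>\<epsilon>>0. \<exists>\<delta>>0. \<forall>x\<in>M. \<forall>y\<in>M. d x y < \<delta> \<longrightarrow> \<bar>k x - k y\<bar> < \<epsilon>"
  obtains F where "continuous_map (mtopology_of Y) euclideanreal F" "\<forall>x\<in>M. F (\<iota> x) = k x"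
proof -
  have \<iota>: "\<iota> \<in> M \<rightarrow> mspace Y" "\<forall>x\<in>M. \<forall>y\<in>M. mdist Y (\<iota> x) (\<iota> y) = d x y"
    and dense: "mtopology_of Y closure_of (\<iota> ` M) = mspace Y"
    using comp by (simp_all add: is_completion_def)
  define h where "h z = k (inv_into M \<iota> z)" for z
  have h: "h (\<iota> x) = k x" if x: "x \<in> M" for x
  proof -
    let ?y = "inv_into M \<iota> (\<iota> x)"
    have y: "?y \<in> M" "\<iota> ?y = \<iota> x" using x by (auto intro: inv_into_into f_inv_into_f)
    have "mdist Y (\<iota> ?y) (\<iota> x) = 0"
      unfolding y(2) using \<iota>(1) x by (simp add: Pi_iff mdist_zero)
    then have "d ?y x = 0" using \<iota>(2) y(1) x by simp
    then have "\<bar>k ?y - k x\<bar> < \<epsilon>" if "\<epsilon> > 0" for \<epsilon>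
      using uc that y(1) x by metis
    then have "\<bar>k ?y - k x\<bar> \<le> 0" by (meson dense_ge less_imp_le)
    then show ?thesis by (simp add: h_def)
  qed
  have "uniformly_continuous_map (submetric Y (\<iota> ` M)) euclidean_metric h"
    unfolding uniformly_continuous_map_def
  proof (intro conjI allI impI)
    fix \<epsilon> :: real assume "\<epsilon> > 0"
    then obtain \<delta> where \<delta>: "\<delta> > 0" "\<forall>x\<in>M. \<forall>y\<in>M. d x y < \<delta> \<longrightarrow> \<bar>k x - k y\<bar> < \<epsilon>"
      using uc by blast
    then show "\<exists>\<delta>>0. \<forall>x\<in>mspace (submetric Y (\<iota> ` M)). \<forall>y\<in>mspace (submetric Y (\<iota> ` M)).
        mdist (submetric Y (\<iota> ` M)) y x < \<delta> \<longrightarrow> mdist euclidean_metric (h y) (h x) < \<epsilon>"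
      using h \<iota>(2) by (intro exI[of _ \<delta>]) (auto simp: dist_real_def)
  qed simp
  then obtain F where F: "uniformly_continuous_map (submetric Y (mspace Y)) euclidean_metric F"
      "\<And>z. z \<in> \<iota> ` M \<Longrightarrow> F z = h z"
    using uniformly_continuous_map_extends_to_closure_of[of euclidean_metric Y "\<iota> ` M" h]
    by (auto simp: dense mcomplete_of_def complete_UNIV)
  then have "continuous_map (mtopology_of Y) euclideanreal F"
    using uniformly_continuous_imp_continuous_map[OF F(1)] by (simp add: mtopology_of_submetric)
  then show ?thesis using F(2) h that by simp
qed

text \<open>Two continuous real functions that agree on the dense image agree everywhere, so the
  description in \<open>cont_extension\<close> denotes a unique value.\<close>

lemma cont_extension_eq:
  assumes comp: "is_completion M d Y \<iota>"
    and F: "continuous_map (mtopology_of Y) euclideanreal F" "\<forall>x\<in>M. F (\<iota> x) = k x"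
    and \<omega>: "\<omega> \<in> mspace Y"
  shows "cont_extension M Y \<iota> k \<omega> = F \<omega>"
  unfolding cont_extension_def
proof (rule the_equality)
  show "\<exists>h. continuous_map (mtopology_of Y) euclideanreal h \<and> (\<forall>x\<in>M. h (\<iota> x) = k x) \<and> h \<omega> = F \<omega>"
    using F by blast
  fix c assume "\<exists>h. continuous_map (mtopology_of Y) euclideanreal h \<and> (\<forall>x\<in>M. h (\<iota> x) = k x) \<and> h \<omega> = c"
  then obtain h where h: "continuous_map (mtopology_of Y) euclideanreal h" "\<forall>x\<in>M. h (\<iota> x) = k x" "h \<omega> = c"
    by blast
  have "\<omega> \<in> mtopology_of Y closure_of (\<iota> ` M)" using comp \<omega> by (simp add: is_completion_def)
  moreover have "h z = F z" if "z \<in> \<iota> ` M" for z using that h(2) F(2) by auto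
  ultimately have "h \<omega> = F \<omega>"
    by (rule forall_in_closure_of_eq[OF _ Hausdorff_space_euclidean h(1) F(1)])
  then show "c = F \<omega>" using h(3) by simp
qed

text \<open>Density again, applied to \<open>F\<close> and \<open>max 0 F\<close>, which agree on
  the image.\<close>

lemma continuous_extension_nonneg:
  assumes comp: "is_completion M d Y \<iota>"
    and F: "continuous_map (mtopology_of Y) euclideanreal F" "\<forall>x\<in>M. 0 \<le> F (\<iota> x)"
    and \<omega>: "\<omega> \<in> mspace Y"
  shows "0 \<le> F \<omega>"
proof -
  have \<omega>': "\<omega> \<in> mtopology_of Y closure_of (\<iota> ` M)" using comp \<omega> by (simp add: is_completion_def)
  have "max 0 (F \<omega>) = F \<omega>"
    by (rule forall_in_closure_of_eq[OF \<omega>' Hausdorff_space_euclidean _ F(1)])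
      (use F in \<open>auto intro!: continuous_map_real_max\<close>)
  then show ?thesis by linarith
qed

lemma (in transient_shift) kernel_sum:
  assumes "finite W" "\<And>v. v \<in> W \<Longrightarrow> f v \<in> Cc A" "x \<in> X"
  shows "(\<lambda>x. \<Sum>v\<in>W. c v * f v x) \<in> Cc A \<and> K (\<lambda>x. \<Sum>v\<in>W. c v * f v x) x = (\<Sum>v\<in>W. c v * K (f v) x)"
  using assms(1,2)
proof (induction W)
  case empty
  have z: "(\<lambda>x. 0) = (\<lambda>x. 0 * cyl [orig] x + 0 * cyl [orig] x)" by simp
  have o: "cyl [orig] \<in> Cc A" by (rule Cc_pos_imp_Cc[OF Cc_pos_cylinder]) simp
  show ?case
    using Cc_lincomb[OF o o, of 0 0] kernel_lincomb[OF o o assms(3), of 0 0] by simp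
next
  case (insert v W)
  have v: "f v \<in> Cc A" and IH: "(\<lambda>x. \<Sum>v\<in>W. c v * f v x) \<in> Cc A"
    "K (\<lambda>x. \<Sum>v\<in>W. c v * f v x) x = (\<Sum>v\<in>W. c v * K (f v) x)"
    using insert by auto
  have eq: "(\<lambda>x. \<Sum>v\<in>insert v W. c v * f v x) = (\<lambda>x. c v * f v x + 1 * (\<Sum>v\<in>W. c v * f v x))"
    using insert.hyps by simp
  show ?case
    unfolding eq using Cc_lincomb[OF v IH(1), of "c v" 1] kernel_lincomb[OF v IH(1) assms(3), of "c v" 1]
      insert.hyps IH(2) by simp
qed

text \<open>The error is dominated by a multiple of the indicator of \<open>starting_in A F\<close>,
  not merely by a constant: that indicator lies in \<open>Cc A\<close>, so positivity can carry the
  estimate over to kernels.\<close>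

lemma (in transient_shift) Cc_approximation:
  assumes f: "f \<in> Cc A" and F: "finite F" "supported_in A F f" and "\<epsilon> > 0"
  obtains W c where "finite W" "W \<subseteq> admissible_words A"
    "\<forall>x\<in>X. \<bar>f x - (\<Sum>v\<in>W. c v * cyl v x)\<bar> \<le> \<epsilon> * indicator (starting_in A F) x"
proof -
  obtain m where m: "\<forall>x y. x \<in> X \<longrightarrow> y \<in> X \<longrightarrow> (\<forall>i<m. x i = y i) \<longrightarrow> \<bar>f x - f y\<bar> < \<epsilon>"
    using Cc_uniformly_continuous[OF locally_compact f \<open>\<epsilon> > 0\<close>] .
  \<comment> \<open>\<open>Suc m\<close> makes the words nonempty, so each word also determines
    whether the first letter lies in \<open>F\<close>.\<close>
  let ?p = "\<lambda>x. map x [0..<Suc m]"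
  define W where "W = ?p ` starting_in A F"
  define c where "c v = f (SOME x. x \<in> starting_in A F \<and> ?p x = v)" for v
  have fin: "finite W" unfolding W_def by (rule finite_prefixes[OF locally_compact F(1)])
  have incyl: "x \<in> cylinder A (?p x)" if "x \<in> X" for x
    using that by (simp add: cylinder_def del: upt_Suc)
  have adm: "W \<subseteq> admissible_words A"
    using incyl by (auto simp: W_def admissible_words_def starting_in_def simp del: upt_Suc)
  have cyl_iff: "x \<in> cylinder A v \<longleftrightarrow> ?p x = v" if "x \<in> X" "v \<in> W" for x v
    using that by (auto simp: W_def cylinder_def list_eq_iff_nth_eq simp del: upt_Suc)
  have "\<bar>f x - (\<Sum>v\<in>W. c v * cyl v x)\<bar> \<le> \<epsilon> * indicator (starting_in A F) x" if x: "x \<in> X" for x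
  proof (cases "x \<in> starting_in A F")
    case True
    then have pW: "?p x \<in> W" by (auto simp: W_def)
    have "(\<Sum>v\<in>W. c v * cyl v x) = (\<Sum>v\<in>W. if v = ?p x then c v else 0)"
      by (rule sum.cong) (auto simp: indicator_def cyl_iff[OF x] simp del: upt_Suc)
    also have "\<dots> = c (?p x)" using pW fin by (simp del: upt_Suc)
    finally have sum: "(\<Sum>v\<in>W. c v * cyl v x) = c (?p x)" .
    define z where "z = (SOME z. z \<in> starting_in A F \<and> ?p z = ?p x)"
    have z: "z \<in> starting_in A F \<and> ?p z = ?p x"
      unfolding z_def by (rule someI[of _ x]) (simp add: True)
    then have "\<forall>i<m. x i = z i" by (auto simp del: upt_Suc)
    moreover have "z \<in> X" using z by (simp add: starting_in_def)
    ultimately have "\<bar>f x - f z\<bar> < \<epsilon>" using m x by blast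
    moreover have "c (?p x) = f z" by (simp add: c_def z_def)
    ultimately show ?thesis using True sum by simp
  next
    case False
    have "cyl v x = 0" if vW: "v \<in> W" for v
    proof -
      have "?p x \<noteq> v"
      proof
        assume "?p x = v"
        then obtain y where "y \<in> starting_in A F" "?p x = ?p y"
          using vW by (auto simp: W_def simp del: upt_Suc)
        moreover from this(2) have "x 0 = y 0" by (auto simp del: upt_Suc)
        ultimately show False using False x by (simp add: starting_in_def)
      qed
      then show ?thesis using cyl_iff[OF x vW] by (simp add: indicator_def)
    qed
    moreover have "f x = 0" using F(2) False x by (auto simp: supported_in_def starting_in_def)
    ultimately show ?thesis using False by simp
  qed
  then show ?thesis using that fin adm by blast
qed

section \<open>Compactness of the completion and uniform continuity of the kernels\<close>

locale martin_compactification = transient_shift A \<phi> lam orig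
  for A :: "'s \<Rightarrow> 's \<Rightarrow> bool" and \<phi> lam orig +
  fixes w :: "nat \<Rightarrow> 's list" and C :: "nat \<Rightarrow> real" and Xhat :: "'b metric"
    and \<iota> :: "(nat \<Rightarrow> 's) \<Rightarrow> 'b"
  assumes words: "bij_betw w {1..} (admissible_words A)"
    and C_pos: "\<And>i. i \<ge> 1 \<Longrightarrow> C i > 0"
    and C_bound: "\<And>i x. i \<ge> 1 \<Longrightarrow> x \<in> tms A \<Longrightarrow>
      martin_kernel A \<phi> lam orig (indicator (cylinder A (w i))) x \<le> C i"
    and completion: "is_completion (tms A) (martin_dist A \<phi> lam orig w C) Xhat \<iota>"
begin

abbreviation "TY \<equiv> mtopology_of Xhat"
abbreviation "dM \<equiv> martin_dist A \<phi> lam orig w C"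

definition mterm :: "(nat \<Rightarrow> 's) \<Rightarrow> (nat \<Rightarrow> 's) \<Rightarrow> nat \<Rightarrow> real" where
  "mterm x y j = (\<bar>K (cyl (w (Suc j))) x - K (cyl (w (Suc j))) y\<bar> + \<bar>cyl (w (Suc j)) x - cyl (w (Suc j)) y\<bar>)
      / (2 ^ Suc j * (C (Suc j) + 1))"

lemma martin_dist_eq: "dM x y = (\<Sum>j. mterm x y j)"
  by (simp add: martin_dist_def mterm_def Let_def)

lemma word_nonempty: "w (Suc j) \<noteq> []"
  using words by (auto simp: bij_betw_def admissible_words_def)

lemma admissible_index:
  assumes "v \<in> admissible_words A" obtains j where "v = w (Suc j)"
proof -
  obtain i where "i \<ge> 1" "v = w i" using words assms by (auto simp: bij_betw_def image_iff)
  then show ?thesis using that[of "i - 1"] by simp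
qed

lemma kernel_word_bounds: "x \<in> X \<Longrightarrow> 0 \<le> K (cyl (w (Suc j))) x" "x \<in> X \<Longrightarrow> K (cyl (w (Suc j))) x \<le> C (Suc j)"
  by (auto intro!: kernel_nonneg Cc_pos_cylinder word_nonempty C_bound)

lemma mterm_denominator_nonzero: "2 ^ Suc j * (C (Suc j) + 1) \<noteq> 0"
  using C_pos[of "Suc j"] by simp

lemma mterm_nonneg: "0 \<le> mterm x y j"
  using C_pos[of "Suc j"] by (simp add: mterm_def)

text \<open>Both kernel values lie between 0 and \<open>C (Suc j)\<close> and indicators differ by
  at most 1; this is what the normalisation by \<open>C + 1\<close> is for.\<close>

lemma mterm_le:
  assumes "x \<in> X" "y \<in> X" shows "mterm x y j \<le> (1/2) ^ Suc j"
proof -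
  have "\<bar>K (cyl (w (Suc j))) x - K (cyl (w (Suc j))) y\<bar> \<le> C (Suc j)"
    using kernel_word_bounds[OF assms(1), of j] kernel_word_bounds[OF assms(2), of j] by (simp add: abs_le_iff)
  moreover have "\<bar>cyl (w (Suc j)) x - cyl (w (Suc j)) y\<bar> \<le> 1" by (simp add: indicator_def)
  ultimately have "mterm x y j \<le> (C (Suc j) + 1) / (2 ^ Suc j * (C (Suc j) + 1))"
    unfolding mterm_def using C_pos[of "Suc j"] by (intro divide_right_mono add_mono) auto
  also have "\<dots> = (1/2) ^ Suc j" using C_pos[of "Suc j"] by (simp add: power_one_over divide_simps)
  finally show ?thesis .
qed

lemma half_sums: "(\<lambda>j. (1/2::real) ^ Suc (j + J)) sums (1/2) ^ J"
  using sums_mult2[OF power_half_series, of "(1/2) ^ J"] by (simp add: power_add mult_ac)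

lemma summable_mterm: "x \<in> X \<Longrightarrow> y \<in> X \<Longrightarrow> summable (mterm x y)"
  using mterm_le mterm_nonneg
  by (intro summable_comparison_test'[OF sums_summable[OF half_sums[of 0]], of 0]) simp

lemma martin_dist_split:
  assumes "x \<in> X" "y \<in> X"
  shows "dM x y \<le> (\<Sum>j<J. mterm x y j) + (1/2) ^ J"
proof -
  have "(\<Sum>j. mterm x y (j + J)) \<le> (\<Sum>j. (1/2) ^ Suc (j + J))"
    using mterm_le[OF assms] summable_mterm[OF assms] sums_summable[OF half_sums[of J]]
    by (intro suminf_le) (auto simp: summable_iff_shift)
  also have "\<dots> = (1/2) ^ J" using half_sums[of J] by (simp add: sums_iff)
  finally show ?thesis
    unfolding martin_dist_eq suminf_split_initial_segment[OF summable_mterm[OF assms], of J] by simp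
qed

lemma mterm_le_martin_dist: "x \<in> X \<Longrightarrow> y \<in> X \<Longrightarrow> mterm x y j \<le> dM x y"
  unfolding martin_dist_eq
  using sum_le_suminf[OF summable_mterm, of x y "{j}"] mterm_nonneg by simp

text \<open>A single term of the series is at most the whole distance, so the denominator of that
  term serves as Lipschitz constant for the kernel and for the indicator.\<close>

lemma word_lipschitz:
  obtains L where "L \<ge> 0"
    "\<forall>x\<in>X. \<forall>y\<in>X. \<bar>K (cyl (w (Suc j))) x - K (cyl (w (Suc j))) y\<bar> \<le> L * dM x y \<and>
       \<bar>cyl (w (Suc j)) x - cyl (w (Suc j)) y\<bar> \<le> L * dM x y"
proof (rule that[of "2 ^ Suc j * (C (Suc j) + 1)"])
  let ?L = "2 ^ Suc j * (C (Suc j) + 1)"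
  have L: "?L > 0" using C_pos[of "Suc j"] by simp
  then show "?L \<ge> 0" by simp
  show "\<forall>x\<in>X. \<forall>y\<in>X. \<bar>K (cyl (w (Suc j))) x - K (cyl (w (Suc j))) y\<bar> \<le> ?L * dM x y \<and>
       \<bar>cyl (w (Suc j)) x - cyl (w (Suc j)) y\<bar> \<le> ?L * dM x y"
  proof (intro ballI)
    fix x y assume xy: "x \<in> X" "y \<in> X"
    have "?L * mterm x y j \<le> ?L * dM x y"
      using L mterm_le_martin_dist[OF xy, of j] by (intro mult_left_mono) auto
    moreover have "?L * mterm x y j =
        \<bar>K (cyl (w (Suc j))) x - K (cyl (w (Suc j))) y\<bar> + \<bar>cyl (w (Suc j)) x - cyl (w (Suc j)) y\<bar>"
      using C_pos[of "Suc j"] by (simp add: mterm_def del: power_Suc)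
    ultimately show "\<bar>K (cyl (w (Suc j))) x - K (cyl (w (Suc j))) y\<bar> \<le> ?L * dM x y \<and>
       \<bar>cyl (w (Suc j)) x - cyl (w (Suc j)) y\<bar> \<le> ?L * dM x y" by linarith
  qed
qed

lemma martin_dist_nonneg: "x \<in> X \<Longrightarrow> y \<in> X \<Longrightarrow> 0 \<le> dM x y"
  using mterm_le_martin_dist[of x y 0] mterm_nonneg[of x y 0] by simp

lemma lipschitz_uniform:
  assumes "L \<ge> 0" "\<forall>x\<in>X. \<forall>y\<in>X. \<bar>k x - k y\<bar> \<le> L * dM x y"
  shows "\<forall>\<epsilon>>0. \<exists>\<delta>>0. \<forall>x\<in>X. \<forall>y\<in>X. dM x y < \<delta> \<longrightarrow> \<bar>k x - k y\<bar> < \<epsilon>"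
proof (intro allI impI)
  fix \<epsilon> :: real assume "\<epsilon> > 0"
  show "\<exists>\<delta>>0. \<forall>x\<in>X. \<forall>y\<in>X. dM x y < \<delta> \<longrightarrow> \<bar>k x - k y\<bar> < \<epsilon>"
  proof (intro exI[of _ "\<epsilon> / (L + 1)"] conjI ballI impI)
    show "\<epsilon> / (L + 1) > 0" using \<open>\<epsilon> > 0\<close> assms(1) by simp
    fix x y assume xy: "x \<in> X" "y \<in> X" "dM x y < \<epsilon> / (L + 1)"
    have "\<bar>k x - k y\<bar> \<le> L * dM x y" using assms(2) xy by blast
    also have "\<dots> \<le> (L + 1) * dM x y" using martin_dist_nonneg[OF xy(1,2)] by (simp add: algebra_simps)
    also have "\<dots> < \<epsilon>" using xy(3) assms(1) by (simp add: pos_less_divide_eq mult.commute)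
    finally show "\<bar>k x - k y\<bar> < \<epsilon>" .
  qed
qed

text \<open>A finite part of the series is continuous in the shift topology and the rest is
  uniformly at most \<open>(1/2) ^ J\<close>. Hence Borel measures on the shift space can be pushed
  to the completion.\<close>

lemma iota_continuous: "continuous_map (tms_top A) TY \<iota>"
  unfolding continuous_map_tms_metric
proof (intro conjI ballI allI impI)
  show "\<iota> \<in> X \<rightarrow> mspace Xhat" using completion by (simp add: is_completion_def)
  fix x and \<epsilon> :: real assume x: "x \<in> X" and "\<epsilon> > 0"
  then obtain J where J: "(1/2) ^ J < \<epsilon> / 2"
    using real_arch_pow_inv[of "\<epsilon> / 2" "1/2"] by (auto simp del: power_one_over)
  have "continuous_map (tms_top A) euclideanreal (\<lambda>y. \<Sum>j<J. mterm x y j)"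
    unfolding mterm_def
    using mterm_denominator_nonzero
    by (intro continuous_map_sum continuous_map_real_divide continuous_map_add continuous_map_real_abs
        continuous_map_diff continuous_map_const[THEN iffD2] continuous_kernel_cylinder word_nonempty
        continuous_map_cylinder) auto
  then obtain n where n: "\<forall>y\<in>X. (\<forall>i<n. y i = x i) \<longrightarrow> \<bar>(\<Sum>j<J. mterm x x j) - (\<Sum>j<J. mterm x y j)\<bar> < \<epsilon> / 2"
    using x half_gt_zero[OF \<open>\<epsilon> > 0\<close>] unfolding continuous_map_tms_real by blast
  have "mdist Xhat (\<iota> x) (\<iota> y) < \<epsilon>" if y: "y \<in> X" "\<forall>i<n. y i = x i" for y
  proof -
    have "\<bar>(\<Sum>j<J. mterm x x j) - (\<Sum>j<J. mterm x y j)\<bar> < \<epsilon> / 2" using n y by blast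
    moreover have "(\<Sum>j<J. mterm x x j) = 0" by (simp add: mterm_def)
    ultimately have "dM x y < \<epsilon>" using martin_dist_split[OF x y(1), of J] J by linarith
    then show ?thesis using completion x y(1) by (simp add: is_completion_def)
  qed
  then show "\<exists>n. \<forall>y\<in>X. (\<forall>i<n. y i = x i) \<longrightarrow> mdist Xhat (\<iota> x) (\<iota> y) < \<epsilon>" by blast
qed

text \<open>Record, for the first \<open>J\<close> words, the kernel value rounded down to a
  multiple of \<open>1 / m\<close> and the membership in the cylinder. There are finitely many such
  records, and points with equal records are within \<open>1 / m + (1/2) ^ J\<close>.\<close>

lemma finite_net:
  assumes "\<epsilon> > 0"
  obtains N where "finite N" "N \<subseteq> X" "\<forall>x\<in>X. \<exists>y\<in>N. dM y x < \<epsilon>"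
proof -
  obtain J where J: "(1/2) ^ J < \<epsilon> / 2"
    using real_arch_pow_inv[of "\<epsilon> / 2" "1/2"] assms by (auto simp del: power_one_over)
  obtain m :: nat where m: "m > 0" "1 / real m < \<epsilon> / 2"
    using reals_Archimedean[of "\<epsilon> / 2"] assms by (auto simp: inverse_eq_divide intro: that[of "Suc _"])
  define q where "q x = map (\<lambda>j. (\<lfloor>K (cyl (w (Suc j))) x * m\<rfloor>, x \<in> cylinder A (w (Suc j)))) [0..<J]" for x
  define B where "B = (\<Union>j<J. {0..\<lfloor>C (Suc j) * m\<rfloor>}) \<times> (UNIV :: bool set)"
  have "finite {xs. set xs \<subseteq> B \<and> length xs = J}"
    by (rule finite_lists_length_eq) (simp add: B_def)
  moreover have "q ` X \<subseteq> {xs. set xs \<subseteq> B \<and> length xs = J}"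
  proof -
    have "\<lfloor>K (cyl (w (Suc j))) x * m\<rfloor> \<in> {0..\<lfloor>C (Suc j) * m\<rfloor>}" if "x \<in> X" for x j
      using kernel_word_bounds[OF that, of j] by (auto intro!: floor_mono mult_right_mono)
    then have "(\<lfloor>K (cyl (w (Suc j))) x * m\<rfloor>, b) \<in> B" if "x \<in> X" "j < J" for x j b
      using that unfolding B_def by blast
    then show ?thesis by (auto simp: q_def)
  qed
  ultimately have "finite (q ` X)" by (rule rev_finite_subset)
  then obtain N where N: "N \<subseteq> X" "finite N" "q ` X = q ` N"
    using finite_subset_image[of "q ` X" q X] by blast
  have "\<exists>y\<in>N. dM y x < \<epsilon>" if x: "x \<in> X" for x
  proof -
    obtain y where y: "y \<in> N" "q x = q y" using N(3) imageI[OF x, of q] by auto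
    then have yX: "y \<in> X" using N(1) by blast
    have "mterm y x j \<le> (1/2) ^ Suc j * (1 / m)" if "j < J" for j
    proof -
      have "q x ! j = q y ! j" using y(2) by simp
      then have fl: "\<lfloor>K (cyl (w (Suc j))) x * m\<rfloor> = \<lfloor>K (cyl (w (Suc j))) y * m\<rfloor>"
        and ind: "x \<in> cylinder A (w (Suc j)) \<longleftrightarrow> y \<in> cylinder A (w (Suc j))"
        using that by (simp_all add: q_def)
      from fl have "\<bar>K (cyl (w (Suc j))) y * m - K (cyl (w (Suc j))) x * m\<bar> \<le> 1" by linarith
      then have "\<bar>K (cyl (w (Suc j))) y - K (cyl (w (Suc j))) x\<bar> * m \<le> 1"
        by (simp add: left_diff_distrib[symmetric] abs_mult)
      then have "\<bar>K (cyl (w (Suc j))) y - K (cyl (w (Suc j))) x\<bar> \<le> 1 / m"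
        using m(1) by (simp add: pos_le_divide_eq)
      moreover have "cyl (w (Suc j)) y - cyl (w (Suc j)) x = 0"
        using ind by (simp add: indicator_def)
      ultimately have "mterm y x j \<le> (1 / m) / (2 ^ Suc j * (C (Suc j) + 1))"
        unfolding mterm_def using C_pos[of "Suc j"] by (intro divide_right_mono) auto
      also have "\<dots> \<le> (1 / m) / (2 ^ Suc j * 1)"
        using C_pos[of "Suc j"] by (intro divide_left_mono mult_left_mono mult_pos_pos) auto
      finally show ?thesis by (simp add: power_one_over mult_ac)
    qed
    then have "(\<Sum>j<J. mterm y x j) \<le> (\<Sum>j<J. (1/2) ^ Suc j * (1 / m))" by (intro sum_mono) auto
    also have "\<dots> \<le> (\<Sum>j. (1/2) ^ Suc j * (1 / m))"
      using sums_mult2[OF half_sums[of 0], of "1 / m"] by (intro sum_le_suminf) (auto simp: sums_iff)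
    also have "\<dots> = 1 / m" using sums_mult2[OF half_sums[of 0], of "1 / m"] by (simp add: sums_iff)
    finally have "dM y x < \<epsilon>" using martin_dist_split[OF yX x, of J] J m(2) by linarith
    with y(1) show ?thesis by blast
  qed
  then have "\<forall>x\<in>X. \<exists>y\<in>N. dM y x < \<epsilon>" by (rule ballI)
  with N(2,1) show ?thesis by (rule that)
qed

lemma Xhat_compact: "compact_space TY"
proof -
  interpret Y: Metric_space "mspace Xhat" "mdist Xhat" by (rule Metric_space_mspace_mdist)
  have top: "TY = Y.mtopology" by (simp add: mtopology_of_def)
  have \<iota>: "\<iota> \<in> X \<rightarrow> mspace Xhat" "\<forall>x\<in>X. \<forall>y\<in>X. mdist Xhat (\<iota> x) (\<iota> y) = dM x y"
    using completion by (simp_all add: is_completion_def)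
  have "Y.mtotally_bounded (\<iota> ` X)"
    unfolding Y.mtotally_bounded_def
  proof (intro allI impI)
    fix \<epsilon> :: real assume "\<epsilon> > 0"
    then obtain N where N: "finite N" "N \<subseteq> X" "\<forall>x\<in>X. \<exists>y\<in>N. dM y x < \<epsilon>" by (rule finite_net)
    have "\<iota> ` X \<subseteq> (\<Union>z\<in>\<iota> ` N. Y.mball z \<epsilon>)"
    proof
      fix z assume "z \<in> \<iota> ` X"
      then obtain x where x: "x \<in> X" "z = \<iota> x" by blast
      then obtain y where y: "y \<in> N" "dM y x < \<epsilon>" using N(3) by blast
      then have "\<iota> x \<in> Y.mball (\<iota> y) \<epsilon>"
        using \<iota> x N(2) by (auto simp: Y.in_mball Pi_iff subset_iff)
      then show "z \<in> (\<Union>z\<in>\<iota> ` N. Y.mball z \<epsilon>)" using x y(1) by blast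
    qed
    then show "\<exists>K. finite K \<and> K \<subseteq> \<iota> ` X \<and> \<iota> ` X \<subseteq> (\<Union>x\<in>K. Y.mball x \<epsilon>)"
      using N by (intro exI[of _ "\<iota> ` N"]) auto
  qed
  then have "Y.mtotally_bounded (Y.mtopology closure_of (\<iota> ` X))"
    by (rule Y.mtotally_bounded_closure_of)
  then have "Y.mtotally_bounded (mspace Xhat)"
    using completion by (simp add: is_completion_def top)
  moreover have "Y.mcomplete" using completion by (simp add: is_completion_def mcomplete_of_def)
  ultimately show ?thesis by (simp add: top Y.compact_space_eq_mcomplete_mtotally_bounded)
qed

text \<open>For cylinders the metric makes the kernel Lipschitz. A general \<open>f\<close> is
  approximated by a combination of cylinders; by positivity the kernels then differ by at most the
  tolerance times \<open>M\<close>, the sum of the bounds for the letters in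
  \<open>F\<close>.\<close>

lemma kernel_uniform:
  assumes f: "f \<in> Cc A"
  shows "\<forall>\<epsilon>>0. \<exists>\<delta>>0. \<forall>x\<in>X. \<forall>y\<in>X. dM x y < \<delta> \<longrightarrow> \<bar>K f x - K f y\<bar> < \<epsilon>"
proof (intro allI impI)
  fix \<epsilon> :: real assume "\<epsilon> > 0"
  obtain F where F: "finite F" "supported_in A F f" using Cc_supported_in[OF f] .
  have "[a] \<in> admissible_words A" for a
    using transitive by (auto simp: tms_transitive_def admissible_words_def)
  then have "\<forall>a. \<exists>j. [a] = w (Suc j)" using admissible_index by metis
  then obtain j where j: "\<And>a. [a] = w (Suc (j a))" by metis
  define M where "M = (\<Sum>a\<in>F. C (Suc (j a)))"
  have M: "M \<ge> 0" unfolding M_def by (intro sum_nonneg less_imp_le[OF C_pos]) simp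
  let ?s = "\<lambda>x. \<Sum>a\<in>F. 1 * cyl [a] x"
  have cylC: "cyl v \<in> Cc A" if "v \<noteq> []" for v by (rule Cc_pos_imp_Cc[OF Cc_pos_cylinder[OF that]])
  have sC: "?s \<in> Cc A" "K ?s x \<le> M" if "x \<in> X" for x
  proof -
    have k: "?s \<in> Cc A \<and> K ?s x = (\<Sum>a\<in>F. 1 * K (cyl [a]) x)"
      by (rule kernel_sum[OF F(1) _ that]) (simp add: cylC)
    then show "?s \<in> Cc A" by simp
    have "K (cyl [a]) x \<le> C (Suc (j a))" for a using kernel_word_bounds(2)[OF that, of "j a"] by (simp add: j)
    then show "K ?s x \<le> M" using k by (simp add: M_def sum_mono)
  qed
  have s: "?s x = indicator (starting_in A F) x" if "x \<in> X" for x
  proof -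
    have "?s x = (\<Sum>a\<in>F. if a = x 0 then 1 else 0)"
      using that by (intro sum.cong) (auto simp: cylinder_def indicator_def)
    then show ?thesis using F(1) that by (simp add: starting_in_def indicator_def)
  qed
  \<comment> \<open>Chosen so that \<open>\<eta> * M \<le> \<epsilon> / 4\<close>; the 1 guards
    against \<open>M = 0\<close>.\<close>
  define \<eta> where "\<eta> = \<epsilon> / (4 * (M + 1))"
  have "\<eta> > 0" using \<open>\<epsilon> > 0\<close> M by (simp add: \<eta>_def)
  have \<eta>M: "\<eta> * M \<le> \<epsilon> / 4"
  proof -
    have "\<eta> * M \<le> \<eta> * (M + 1)" using \<open>\<eta> > 0\<close> by simp
    also have "\<eta> * (M + 1) = \<epsilon> / 4" using M by (simp add: \<eta>_def divide_simps)
    finally show ?thesis .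
  qed
  obtain W c where W: "finite W" "W \<subseteq> admissible_words A"
    "\<forall>x\<in>X. \<bar>f x - (\<Sum>v\<in>W. c v * cyl v x)\<bar> \<le> \<eta> * indicator (starting_in A F) x"
    using Cc_approximation[OF f F \<open>\<eta> > 0\<close>] .
  let ?h = "\<lambda>x. \<Sum>v\<in>W. c v * cyl v x"
  have Wne: "v \<noteq> []" if "v \<in> W" for v using that W(2) by (auto simp: admissible_words_def)
  have h: "?h \<in> Cc A" "K ?h x = (\<Sum>v\<in>W. c v * K (cyl v) x)" if "x \<in> X" for x
    using kernel_sum[OF W(1) _ that, of cyl c] cylC Wne by auto
  have close: "\<bar>K f x - K ?h x\<bar> \<le> \<epsilon> / 4" if x: "x \<in> X" for x
  proof -
    note hC = h(1)[OF x] and sC' = sC(1)[OF x]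
    note fh = Cc_lincomb[OF f hC, of 1 "-1"] and hf = Cc_lincomb[OF f hC, of "-1" 1]
    have le: "\<bar>f y - ?h y\<bar> \<le> \<eta> * ?s y" if "y \<in> X" for y
      using W(3) s[OF that] that by simp
    \<comment> \<open>On \<open>X\<close>, \<open>?s\<close> is the indicator of
      \<open>starting_in A F\<close> written as a sum of cylinders, so \<open>\<eta> * ?s\<close>
      dominates the error. Nonnegativity of the kernel of both \<open>\<eta> * ?s\<close> plus and
      minus the error gives the two-sided bound.\<close>
    have "(\<lambda>y. \<eta> * ?s y + 1 * (1 * f y + (-1) * ?h y)) \<in> Cc_pos A"
      using Cc_lincomb[OF sC' fh, of \<eta> 1] le by (fastforce simp: Cc_pos_def abs_le_iff)
    from kernel_nonneg[OF this x] have 1: "0 \<le> \<eta> * K ?s x + (K f x - K ?h x)"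
      unfolding kernel_lincomb[OF sC' fh x] kernel_lincomb[OF f hC x] by simp
    have "(\<lambda>y. \<eta> * ?s y + 1 * ((-1) * f y + 1 * ?h y)) \<in> Cc_pos A"
      using Cc_lincomb[OF sC' hf, of \<eta> 1] le by (fastforce simp: Cc_pos_def abs_le_iff)
    from kernel_nonneg[OF this x] have 2: "0 \<le> \<eta> * K ?s x + (K ?h x - K f x)"
      unfolding kernel_lincomb[OF sC' hf x] kernel_lincomb[OF f hC x] by simp
    have "\<eta> * K ?s x \<le> \<eta> * M" using sC(2)[OF x] \<open>\<eta> > 0\<close> by (intro mult_left_mono) auto
    then show ?thesis using 1 2 \<eta>M by linarith
  qed
  have "\<forall>v\<in>W. \<exists>L\<ge>0. \<forall>x\<in>X. \<forall>y\<in>X. \<bar>K (cyl v) x - K (cyl v) y\<bar> \<le> L * dM x y"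
  proof
    fix v assume "v \<in> W"
    then obtain i where "v = w (Suc i)" using W(2) admissible_index by blast
    then show "\<exists>L\<ge>0. \<forall>x\<in>X. \<forall>y\<in>X. \<bar>K (cyl v) x - K (cyl v) y\<bar> \<le> L * dM x y"
      using word_lipschitz[of i] by metis
  qed
  then obtain L where L: "\<forall>v\<in>W. L v \<ge> 0 \<and> (\<forall>x\<in>X. \<forall>y\<in>X. \<bar>K (cyl v) x - K (cyl v) y\<bar> \<le> L v * dM x y)"
    by metis
  define L' where "L' = (\<Sum>v\<in>W. \<bar>c v\<bar> * L v)"
  have "\<bar>K ?h x - K ?h y\<bar> \<le> L' * dM x y" if xy: "x \<in> X" "y \<in> X" for x y
  proof -
    have "\<bar>K ?h x - K ?h y\<bar> = \<bar>\<Sum>v\<in>W. c v * (K (cyl v) x - K (cyl v) y)\<bar>"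
      unfolding h(2)[OF xy(1)] h(2)[OF xy(2)] by (simp add: sum_subtractf algebra_simps)
    also have "\<dots> \<le> (\<Sum>v\<in>W. \<bar>c v * (K (cyl v) x - K (cyl v) y)\<bar>)" by (rule sum_abs)
    also have "\<dots> \<le> (\<Sum>v\<in>W. \<bar>c v\<bar> * (L v * dM x y))"
      unfolding abs_mult using L xy by (intro sum_mono mult_left_mono) auto
    finally show ?thesis by (simp add: L'_def sum_distrib_right mult.assoc)
  qed
  then have Lh: "\<forall>x\<in>X. \<forall>y\<in>X. \<bar>K ?h x - K ?h y\<bar> \<le> L' * dM x y" by (intro ballI)
  have L'0: "L' \<ge> 0" using L by (auto simp: L'_def intro!: sum_nonneg mult_nonneg_nonneg)
  have "\<epsilon> / 4 > 0" using \<open>\<epsilon> > 0\<close> by simp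
  from lipschitz_uniform[OF L'0 Lh, THEN spec, THEN mp, OF this] obtain \<delta> where \<delta>: "\<delta> > 0" "\<forall>x\<in>X. \<forall>y\<in>X. dM x y < \<delta> \<longrightarrow> \<bar>K ?h x - K ?h y\<bar> < \<epsilon> / 4"
    by blast
  have "\<bar>K f x - K f y\<bar> < \<epsilon>" if "x \<in> X" "y \<in> X" "dM x y < \<delta>" for x y
  proof -
    have "\<bar>K ?h x - K ?h y\<bar> < \<epsilon> / 4" using \<delta>(2) that by blast
    with close[OF that(1)] close[OF that(2)] \<open>\<epsilon> > 0\<close> show ?thesis by linarith
  qed
  with \<delta>(1) show "\<exists>\<delta>>0. \<forall>x\<in>X. \<forall>y\<in>X. dM x y < \<delta> \<longrightarrow> \<bar>K f x - K f y\<bar> < \<epsilon>" by blast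
qed

end

section \<open>The representing measure\<close>

context conformal_measure
begin

lemma Cc_measurable: "f \<in> Cc A \<Longrightarrow> f \<in> borel_measurable BX"
  by (rule continuous_map_borel_measurable) (simp add: Cc_def)

lemma Cc_bounded:
  assumes f: "f \<in> Cc A"
  obtains B where "\<forall>x\<in>X. \<bar>f x\<bar> \<le> B"
proof -
  obtain F where F: "finite F" "supported_in A F f" using Cc_supported_in[OF f] .
  have "compactin euclideanreal (f ` starting_in A F)"
    using f by (intro image_compactin[OF compactin_starting_in[OF locally_compact F(1)]]) (simp add: Cc_def)
  then have "bounded (f ` starting_in A F)" by (simp add: compact_imp_bounded)
  then obtain B where B: "B > 0" "\<forall>y\<in>f ` starting_in A F. norm y \<le> B" by (auto simp: bounded_pos)
  have "\<bar>f x\<bar> \<le> B" if "x \<in> X" for x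
  proof (cases "f x = 0")
    case False
    then have "x \<in> starting_in A F" using F(2) that by (auto simp: supported_in_def starting_in_def)
    then show ?thesis using B(2) by auto
  qed (use B(1) in simp)
  then show ?thesis using that by blast
qed

text \<open>\<open>f\<close> is bounded and lives on a set of finite measure, so its integral is
  finite; the extended last-exit identity then makes the right side integrable as well and descends
  to real integrals.\<close>

lemma Cc_pos_last_exit:
  assumes f: "f \<in> Cc_pos A" and F: "finite F" "supported_in A F f"
  shows "integrable \<mu> f \<and> integrable \<mu> (\<lambda>x. g f x * indicator (last_exit A F) x) \<and>
    (\<integral>x. f x \<partial>\<mu>) = (\<integral>x. g f x * indicator (last_exit A F) x \<partial>\<mu>)"
proof -
  have f0: "0 \<le> f x" if "x \<in> X" for x using f that by (simp add: Cc_pos_def)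
  note fm = Cc_measurable[OF Cc_pos_imp_Cc[OF f]]
  have em: "(\<lambda>x. ennreal (f x)) \<in> borel_measurable BX" using fm by measurable
  obtain B where B: "\<forall>x\<in>X. \<bar>f x\<bar> \<le> B" using Cc_bounded[OF Cc_pos_imp_Cc[OF f]] .
  have fin: "(\<integral>\<^sup>+x. ennreal (f x) \<partial>\<mu>) < \<infinity>"
  proof -
    have "(\<integral>\<^sup>+x. ennreal (f x) \<partial>\<mu>) \<le> (\<integral>\<^sup>+x. ennreal B * indicator (starting_in A F) x \<partial>\<mu>)"
    proof (rule nn_integral_mono)
      fix x assume "x \<in> space \<mu>"
      then have x: "x \<in> X" by (simp add: space_mu)
      show "ennreal (f x) \<le> ennreal B * indicator (starting_in A F) x"
      proof (cases "x \<in> starting_in A F")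
        case True
        have "f x \<le> B" using B x by fastforce
        then show ?thesis using True by (simp add: ennreal_leI)
      next
        case False
        then have "f x = 0" using F(2) x by (auto simp: supported_in_def starting_in_def)
        then show ?thesis by simp
      qed
    qed
    also have "\<dots> = ennreal B * emeasure \<mu> (starting_in A F)"
      by (intro nn_integral_cmult_indicator) (simp add: sets_mu starting_in_measurable)
    also have "\<dots> < \<infinity>"
      using conformal compactin_starting_in[OF locally_compact F(1)]
      by (simp add: Conf_def radon_measure_def ennreal_mult_less_top)
    finally show ?thesis .
  qed
  have int_f: "integrable \<mu> f"
  proof (rule integrableI_nonneg)
    show "f \<in> borel_measurable \<mu>" using fm by (simp add: measurable_mu)
    show "AE x in \<mu>. 0 \<le> f x" using f0 by (intro AE_I2) (simp add: space_mu)
  qed (use fin in simp)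
  have eq: "(\<integral>\<^sup>+x. ennreal (f x) \<partial>\<mu>) = (\<integral>\<^sup>+x. ennreal (g f x * indicator (last_exit A F) x) \<partial>\<mu>)"
  proof -
    have "(\<integral>\<^sup>+x. ennreal (f x) \<partial>\<mu>) =
        (\<integral>\<^sup>+x. G (\<lambda>y. ennreal (f y)) x * indicator (last_exit A F) x \<partial>\<mu>)"
      using F(2) by (intro last_exit_decomposition[OF F(1) em]) (auto simp: supported_in_def)
    also have "\<dots> = (\<integral>\<^sup>+x. ennreal (g f x * indicator (last_exit A F) x) \<partial>\<mu>)"
      by (intro nn_integral_cong) (simp add: space_mu potential_eq_green[OF f] indicator_def)
    finally show ?thesis .
  qed
  have gm: "(\<lambda>x. g f x * indicator (last_exit A F) x) \<in> borel_measurable \<mu>"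
  proof -
    have "(\<lambda>x. enn2real (G (\<lambda>y. ennreal (f y)) x)) \<in> borel_measurable \<mu>"
      using potential_measurable[OF em] by (simp add: measurable_mu)
    then have "g f \<in> borel_measurable \<mu>"
      by (rule measurable_cong[THEN iffD1, rotated])
        (simp add: space_mu potential_eq_green[OF f] green_nonneg[OF f])
    then show ?thesis
      using last_exit_measurable[of A F] by (intro borel_measurable_times borel_measurable_indicator) (simp_all add: sets_mu)
  qed
  have g0: "AE x in \<mu>. 0 \<le> g f x * indicator (last_exit A F) x"
    by (intro AE_I2) (simp add: space_mu green_nonneg[OF f])
  have int_g: "integrable \<mu> (\<lambda>x. g f x * indicator (last_exit A F) x)"
    by (rule integrableI_nonneg[OF gm g0]) (use fin eq in simp)
  have "(\<integral>x. f x \<partial>\<mu>) = enn2real (\<integral>\<^sup>+x. ennreal (f x) \<partial>\<mu>)"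
    using f0 fm by (intro integral_eq_nn_integral) (auto simp: measurable_mu space_mu)
  also have "\<dots> = (\<integral>x. g f x * indicator (last_exit A F) x \<partial>\<mu>)"
    unfolding eq by (rule integral_eq_nn_integral[OF gm g0, symmetric])
  finally show ?thesis using int_f int_g by blast
qed

lemma Cc_last_exit:
  assumes f: "f \<in> Cc A" and F: "finite F" "supported_in A F f"
  shows "integrable \<mu> f \<and> integrable \<mu> (\<lambda>x. g f x * indicator (last_exit A F) x) \<and>
    (\<integral>x. f x \<partial>\<mu>) = (\<integral>x. g f x * indicator (last_exit A F) x \<partial>\<mu>)"
proof -
  let ?I = "\<lambda>x. indicator (last_exit A F) x :: real"
  let ?p = "\<lambda>x. max 0 (f x)" and ?q = "\<lambda>x. max 0 ((-1) * f x + 0 * f x)"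
  have pq: "?p \<in> Cc_pos A" "?q \<in> Cc_pos A"
    by (rule Cc_pos_part[OF f], rule Cc_pos_part[OF Cc_lincomb[OF f f]])
  have sup: "supported_in A F ?p" "supported_in A F ?q" using F(2) by (auto simp: supported_in_def)
  define p where "p = ?p"
  define q where "q = ?q"
  note pqC = pq[THEN Cc_pos_imp_Cc, folded p_def q_def]
  note P = Cc_pos_last_exit[OF pq(1) F(1) sup(1), folded p_def]
    and Q = Cc_pos_last_exit[OF pq(2) F(1) sup(2), folded q_def]
  have f_eq: "f x = p x - q x" for x by (auto simp: p_def q_def max_def)
  have eqf: "f = (\<lambda>x. 1 * p x + (-1) * q x)" by (simp add: fun_eq_iff f_eq)
  have g_eq: "g f x = g p x - g q x" if "x \<in> X" for x
    using arg_cong[where f="\<lambda>h. g h x", OF eqf] green_lincomb[OF pqC that, of 1 "-1"]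
    by linarith
  have "integrable \<mu> f"
    unfolding f_eq[abs_def] using P Q by (intro Bochner_Integration.integrable_diff) simp_all
  moreover have "integrable \<mu> (\<lambda>x. g p x * ?I x - g q x * ?I x)"
    using P Q by (intro Bochner_Integration.integrable_diff) simp_all
  then have "integrable \<mu> (\<lambda>x. g f x * ?I x)"
    by (rule Bochner_Integration.integrable_cong[THEN iffD1, rotated 2])
      (simp_all add: g_eq space_mu left_diff_distrib)
  moreover have "(\<integral>x. f x \<partial>\<mu>) = (\<integral>x. g f x * ?I x \<partial>\<mu>)"
  proof -
    have "(\<integral>x. f x \<partial>\<mu>) = (\<integral>x. p x \<partial>\<mu>) - (\<integral>x. q x \<partial>\<mu>)"
      unfolding f_eq using P Q by (intro Bochner_Integration.integral_diff) simp_all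
    also have "\<dots> = (\<integral>x. g p x * ?I x \<partial>\<mu>) - (\<integral>x. g q x * ?I x \<partial>\<mu>)"
      using P Q by simp
    also have "\<dots> = (\<integral>x. g p x * ?I x - g q x * ?I x \<partial>\<mu>)"
      using P Q by (intro Bochner_Integration.integral_diff[symmetric]) simp_all
    also have "\<dots> = (\<integral>x. g f x * ?I x \<partial>\<mu>)"
      by (rule Bochner_Integration.integral_cong) (simp_all add: g_eq space_mu left_diff_distrib)
    finally show ?thesis .
  qed
  ultimately show ?thesis by blast
qed

text \<open>The degenerate case, in which no normalisation is possible. The last-exit formula for
  \<open>cyl [orig]\<close> has a strictly positive Green function under the integral, so the exit
  set itself is null, and the formula for \<open>f\<close> gives 0.\<close>

lemma Cc_integral_zero:
  assumes null: "emeasure \<mu> (cylinder A [orig]) = 0" and f: "f \<in> Cc A"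
  shows "(\<integral>x. f x \<partial>\<mu>) = 0"
proof -
  obtain F0 where F0: "finite F0" "supported_in A F0 f" using Cc_supported_in[OF f] .
  define F where "F = insert orig F0"
  have F: "finite F" "supported_in A F f" using F0 by (auto simp: F_def intro: supported_in_mono)
  let ?o = "cyl [orig]"
  have oC: "?o \<in> Cc_pos A" by (rule Cc_pos_cylinder) simp
  have osup: "supported_in A F ?o" by (auto simp: supported_in_def F_def cylinder_def indicator_def)
  note O = Cc_pos_last_exit[OF oC F(1) osup]
  have "(\<integral>x. ?o x \<partial>\<mu>) = 0"
    using null by (simp add: sets_mu cylinder_measurable measure_def)
  then have "(\<integral>x. g ?o x * indicator (last_exit A F) x \<partial>\<mu>) = 0" using O by simp
  then have "AE x in \<mu>. g ?o x * indicator (last_exit A F) x = 0"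
    using O by (subst (asm) integral_nonneg_eq_0_iff_AE)
      (auto intro!: AE_I2 simp: space_mu green_nonneg[OF oC])
  then have "AE x in \<mu>. g f x * indicator (last_exit A F) x = 0"
  proof (rule AE_mp, intro AE_I2 impI)
    fix x assume "x \<in> space \<mu>" "g ?o x * indicator (last_exit A F) x = 0"
    then have "indicator (last_exit A F) x = (0::real)"
      using green_cylinder_pos[of x orig] by (simp add: space_mu)
    then show "g f x * indicator (last_exit A F) x = 0" by simp
  qed
  then have "(\<integral>x. g f x * indicator (last_exit A F) x \<partial>\<mu>) = 0"
    by (rule integral_eq_zero_AE)
  then show ?thesis using Cc_last_exit[OF f F] by simp
qed

end

section \<open>Exit laws on the completion and their weak limit\<close>

locale martin_representation =
  martin_compactification A \<phi> lam orig w C Xhat \<iota> + conformal_measure A \<phi> lam orig \<mu>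
  for A :: "'s \<Rightarrow> 's \<Rightarrow> bool" and \<phi> lam orig w C and Xhat :: "'b metric" and \<iota> \<mu>
begin

abbreviation "BY \<equiv> borel_sigma TY"
abbreviation "bdry \<equiv> boundary_in (tms A) Xhat \<iota>"
abbreviation "Kext f \<equiv> cont_extension (tms A) Xhat \<iota> (K f)"

lemma Kext:
  assumes "f \<in> Cc A"
  shows "continuous_map TY euclideanreal (Kext f)" "x \<in> X \<Longrightarrow> Kext f (\<iota> x) = K f x"
proof -
  obtain F where F: "continuous_map TY euclideanreal F" "\<forall>x\<in>X. F (\<iota> x) = K f x"
    using completion_uniform_extension[OF completion kernel_uniform[OF assms]] .
  have eq: "Kext f \<omega> = F \<omega>" if "\<omega> \<in> mspace Xhat" for \<omega>
    by (rule cont_extension_eq[OF completion F that])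
  then show "continuous_map TY euclideanreal (Kext f)"
    by (intro continuous_map_eq[OF F(1)]) simp
  show "Kext f (\<iota> x) = K f x" if "x \<in> X"
    using eq[of "\<iota> x"] F(2) that completion by (auto simp: is_completion_def Pi_iff)
qed

lemma continuous_bounded:
  assumes "continuous_map TY euclideanreal F"
  obtains B where "\<forall>\<omega>\<in>mspace Xhat. \<bar>F \<omega>\<bar> \<le> B"
proof -
  have "compactin TY (mspace Xhat)" using Xhat_compact by (simp add: compact_space_def)
  from image_compactin[OF this assms] have "bounded (F ` mspace Xhat)" by (simp add: compact_imp_bounded)
  then obtain B where "\<forall>y\<in>F ` mspace Xhat. norm y \<le> B" by (auto simp: bounded_iff)
  then show ?thesis using that by auto
qed

lemma continuous_integrable:
  assumes "prob_space \<nu>" "sets \<nu> = sets BY" "continuous_map TY euclideanreal F"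
  shows "integrable \<nu> F"
proof -
  interpret \<nu>: prob_space \<nu> by (rule assms(1))
  obtain B where "\<forall>\<omega>\<in>mspace Xhat. \<bar>F \<omega>\<bar> \<le> B" using continuous_bounded[OF assms(3)] .
  moreover have "space \<nu> = mspace Xhat" using sets_eq_imp_space_eq[OF assms(2)] by simp
  moreover have "F \<in> borel_measurable \<nu>"
    using continuous_map_borel_measurable[OF assms(3)] measurable_cong_sets[OF assms(2) refl] by blast
  ultimately show ?thesis by (intro \<nu>.integrable_const_bound[of _ B]) auto
qed

text \<open>The indicator summand of the metric makes each \<open>cyl [a]\<close> Lipschitz, hence
  extendable. At a point of \<open>X\<close> one of these extensions equals 1, so they detect the
  image of \<open>X\<close> in the completion.\<close>

lemma state_indicator_extension:
  obtains I where "\<forall>a. continuous_map TY euclideanreal (I a)"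
    "\<forall>a. \<forall>x\<in>X. I a (\<iota> x) = cyl [a] x"
proof -
  have "\<exists>I. continuous_map TY euclideanreal I \<and> (\<forall>x\<in>X. I (\<iota> x) = cyl [a] x)" for a
  proof -
    have "[a] \<in> admissible_words A"
      using transitive by (auto simp: tms_transitive_def admissible_words_def)
    then obtain j where j: "[a] = w (Suc j)" by (rule admissible_index)
    obtain L where "L \<ge> 0" "\<forall>x\<in>X. \<forall>y\<in>X. \<bar>K (cyl [a]) x - K (cyl [a]) y\<bar> \<le> L * dM x y \<and>
       \<bar>cyl [a] x - cyl [a] y\<bar> \<le> L * dM x y"
      using word_lipschitz[of j] unfolding j .
    then have "\<forall>\<epsilon>>0. \<exists>\<delta>>0. \<forall>x\<in>X. \<forall>y\<in>X. dM x y < \<delta> \<longrightarrow> \<bar>cyl [a] x - cyl [a] y\<bar> < \<epsilon>"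
      by (intro lipschitz_uniform) auto
    from completion_uniform_extension[OF completion this] show ?thesis by blast
  qed
  then show ?thesis using that by metis
qed

text \<open>\<open>orig\<close> is included from the start so that every exit law has the same total
  mass before normalisation.\<close>

definition exit_set :: "nat \<Rightarrow> 's set" where
  "exit_set n = insert orig (from_nat_into UNIV ` {..n})"

lemma finite_exit_set: "finite (exit_set n)"
  by (simp add: exit_set_def)

lemma eventually_exit_set:
  assumes "finite F" shows "\<forall>\<^sub>F n in sequentially. F \<subseteq> exit_set n"
proof -
  have "\<forall>\<^sub>F n in sequentially. b \<in> exit_set n" for b
  proof -
    obtain k where "from_nat_into (UNIV :: 's set) k = b"
      using bij_betw_from_nat_into[OF countable_states infinite_states] by (metis bij_betw_def surjD)
    then have "b \<in> exit_set n" if "n \<ge> k" for n using that by (auto simp: exit_set_def)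
    then show ?thesis by (auto simp: eventually_sequentially)
  qed
  then have "\<forall>\<^sub>F n in sequentially. \<forall>b\<in>F. b \<in> exit_set n"
    using assms by (intro eventually_ball_finite) auto
  then show ?thesis by (simp add: subset_eq)
qed

text \<open>The density of nu_F for \<open>F = exit_set n\<close>, divided by its total mass; the
  common factor is restored at the very end.\<close>

definition exit_density :: "nat \<Rightarrow> (nat \<Rightarrow> 's) \<Rightarrow> real" where
  "exit_density n x = g (cyl [orig]) x * indicator (last_exit A (exit_set n)) x / measure \<mu> (cylinder A [orig])"

definition exit_law :: "nat \<Rightarrow> 'b measure" where
  "exit_law n = distr (density \<mu> (\<lambda>x. ennreal (exit_density n x))) BY \<iota>"

lemma orig_Cc: "cyl [orig] \<in> Cc_pos A"
  by (rule Cc_pos_cylinder) simp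

lemma orig_supported: "supported_in A (exit_set n) (cyl [orig])"
  by (auto simp: supported_in_def exit_set_def cylinder_def indicator_def)

lemma orig_integral: "(\<integral>x. cyl [orig] x \<partial>\<mu>) = measure \<mu> (cylinder A [orig])"
  by (simp add: sets_mu cylinder_measurable)

lemma exit_density_nonneg: "x \<in> X \<Longrightarrow> 0 \<le> exit_density n x"
  by (simp add: exit_density_def green_nonneg[OF orig_Cc])

lemma integrable_exit_density: "integrable \<mu> (exit_density n)"
  unfolding exit_density_def
  using Cc_pos_last_exit[OF orig_Cc finite_exit_set orig_supported] by (intro integrable_divide) blast

lemma iota_measurable: "\<iota> \<in> measurable (density \<mu> h) BY"
  using continuous_map_borel_sigma[OF iota_continuous] by (simp add: measurable_mu)

lemma exit_law_integral:
  assumes F: "continuous_map TY euclideanreal F"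
  shows "(\<integral>\<omega>. F \<omega> \<partial>exit_law n) = (\<integral>x. exit_density n x * F (\<iota> x) \<partial>\<mu>)"
proof -
  have Fm: "F \<in> borel_measurable BY" by (rule continuous_map_borel_measurable[OF F])
  have "(\<integral>\<omega>. F \<omega> \<partial>exit_law n) = (\<integral>x. F (\<iota> x) \<partial>density \<mu> (\<lambda>x. ennreal (exit_density n x)))"
    unfolding exit_law_def by (rule integral_distr[OF iota_measurable Fm])
  also have "\<dots> = (\<integral>x. exit_density n x *\<^sub>R F (\<iota> x) \<partial>\<mu>)"
  proof (rule integral_density)
    show "(\<lambda>x. F (\<iota> x)) \<in> borel_measurable \<mu>"
      using measurable_compose[OF continuous_map_borel_sigma[OF iota_continuous] Fm] by (simp add: measurable_mu)
    show "exit_density n \<in> borel_measurable \<mu>"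
      using integrable_exit_density by (rule borel_measurable_integrable)
    show "AE x in \<mu>. 0 \<le> exit_density n x"
      by (intro AE_I2) (simp add: space_mu exit_density_nonneg)
  qed
  finally show ?thesis by simp
qed

context
  assumes mass: "measure \<mu> (cylinder A [orig]) > 0"
begin

text \<open>The last-exit formula for \<open>cyl [orig]\<close> identifies the integral of the
  numerator with the measure of \<open>[orig]\<close>.\<close>

lemma prob_space_exit_law: "prob_space (exit_law n)"
proof -
  have "(\<integral>x. exit_density n x \<partial>\<mu>) = 1"
    unfolding exit_density_def
    using Cc_pos_last_exit[OF orig_Cc finite_exit_set orig_supported, of n] orig_integral mass by simp
  moreover have "AE x in \<mu>. 0 \<le> exit_density n x"
    by (intro AE_I2) (simp add: space_mu exit_density_nonneg)
  ultimately have "(\<integral>\<^sup>+x. ennreal (exit_density n x) \<partial>\<mu>) = 1"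
    using nn_integral_eq_integral[OF integrable_exit_density[of n]] by simp
  then have "prob_space (density \<mu> (\<lambda>x. ennreal (exit_density n x)))"
    using borel_measurable_integrable[OF integrable_exit_density[of n]]
    by (intro prob_spaceI) (simp add: emeasure_density nn_integral_cong[of \<mu> "\<lambda>x. _ x * indicator (space \<mu>) x"] cong: nn_integral_cong)
  then show ?thesis
    unfolding exit_law_def by (rule prob_space.prob_space_distr[OF _ iota_measurable])
qed

text \<open>The density carries the denominator of the Martin kernel as a factor; it cancels and
  leaves the integrand of the last-exit formula for \<open>f\<close>.\<close>

lemma exit_law_Kext:
  assumes f: "f \<in> Cc A" and sup: "supported_in A (exit_set n) f"
  shows "(\<integral>\<omega>. Kext f \<omega> \<partial>exit_law n) = (\<integral>x. f x \<partial>\<mu>) / measure \<mu> (cylinder A [orig])"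
proof -
  have "(\<integral>\<omega>. Kext f \<omega> \<partial>exit_law n) = (\<integral>x. exit_density n x * K f x \<partial>\<mu>)"
    unfolding exit_law_integral[OF Kext(1)[OF f]]
    by (rule Bochner_Integration.integral_cong) (simp_all add: Kext(2)[OF f] space_mu)
  also have "\<dots> = (\<integral>x. g f x * indicator (last_exit A (exit_set n)) x / measure \<mu> (cylinder A [orig]) \<partial>\<mu>)"
  proof (rule Bochner_Integration.integral_cong[OF refl])
    fix x assume "x \<in> space \<mu>"
    then have "g (cyl [orig]) x \<noteq> 0" using green_cylinder_pos[of x orig] by (simp add: space_mu)
    then show "exit_density n x * K f x =
        g f x * indicator (last_exit A (exit_set n)) x / measure \<mu> (cylinder A [orig])"
      by (simp add: exit_density_def martin_kernel_def)
  qed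
  also have "\<dots> = (\<integral>x. f x \<partial>\<mu>) / measure \<mu> (cylinder A [orig])"
    using Cc_last_exit[OF f finite_exit_set sup] by simp
  finally show ?thesis .
qed

text \<open>A path leaving \<open>a\<close> enters one of the finitely many successors of \<open>a\<close>, so it does not exit
  \<open>exit_set n\<close> at time 0 once that set contains them.\<close>

lemma exit_law_state:
  assumes I: "continuous_map TY euclideanreal I" "\<And>x. x \<in> X \<Longrightarrow> I (\<iota> x) = cyl [a] x"
    and sub: "{b. A a b} \<subseteq> exit_set n"
  shows "(\<integral>\<omega>. I \<omega> \<partial>exit_law n) = 0"
proof -
  have "exit_density n x * I (\<iota> x) = 0" if x: "x \<in> X" for x
  proof -
    have "x \<notin> cylinder A [a] \<or> x \<notin> last_exit A (exit_set n)"
    proof (rule ccontr)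
      assume "\<not> ?thesis"
      then have "x 0 = a" "x 1 \<notin> exit_set n" by (auto simp: cylinder_def last_exit_def)
      moreover have "A (x 0) (x 1)" using x by (simp add: tms_def)
      ultimately show False using sub by auto
    qed
    then show ?thesis using I(2)[OF x] by (auto simp: exit_density_def)
  qed
  then show ?thesis
    unfolding exit_law_integral[OF I(1)] by (intro integral_eq_zero_AE AE_I2) (simp add: space_mu)
qed

text \<open>The boundary has not been shown to be a Borel set, so being carried by it is expressed
  through a null set \<open>N\<close> whose complement lies in the boundary.\<close>

lemma limit_law:
  obtains \<nu> N where "prob_space \<nu>" "sets \<nu> = sets BY" "N \<in> null_sets \<nu>" "mspace Xhat - N \<subseteq> bdry"
    "\<forall>f\<in>Cc A. (\<integral>\<omega>. Kext f \<omega> \<partial>\<nu>) = (\<integral>x. f x \<partial>\<mu>) / measure \<mu> (cylinder A [orig])"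
proof -
  have "sets (exit_law n) = sets BY" for n by (simp add: exit_law_def)
  from compact_metric_weak_limit[of Xhat exit_law, OF Xhat_compact prob_space_exit_law this]
  obtain r \<nu> where r: "strict_mono r" and \<nu>: "prob_space \<nu>" "sets \<nu> = sets BY"
    and lim: "\<And>F. continuous_map TY euclideanreal F \<Longrightarrow>
       (\<lambda>n. \<integral>x. F x \<partial>exit_law (r n)) \<longlonglongrightarrow> (\<integral>x. F x \<partial>\<nu>)" by blast
  interpret \<nu>: prob_space \<nu> by (rule \<nu>(1))
  have sp: "space \<nu> = mspace Xhat" using sets_eq_imp_space_eq[OF \<nu>(2)] by simp
  \<comment> \<open>For each test function of interest the integrals are constant once
    \<open>exit_set n\<close> contains a suitable finite set, so the limit equals that
    constant.\<close>
  have eventual: "(\<integral>x. F x \<partial>\<nu>) = c"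
    if F: "continuous_map TY euclideanreal F" and S: "finite S"
      and const: "\<And>n. S \<subseteq> exit_set n \<Longrightarrow> (\<integral>x. F x \<partial>exit_law n) = c" for F S c
  proof -
    have "\<forall>\<^sub>F n in sequentially. S \<subseteq> exit_set (r n)"
      by (rule eventually_subseq[OF r eventually_exit_set[OF S]])
    then have "\<forall>\<^sub>F n in sequentially. (\<integral>x. F x \<partial>exit_law (r n)) = c"
      by (rule eventually_mono) (rule const)
    then have "(\<lambda>n. \<integral>x. F x \<partial>exit_law (r n)) \<longlonglongrightarrow> c" by (rule tendsto_eventually)
    then show ?thesis using lim[OF F] by (rule LIMSEQ_unique[rotated])
  qed
  have Kint: "(\<integral>\<omega>. Kext f \<omega> \<partial>\<nu>) = (\<integral>x. f x \<partial>\<mu>) / measure \<mu> (cylinder A [orig])" if f: "f \<in> Cc A" for f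
  proof -
    obtain F where F: "finite F" "supported_in A F f" using Cc_supported_in[OF f] .
    show ?thesis
      by (rule eventual[OF Kext(1)[OF f] F(1) exit_law_Kext[OF f supported_in_mono[OF F(2)]]])
  qed
  obtain I where I: "\<forall>a. continuous_map TY euclideanreal (I a)" "\<forall>a. \<forall>x\<in>X. I a (\<iota> x) = cyl [a] x"
    by (rule state_indicator_extension)
  \<comment> \<open>\<open>I a\<close> is nonnegative by density and has limit integral 0, hence
    vanishes almost everywhere; at \<open>\<iota> x\<close> the function \<open>I (x 0)\<close>
    equals 1, which excludes the image of \<open>X\<close>.\<close>
  have "AE \<omega> in \<nu>. I a \<omega> = 0" for a
  proof -
    have "(\<integral>\<omega>. I a \<omega> \<partial>\<nu>) = 0"
      by (rule eventual[of "I a" "{b. A a b}"])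
        (use locally_compact I in \<open>auto simp: tms_locally_compact_def intro!: exit_law_state\<close>)
    moreover have "AE \<omega> in \<nu>. 0 \<le> I a \<omega>"
      using I by (intro AE_I2 continuous_extension_nonneg[OF completion]) (auto simp: sp)
    moreover have "integrable \<nu> (I a)"
      using continuous_integrable[OF \<nu>] I(1) by blast
    ultimately show ?thesis using integral_nonneg_eq_0_iff_AE by blast
  qed
  then have "AE \<omega> in \<nu>. \<forall>a\<in>UNIV. I a \<omega> = 0"
    by (intro AE_ball_countable' countable_states)
  then have "AE \<omega> in \<nu>. \<omega> \<in> bdry"
  proof (rule AE_mp, intro AE_I2 impI)
    fix \<omega> assume \<omega>: "\<omega> \<in> space \<nu>" "\<forall>a\<in>UNIV. I a \<omega> = 0"
    have "\<omega> \<noteq> \<iota> x" if x: "x \<in> X" for x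
    proof
      assume "\<omega> = \<iota> x"
      then have "I (x 0) \<omega> = cyl [x 0] x" using I(2) x by simp
      then show False using \<omega>(2) x by (simp add: cylinder_def)
    qed
    then show "\<omega> \<in> bdry" using \<omega>(1) by (auto simp: boundary_in_def sp)
  qed
  then obtain N where "N \<in> null_sets \<nu>" "{\<omega> \<in> space \<nu>. \<omega> \<notin> bdry} \<subseteq> N"
    by (auto simp: eventually_ae_filter)
  moreover from this(2) have "mspace Xhat - N \<subseteq> bdry" by (auto simp: sp)
  ultimately show ?thesis using that \<nu> Kint by blast
qed

end

text \<open>What remains after the limit is to move the law from the completion to the boundary and
  to undo the normalisation. Integrability is asserted explicitly because the integral of a
  non-integrable function is 0 by convention.\<close>

theorem boundary_representation:
  "\<exists>\<nu> :: 'b measure.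
     sets \<nu> = sets (borel_sigma (subtopology TY bdry)) \<and> finite_measure \<nu> \<and>
     (\<forall>f \<in> Cc A. integrable \<nu> (Kext f) \<and> (\<integral>x. f x \<partial>\<mu>) = (\<integral>\<omega>. Kext f \<omega> \<partial>\<nu>))"
proof -
  let ?B = "borel_sigma (subtopology TY bdry)"
  let ?c = "measure \<mu> (cylinder A [orig])"
  have spB: "space ?B = bdry" by (auto simp: boundary_in_def)
  have Km: "Kext f \<in> borel_measurable ?B" if "f \<in> Cc A" for f
    by (intro continuous_map_borel_measurable continuous_map_from_subtopology Kext(1)[OF that])
  show ?thesis
  proof (cases "?c = 0")
    case True
    then have "emeasure \<mu> (cylinder A [orig]) = 0"
      using cylinder_finite[of "[orig]"] by (simp add: emeasure_eq_ennreal_measure less_top)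
    then have "integrable (null_measure ?B) (Kext f) \<and> (\<integral>x. f x \<partial>\<mu>) = (\<integral>\<omega>. Kext f \<omega> \<partial>null_measure ?B)"
      if "f \<in> Cc A" for f
      using Km[OF that] Cc_integral_zero[OF _ that]
      by (auto simp: integrable_iff_bounded measurable_cong_sets[of "null_measure ?B" ?B])
    moreover have "finite_measure (null_measure ?B)" by (rule finite_measureI) simp
    ultimately show ?thesis by (intro exI[of _ "null_measure ?B"]) simp
  next
    case False
    then have c: "?c > 0" using measure_nonneg[of \<mu> "cylinder A [orig]"] by linarith
    obtain \<nu> N where \<nu>: "prob_space \<nu>" "sets \<nu> = sets BY" "N \<in> null_sets \<nu>" "mspace Xhat - N \<subseteq> bdry"
      "\<forall>f\<in>Cc A. (\<integral>\<omega>. Kext f \<omega> \<partial>\<nu>) = (\<integral>x. f x \<partial>\<mu>) / ?c"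
      by (rule limit_law[OF c])
    interpret \<nu>: prob_space \<nu> by (rule \<nu>(1))
    have sp: "space \<nu> = mspace Xhat" using sets_eq_imp_space_eq[OF \<nu>(2)] by simp
    define Z where "Z = mspace Xhat - N"
    have Z: "Z \<in> sets \<nu>" using \<nu>(3) by (auto simp: Z_def sp[symmetric])
    have aeZ: "AE \<omega> in \<nu>. \<omega> \<in> Z"
      using AE_not_in[OF \<nu>(3)] by (rule AE_mp) (auto intro!: AE_I2 simp: Z_def sp)
    then have "Z \<noteq> {}" using \<nu>.AE_False by auto
    then obtain z where z: "z \<in> Z" by blast
    \<comment> \<open>Restriction to the boundary is avoided, as that set may fail to be measurable.
      Instead \<open>s\<close> moves the null set off \<open>Z\<close> to one boundary point; it is
      measurable because \<open>Z\<close> is, and it changes no integral.\<close>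
    define s where "s \<omega> = (if \<omega> \<in> Z then \<omega> else z)" for \<omega>
    have s: "s \<in> measurable \<nu> ?B"
    proof (rule measurable_borel_sigmaI)
      have sb: "s \<omega> \<in> bdry" for \<omega> using z \<nu>(4) by (auto simp: s_def Z_def)
      then show "s \<in> space \<nu> \<rightarrow> topspace (subtopology TY bdry)" by (auto simp: boundary_in_def)
      fix U assume "openin (subtopology TY bdry) U"
      then obtain V where V: "openin TY V" "U = V \<inter> bdry" by (auto simp: openin_subtopology)
      have Zb: "Z \<subseteq> bdry" using \<nu>(4) by (simp add: Z_def)
      have "V \<in> sets \<nu>" using openin_borel_sigma[OF V(1)] by (simp add: \<nu>(2))
      moreover have "s -` U \<inter> space \<nu> = (V \<inter> Z) \<union> (if z \<in> V then space \<nu> - Z else {})"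
        using Zb z sets.sets_into_space[OF Z] by (auto simp: s_def V(2) split: if_splits)
      ultimately show "s -` U \<inter> space \<nu> \<in> sets \<nu>" using Z by auto
    qed
    define D where "D = distr \<nu> ?B s"
    interpret D: prob_space D unfolding D_def by (rule \<nu>.prob_space_distr[OF s])
    have mD: "measurable D = measurable ?B" by (intro ext measurable_cong_sets) (simp_all add: D_def)
    have spD: "space D = bdry" by (simp add: D_def spB del: space_borel_sigma)
    have Dint: "integrable D (Kext f)" "(\<integral>\<omega>. Kext f \<omega> \<partial>D) = (\<integral>x. f x \<partial>\<mu>) / ?c" if f: "f \<in> Cc A" for f
    proof -
      obtain B where B: "\<forall>\<omega>\<in>mspace Xhat. \<bar>Kext f \<omega>\<bar> \<le> B" using continuous_bounded[OF Kext(1)[OF f]] .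
      show "integrable D (Kext f)"
        by (rule D.integrable_const_bound[of _ B])
          (use B Km[OF f] in \<open>auto intro!: AE_I2 simp: spD boundary_in_def mD\<close>)
      have "(\<integral>\<omega>. Kext f \<omega> \<partial>D) = (\<integral>\<omega>. Kext f (s \<omega>) \<partial>\<nu>)"
        unfolding D_def by (rule integral_distr[OF s Km[OF f]])
      also have "\<dots> = (\<integral>\<omega>. Kext f \<omega> \<partial>\<nu>)"
      proof (rule integral_cong_AE)
        show "(\<lambda>\<omega>. Kext f (s \<omega>)) \<in> borel_measurable \<nu>" by (rule measurable_compose[OF s Km[OF f]])
        show "Kext f \<in> borel_measurable \<nu>"
          using continuous_map_borel_measurable[OF Kext(1)[OF f]] measurable_cong_sets[OF \<nu>(2) refl] by blast
        show "AE \<omega> in \<nu>. Kext f (s \<omega>) = Kext f \<omega>"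
          using aeZ by (rule AE_mp) (auto intro!: AE_I2 simp: s_def)
      qed
      finally show "(\<integral>\<omega>. Kext f \<omega> \<partial>D) = (\<integral>x. f x \<partial>\<mu>) / ?c" using \<nu>(5) f by simp
    qed
    \<comment> \<open>Multiplying by the mass of \<open>[orig]\<close> reverses the division in
      \<open>exit_density\<close>.\<close>
    let ?E = "density D (\<lambda>_. ennreal ?c)"
    have "integrable ?E (Kext f) \<and> (\<integral>x. f x \<partial>\<mu>) = (\<integral>\<omega>. Kext f \<omega> \<partial>?E)" if f: "f \<in> Cc A" for f
      using Dint[OF f] Km[OF f] c by (simp add: integrable_density integral_density mD)
    moreover have "finite_measure ?E"
      by (rule finite_measureI) (simp add: emeasure_density_const D.emeasure_space_1)
    moreover have "sets ?E = sets ?B" by (simp add: D_def)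
    ultimately show ?thesis by (intro exI[of _ ?E]) simp
  qed
qed

end

theorem theorem3p1:
  fixes A :: "'s \<Rightarrow> 's \<Rightarrow> bool"
    and \<phi> :: "(nat \<Rightarrow> 's) \<Rightarrow> real"
    and lam :: real
    and orig :: 's
    and w :: "nat \<Rightarrow> 's list"
    and C :: "nat \<Rightarrow> real"
    and Xhat :: "'b metric"
    and \<iota> :: "(nat \<Rightarrow> 's) \<Rightarrow> 'b"
    and \<mu> :: "(nat \<Rightarrow> 's) measure"
  assumes "countable (UNIV :: 's set)" and "infinite (UNIV :: 's set)"
    and "tms_transitive A"
    and "tms_locally_compact A"
    and "lam > 0"
    and "summable_variations A \<phi>"
    and "transient A \<phi> lam"
    and "bij_betw w {1..} (admissible_words A)"
    and "\<And>i. i \<ge> 1 \<Longrightarrow> C i > 0"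
    and "\<And>i x. i \<ge> 1 \<Longrightarrow> x \<in> tms A \<Longrightarrow>
           martin_kernel A \<phi> lam orig (indicator (cylinder A (w i))) x \<le> C i"
    and "is_completion (tms A) (martin_dist A \<phi> lam orig w C) Xhat \<iota>"
    and "\<mu> \<in> Conf A \<phi> lam"
  shows "\<exists>\<nu> :: 'b measure.
           sets \<nu> = sets (borel_sigma (subtopology (mtopology_of Xhat) (boundary_in (tms A) Xhat \<iota>))) \<and>
           finite_measure \<nu> \<and>
           (\<forall>f \<in> Cc A.
              integrable \<nu> (cont_extension (tms A) Xhat \<iota> (martin_kernel A \<phi> lam orig f)) \<and>
              (\<integral>x. f x \<partial>\<mu>) =
                (\<integral>\<omega>. cont_extension (tms A) Xhat \<iota> (martin_kernel A \<phi> lam orig f) \<omega> \<partial>\<nu>))"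
proof -
  interpret martin_representation A \<phi> lam orig w C Xhat \<iota> \<mu>
    by unfold_locales (rule assms | assumption)+
  show ?thesis by (rule boundary_representation)
qed

end
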